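(* Let $A$ be a fixed finite alphabet with $|A|\ge 2$ and let $F(A)$ be the free group with basis $A$. There is a randomized algorithm which, given $n\ge 1$, outputs the graphical representation of a size $n$ finite index subgroup of $F(A)$, distributed uniformly over the set of all size $n$ finite index subgroups of $F(A)$, and whose average case complexity is $\mathcal{O}(n)$ in the RAM (unit-cost) model and $\mathcal{O}(n\log n)$ in the bit-cost model.
   Context: An $A$-graph is a pair $\Gamma=(V,E)$ with $V$ finite and $E\subseteq V\times A\times V$ such that $(u,a,v),(u,a,v')\in E$ implies $v=v'$, and $(u,a,v),(u',a,v)\in E$ implies $u=u'$. It is connected if its underlying undirected graph is connected. A vertex is a leaf if it occurs at most once in the list of triples defining $E$ (a loop $(v,a,v)$ counts as two occurrences of $v$). Given a vertex $v$, $\Gamma$ is $v$-trim if no vertex $w\neq v$ is a leaf, and the pair $(\Gamma,v)$ is admissible if $\Gamma$ is connected and $v$-trim. By Stallings foldings, each finitely generated subgroup $H\le F(A)$ is represented by an admissible pair $(\Gamma,1)$ (with $1$ a designated vertex), unique up to isomorphism, called the graphical representation of $H$; $H$ is the set of reduced words over $A\sqcup A^{-1}$ labeling closed paths at the vertex $1$ (edges may be traversed backwards, reading the inverse letter). Conversely every admissible pair is the graphical representation of a unique finitely generated subgroup. The size of $H$ is the number of vertices of $\Gamma$. $H$ has finite index if and only if every letter $a\in A$ labels a permutation of $V(\Gamma)$, i.e. for each vertex $v$ and each $a\in A$ there is an edge of the form $(v,a,w)$. Cost models. In the RAM (unit-cost) model each integer is stored in one unit of space, and reading, writing, comparing, performing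 an arithmetic operation, and drawing an integer uniformly at random from $[0,N[$ each take one unit of time. In the bit-cost model an integer $N$ is represented in binary with length $\mathcal{O}(\log N)$, and the basic operations on integers of size at most polynomial in $n$ (reading, writing, comparison, addition, random drawing on average) take time $\mathcal{O}(\log n)$. "Average" refers to expectation over the random choices of the algorithm; constants may depend on $A$. *)

theory Defs
  imports
    "HOL-Algebra.Coset"
    "HOL-Probability.SPMF"
    "HOL-Library.Landau_Symbols"
    "HOL-Library.Log_Nat"
begin

section \<open>The free group as the group of reduced words\<close>

text \<open>The letter \<open>(a, True)\<close> stands for \<open>a\<close> and \<open>(a, False)\<close> for its formal inverse.\<close>

type_synonym 'a letter = "'a \<times> bool"
type_synonym 'a word = "'a letter list"

definition inv_letter :: "'a letter \<Rightarrow> 'a letter" where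
  "inv_letter x = (fst x, \<not> snd x)"

definition reduced_word :: "'a word \<Rightarrow> bool" where
  "reduced_word w \<longleftrightarrow> successively (\<lambda>x y. y \<noteq> inv_letter x) w"

definition push :: "'a letter \<Rightarrow> 'a word \<Rightarrow> 'a word" where
  "push x w = (case w of [] \<Rightarrow> [x] | y # w' \<Rightarrow> if y = inv_letter x then w' else x # w)"

text \<open>For a reduced word \<open>v\<close>, \<open>foldr push u v\<close> is the reduced form of \<open>u @ v\<close>.\<close>

definition free_group :: "'a set \<Rightarrow> 'a word monoid" where
  "free_group A =
     \<lparr>carrier = {w. reduced_word w \<and> fst ` set w \<subseteq> A},
      monoid.mult = (\<lambda>u v. foldr push u v),
      one = []\<rparr>"

lemma inv_letter_inv_letter [simp]: "inv_letter (inv_letter x) = x"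
  by (simp add: inv_letter_def)

lemma inv_letter_neq [simp]: "inv_letter x \<noteq> x" "x \<noteq> inv_letter x"
  by (auto simp: inv_letter_def prod_eq_iff)

lemma fst_inv_letter [simp]: "fst (inv_letter x) = fst x"
  by (simp add: inv_letter_def)

lemma reduced_Nil [simp]: "reduced_word []"
  by (simp add: reduced_word_def)

lemma reduced_Cons: "reduced_word (x # w) \<longleftrightarrow> reduced_word w \<and> (w = [] \<or> hd w \<noteq> inv_letter x)"
  by (cases w) (auto simp: reduced_word_def)

lemma reduced_push: "reduced_word w \<Longrightarrow> reduced_word (push x w)"
  by (auto simp: push_def reduced_Cons split: list.splits)

lemma push_push: "reduced_word w \<Longrightarrow> push x (push (inv_letter x) w) = w"
  by (auto simp: push_def reduced_Cons split: list.splits)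

lemma set_push: "fst ` set (push x w) \<subseteq> insert (fst x) (fst ` set w)"
  by (auto simp: push_def split: list.splits)

lemma reduced_foldr_push: "reduced_word v \<Longrightarrow> reduced_word (foldr push u v)"
  by (induction u) (auto intro: reduced_push)

lemma set_foldr_push: "fst ` set (foldr push u v) \<subseteq> fst ` set u \<union> fst ` set v"
proof (induction u)
  case (Cons x u)
  have "fst ` set (push x (foldr push u v)) \<subseteq> insert (fst x) (fst ` set (foldr push u v))"
    by (rule set_push)
  also have "\<dots> \<subseteq> fst ` set (x # u) \<union> fst ` set v"
    using Cons.IH by (simp only: list.set image_insert) blast
  finally show ?case by simp
qed auto

lemma foldr_push_push:
  assumes "reduced_word u" "reduced_word w"
  shows "foldr push (push x u) w = push x (foldr push u w)"
proof (cases "\<exists>u'. u = inv_letter x # u'")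
  case True
  then obtain u' where u: "u = inv_letter x # u'" by blast
  show ?thesis
    using push_push[of "foldr push u' w" x] reduced_foldr_push[OF assms(2)]
    by (simp add: u push_def[of x "inv_letter x # u'"])
next
  case False
  then have "push x u = x # u" by (cases u) (auto simp: push_def)
  then show ?thesis by simp
qed

lemma foldr_push_assoc:
  assumes "reduced_word v" "reduced_word w"
  shows "foldr push (foldr push u v) w = foldr push u (foldr push v w)"
  by (induction u) (auto simp: foldr_push_push assms reduced_foldr_push)

lemma foldr_push_Nil: "reduced_word u \<Longrightarrow> foldr push u [] = u"
proof (induction u)
  case (Cons x u)
  then show ?case by (cases u) (auto simp: reduced_Cons push_def)
qed simp

lemma foldr_push_inverse: "reduced_word u \<Longrightarrow> foldr push (map inv_letter (rev u)) u = []"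
proof (induction u)
  case (Cons x u)
  then show ?case by (simp add: reduced_Cons push_def)
qed simp

lemma reduced_inverse: "reduced_word u \<Longrightarrow> reduced_word (map inv_letter (rev u))"
  unfolding reduced_word_def successively_map successively_rev
  by (erule successively_mono) (auto simp: inv_letter_def prod_eq_iff)

lemma group_free_group: "group (free_group A)"
proof (rule groupI, goal_cases)
  case (1 x y)
  then have "fst ` set (foldr push x y) \<subseteq> A"
    by (intro order.trans[OF set_foldr_push]) (simp add: free_group_def)
  with 1 show ?case by (simp add: free_group_def reduced_foldr_push)
next
  case (5 x)
  then have "map inv_letter (rev x) \<in> carrier (free_group A)"
    by (auto simp: free_group_def reduced_inverse)
  moreover have "map inv_letter (rev x) \<otimes>\<^bsub>free_group A\<^esub> x = \<one>\<^bsub>free_group A\<^esub>"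
    using 5 by (simp add: free_group_def foldr_push_inverse)
  ultimately show ?case by blast
qed (auto simp: free_group_def foldr_push_assoc)


section \<open>\<open>A\<close>-graphs and graphical representations of subgroups\<close>

type_synonym ('v, 'a) agraph = "'v set \<times> ('v \<times> 'a \<times> 'v) set"

definition is_agraph :: "'a set \<Rightarrow> ('v, 'a) agraph \<Rightarrow> bool" where
  "is_agraph A = (\<lambda>(V, E).
     finite V \<and> E \<subseteq> V \<times> A \<times> V \<and>
     (\<forall>u a v v'. (u, a, v) \<in> E \<and> (u, a, v') \<in> E \<longrightarrow> v = v') \<and>
     (\<forall>u u' a v. (u, a, v) \<in> E \<and> (u', a, v) \<in> E \<longrightarrow> u = u'))"

definition connected_agraph :: "('v, 'a) agraph \<Rightarrow> bool" where
  "connected_agraph = (\<lambda>(V, E).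
     \<forall>u\<in>V. \<forall>v\<in>V. (u, v) \<in> {(x, y). \<exists>a. (x, a, y) \<in> E \<or> (y, a, x) \<in> E}\<^sup>*)"

definition occurrences :: "('v, 'a) agraph \<Rightarrow> 'v \<Rightarrow> nat" where
  "occurrences = (\<lambda>(V, E) w. card {(u, a, v) \<in> E. u = w} + card {(u, a, v) \<in> E. v = w})"

definition leaf :: "('v, 'a) agraph \<Rightarrow> 'v \<Rightarrow> bool" where
  "leaf \<Gamma> w \<longleftrightarrow> w \<in> fst \<Gamma> \<and> occurrences \<Gamma> w \<le> 1"

definition trim_at :: "('v, 'a) agraph \<Rightarrow> 'v \<Rightarrow> bool" where
  "trim_at \<Gamma> v \<longleftrightarrow> (\<forall>w\<in>fst \<Gamma>. w \<noteq> v \<longrightarrow> \<not> leaf \<Gamma> w)"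

definition admissible_pair :: "'a set \<Rightarrow> ('v, 'a) agraph \<Rightarrow> 'v \<Rightarrow> bool" where
  "admissible_pair A \<Gamma> v \<longleftrightarrow>
     is_agraph A \<Gamma> \<and> v \<in> fst \<Gamma> \<and> connected_agraph \<Gamma> \<and> trim_at \<Gamma> v"

text \<open>\<open>labels_path E w u v\<close>: some path from \<open>u\<close> to \<open>v\<close> is labelled by \<open>w\<close>.\<close>

fun labels_path :: "('v \<times> 'a \<times> 'v) set \<Rightarrow> 'a word \<Rightarrow> 'v \<Rightarrow> 'v \<Rightarrow> bool" where
  "labels_path E [] u v \<longleftrightarrow> u = v"
| "labels_path E ((a, True) # w) u v \<longleftrightarrow> (\<exists>u'. (u, a, u') \<in> E \<and> labels_path E w u' v)"
| "labels_path E ((a, False) # w) u v \<longleftrightarrow> (\<exists>u'. (u', a, u) \<in> E \<and> labels_path E w u' v)"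

definition subgroup_of_graph :: "('v, 'a) agraph \<Rightarrow> 'v \<Rightarrow> 'a word set" where
  "subgroup_of_graph \<Gamma> v = {w. reduced_word w \<and> labels_path (snd \<Gamma>) w v v}"

definition graphical_representation ::
    "'a set \<Rightarrow> 'a word set \<Rightarrow> ('v, 'a) agraph \<Rightarrow> 'v \<Rightarrow> bool" where
  "graphical_representation A H \<Gamma> v \<longleftrightarrow> admissible_pair A \<Gamma> v \<and> subgroup_of_graph \<Gamma> v = H"

text \<open>Graphical representations are unique up to isomorphism and finite, so the number of
  vertices does not depend on the representation and the vertices may be taken to be numbers.\<close>

definition has_size :: "'a set \<Rightarrow> 'a word set \<Rightarrow> nat \<Rightarrow> bool" where
  "has_size A H n \<longleftrightarrow>
     (\<exists>(\<Gamma> :: (nat, 'a) agraph) v. graphical_representation A H \<Gamma> v \<and> card (fst \<Gamma>) = n)"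

definition finite_index_subgroups :: "'a set \<Rightarrow> nat \<Rightarrow> 'a word set set" where
  "finite_index_subgroups A n =
     {H. subgroup H (free_group A) \<and> finite (rcosets\<^bsub>free_group A\<^esub> H) \<and> has_size A H n}"


section \<open>Randomized random access machines\<close>

text \<open>Structured programs over a finite number of registers and an indirectly addressed memory.
  Registers are named by constants of the program; every register and every memory
  cell holds a natural number.\<close>

datatype instr =
    Const nat nat      \<comment> \<open>\<open>Const r c\<close>: \<open>r := c\<close>\<close>
  | Move nat nat       \<comment> \<open>\<open>Move r s\<close>: \<open>r := s\<close>\<close>
  | Add nat nat nat    \<comment> \<open>\<open>Add r s t\<close>: \<open>r := s + t\<close>\<close>
  | Sub nat nat nat    \<comment> \<open>\<open>Sub r s t\<close>: \<open>r := s - t\<close>, truncated at 0\<close>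
  | Load nat nat       \<comment> \<open>\<open>Load r s\<close>: \<open>r := mem[s]\<close>\<close>
  | Store nat nat      \<comment> \<open>\<open>Store r s\<close>: \<open>mem[r] := s\<close>\<close>
  | Draw nat nat       \<comment> \<open>\<open>Draw r s\<close>: \<open>r :=\<close> uniform integer in \<open>[0, s[\<close>\<close>

datatype test = Less nat nat | Equal nat nat

datatype com =
    Skip
  | Do instr
  | Seq com com
  | If test com com
  | While test com

text \<open>The state carries two clocks, one for each cost model.\<close>

record ram =
  reg :: "nat \<Rightarrow> nat"
  mem :: "nat \<Rightarrow> nat"
  unit_time :: nat
  bit_time :: nat

text \<open>\<open>floorlog 2 N\<close> is the number of binary digits of \<open>N\<close>.  In the bit-cost model a step is
  charged the lengths of all integers that it reads, writes or uses as an address; a random draw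
  from \<open>[0, N[\<close> is charged its average cost, proportional to the length of \<open>N\<close>.\<close>

definition charge :: "nat list \<Rightarrow> ram \<Rightarrow> ram" where
  "charge xs \<sigma> =
     \<sigma>\<lparr>unit_time := unit_time \<sigma> + 1,
       bit_time := bit_time \<sigma> + 1 + sum_list (map (floorlog 2) xs)\<rparr>"

definition set_reg :: "nat \<Rightarrow> nat \<Rightarrow> ram \<Rightarrow> ram" where
  "set_reg r x \<sigma> = \<sigma>\<lparr>reg := (reg \<sigma>)(r := x)\<rparr>"

definition set_mem :: "nat \<Rightarrow> nat \<Rightarrow> ram \<Rightarrow> ram" where
  "set_mem i x \<sigma> = \<sigma>\<lparr>mem := (mem \<sigma>)(i := x)\<rparr>"

text \<open>\<open>spmf_of_set {..<0}\<close> has no mass: drawing from the empty interval aborts.\<close>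

fun exec_instr :: "instr \<Rightarrow> ram \<Rightarrow> ram spmf" where
  "exec_instr (Const r c) \<sigma> = return_spmf (set_reg r c (charge [c] \<sigma>))"
| "exec_instr (Move r s) \<sigma> = (let x = reg \<sigma> s in return_spmf (set_reg r x (charge [x] \<sigma>)))"
| "exec_instr (Add r s t) \<sigma> =
     (let x = reg \<sigma> s; y = reg \<sigma> t
      in return_spmf (set_reg r (x + y) (charge [x, y, x + y] \<sigma>)))"
| "exec_instr (Sub r s t) \<sigma> =
     (let x = reg \<sigma> s; y = reg \<sigma> t
      in return_spmf (set_reg r (x - y) (charge [x, y, x - y] \<sigma>)))"
| "exec_instr (Load r s) \<sigma> =
     (let i = reg \<sigma> s; x = mem \<sigma> i in return_spmf (set_reg r x (charge [i, x] \<sigma>)))"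
| "exec_instr (Store r s) \<sigma> =
     (let i = reg \<sigma> r; x = reg \<sigma> s in return_spmf (set_mem i x (charge [i, x] \<sigma>)))"
| "exec_instr (Draw r s) \<sigma> =
     (let N = reg \<sigma> s
      in bind_spmf (spmf_of_set {..<N})
           (\<lambda>x. return_spmf (set_reg r x (charge [N, x] \<sigma>))))"

fun holds :: "test \<Rightarrow> ram \<Rightarrow> bool" where
  "holds (Less r s) \<sigma> \<longleftrightarrow> reg \<sigma> r < reg \<sigma> s"
| "holds (Equal r s) \<sigma> \<longleftrightarrow> reg \<sigma> r = reg \<sigma> s"

fun charge_test :: "test \<Rightarrow> ram \<Rightarrow> ram" where
  "charge_test (Less r s) \<sigma> = charge [reg \<sigma> r, reg \<sigma> s] \<sigma>"
| "charge_test (Equal r s) \<sigma> = charge [reg \<sigma> r, reg \<sigma> s] \<sigma>"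

text \<open>Least fixed point: the missing mass is the probability of nontermination.\<close>

partial_function (spmf) while_loop :: "test \<Rightarrow> (ram \<Rightarrow> ram spmf) \<Rightarrow> ram \<Rightarrow> ram spmf" where
  "while_loop b body \<sigma> =
     (if holds b \<sigma> then bind_spmf (body (charge_test b \<sigma>)) (while_loop b body)
      else return_spmf (charge_test b \<sigma>))"

primrec exec :: "com \<Rightarrow> ram \<Rightarrow> ram spmf" where
  "exec Skip = return_spmf"
| "exec (Do i) = exec_instr i"
| "exec (Seq c d) = (\<lambda>\<sigma>. bind_spmf (exec c \<sigma>) (exec d))"
| "exec (If b c d) =
     (\<lambda>\<sigma>. if holds b \<sigma> then exec c (charge_test b \<sigma>) else exec d (charge_test b \<sigma>))"
| "exec (While b c) = while_loop b (exec c)"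

text \<open>Input \<open>n\<close> is given in register 0; everything else is initially 0.\<close>

definition init :: "nat \<Rightarrow> ram" where
  "init n = \<lparr>reg = (\<lambda>_. 0)(0 := n), mem = (\<lambda>_. 0), unit_time = 0, bit_time = 0\<rparr>"

definition run :: "com \<Rightarrow> nat \<Rightarrow> ram spmf" where
  "run p n = exec p (init n)"

text \<open>Output of a graph with designated vertex: the number \<open>N\<close> of vertices in register 0, the
  designated vertex in register 1, and, for each letter with code \<open>c\<close>, an array at the addresses
  \<open>c * N, \<dots>, c * N + N - 1\<close> giving the target of the edge with this letter out of each of the
  vertices \<open>0, \<dots>, N - 1\<close> (an entry that is not a vertex means that there is no edge).\<close>

definition output_graph :: "'a set \<Rightarrow> ('a \<Rightarrow> nat) \<Rightarrow> ram \<Rightarrow> (nat, 'a) agraph" where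
  "output_graph A code \<sigma> =
     (let N = reg \<sigma> 0
      in ({..<N}, {(u, a, v). u < N \<and> a \<in> A \<and> v < N \<and> mem \<sigma> (code a * N + u) = v}))"

definition output_vertex :: "ram \<Rightarrow> nat" where
  "output_vertex \<sigma> = reg \<sigma> 1"

definition expected :: "(ram \<Rightarrow> nat) \<Rightarrow> ram spmf \<Rightarrow> ennreal" where
  "expected f D = (\<integral>\<^sup>+ \<sigma>. of_nat (f \<sigma>) \<partial>measure_spmf D)"

end

theory Submission
  imports Defs "HOL-Combinatorics.Permutations"
begin

text \<open>
  The algorithm is rejection sampling.  It draws \<open>k = card A\<close> independent uniform permutations of
  \<open>{..<n}\<close> with the Fisher-Yates shuffle, tests by breadth-first search from vertex 0 whether the
  graph in which letter number \<open>c\<close> acts by the \<open>c\<close>-th permutation is connected, and starts again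
  if it is not.

  Why the output is uniform.  A subgroup has finite index iff every letter permutes the vertices of
  its graphical representation (\<open>finite_index_if_complete\<close>, \<open>complete_if_finite_index\<close>): a vertex
  without outgoing edge \<open>a\<close> yields infinitely many cosets.  So after numbering the vertices with the
  base vertex first, the subgroups in question are represented by the transitive tables of \<open>k\<close>
  permutations.  Two tables have the same subgroup iff they differ by a renumbering fixing 0, and
  by transitivity different renumberings give different tables.  Hence every subgroup has exactly
  \<open>(n - 1)!\<close> tables (\<open>card_fibre\<close>), and a uniform transitive table gives a uniform subgroup.

  Why it is fast.  A trial takes time linear in \<open>n\<close>.  Because \<open>k \<ge> 2\<close>, a union bound over the
  possible components of vertex 0 shows that at least half of all tables are transitive
  (\<open>card_intransitive_le\<close>), so the expected number of trials is at most 2.  All integers that occur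
  are at most \<open>(k + 2) * n\<close>, hence every step costs \<open>O(log n)\<close> in the bit-cost model.

  How the program is analysed.  Deterministic code is treated by a total-correctness logic
  (\<open>ensures\<close>), the shuffling loops by couplings with uniform distributions
  (\<open>rel_spmf_sampling_loop\<close>).  For the rejection loop, all that is used of the least fixed point is
  that it satisfies its defining equation: because a trial fails with probability at most one half,
  the unfolding operator is a contraction and determines the law, the support and the
  termination probability of the loop (\<open>loop_expectation\<close>), and bounds its expected time
  (\<open>expected_time_loop\<close>).
\<close>


section \<open>Paths, cancellation and cosets\<close>

lemma is_agraph_source_unique:
  assumes "is_agraph A (V, E)" "(u, a, x) \<in> E" "(u', a, x) \<in> E" shows "u = u'"
proof -
  have "\<forall>u u' a v. (u, a, v) \<in> E \<and> (u', a, v) \<in> E \<longrightarrow> u = u'"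
    using assms(1) unfolding is_agraph_def prod.case by (elim conjE)
  with assms(2,3) show ?thesis by blast
qed

lemma labels_path_append:
  "labels_path E (u @ v) p q \<longleftrightarrow> (\<exists>r. labels_path E u p r \<and> labels_path E v r q)"
proof (induction u arbitrary: p)
  case (Cons x u)
  obtain a b where "x = (a, b)" by (cases x)
  then show ?case using Cons.IH by (cases b) auto
qed simp

lemma labels_path_Cons:
  "labels_path E (x # w) p q \<longleftrightarrow> (\<exists>r. labels_path E [x] p r \<and> labels_path E w r q)"
  using labels_path_append[of E "[x]" w p q] by simp

lemma labels_path_inv_letter: "labels_path E [inv_letter x] q p \<longleftrightarrow> labels_path E [x] p q"
proof -
  obtain a b where "x = (a, b)" by (cases x)
  then show ?thesis by (cases b) (auto simp: inv_letter_def)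
qed

lemma labels_path_inverse:
  "labels_path E w p q \<Longrightarrow> labels_path E (map inv_letter (rev w)) q p"
proof (induction w arbitrary: p)
  case (Cons x w)
  then obtain r where "labels_path E [x] p r" "labels_path E w r q"
    by (subst (asm) labels_path_Cons) blast
  with Cons.IH[of r] show ?case
    by (auto simp: labels_path_append labels_path_inv_letter simp del: labels_path.simps)
qed simp

lemma labels_path_det:
  assumes "is_agraph A (V, E)" "labels_path E w p q" "labels_path E w p q'"
  shows "q = q'"
  using assms(2,3)
proof (induction w arbitrary: p)
  case (Cons x w)
  obtain a b where x: "x = (a, b)" by (cases x)
  obtain r r' where r: "labels_path E [x] p r" "labels_path E w r q"
      "labels_path E [x] p r'" "labels_path E w r' q'"
    using Cons.prems by (subst (asm) (1 2) labels_path_Cons) blast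
  have "r = r'"
    using r(1,3) assms(1) unfolding x is_agraph_def by (cases b; simp; blast)
  with Cons.IH r show ?case by blast
qed simp

text \<open>Cancelling a letter against its inverse removes a step forth and back along one edge;
  by determinism of the graph this does not move the end point of the path.\<close>

lemma labels_path_push:
  assumes "is_agraph A (V, E)" "labels_path E (x # w) p q"
  shows "labels_path E (push x w) p q"
proof (cases "\<exists>w'. w = inv_letter x # w'")
  case True
  then obtain w' where w: "w = inv_letter x # w'" by blast
  obtain r s where "labels_path E [x] p r" "labels_path E [inv_letter x] r s" "labels_path E w' s q"
    using assms(2) unfolding w
    by (subst (asm) labels_path_Cons, subst (asm) (2) labels_path_Cons) blast
  moreover from this have "labels_path E [inv_letter x] r p"
    by (simp only: labels_path_inv_letter)
  ultimately have "labels_path E w' p q"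
    using labels_path_det[OF assms(1)] by blast
  then show ?thesis by (simp add: w push_def)
next
  case False
  then have "push x w = x # w" by (cases w) (auto simp: push_def)
  with assms(2) show ?thesis by simp
qed

lemma labels_path_foldr_push:
  assumes "is_agraph A (V, E)" "labels_path E u p r" "labels_path E v r q"
  shows "labels_path E (foldr push u v) p q"
  using assms(2)
proof (induction u arbitrary: p)
  case (Cons x u)
  then obtain s where "labels_path E [x] p s" "labels_path E u s r"
    by (subst (asm) labels_path_Cons) blast
  with Cons.IH have "labels_path E (x # foldr push u v) p q"
    by (subst labels_path_Cons) blast
  with labels_path_push[OF assms(1)] show ?case by simp
qed (use assms(3) in simp)

lemma labels_path_letters:
  assumes "is_agraph A (V, E)" "labels_path E w p q"
  shows "fst ` set w \<subseteq> A"
  using assms(2)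
proof (induction w arbitrary: p)
  case (Cons x w)
  obtain a b where x: "x = (a, b)" by (cases x)
  obtain r where r: "labels_path E [x] p r" "labels_path E w r q"
    using Cons.prems by (subst (asm) labels_path_Cons) blast
  have "a \<in> A" using r(1) assms(1) by (cases b) (auto simp: x is_agraph_def)
  with Cons.IH[OF r(2)] show ?case by (simp add: x)
qed simp

lemma labels_path_vertex:
  assumes "is_agraph A (V, E)" "labels_path E w p q" "p \<in> V"
  shows "q \<in> V"
  using assms(2,3)
proof (induction w arbitrary: p)
  case (Cons x w)
  obtain a b where x: "x = (a, b)" by (cases x)
  obtain r where r: "labels_path E [x] p r" "labels_path E w r q"
    using Cons.prems by (subst (asm) labels_path_Cons) blast
  have "r \<in> V" using r(1) assms(1) by (cases b) (auto simp: x is_agraph_def)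
  with Cons.IH r(2) show ?case by blast
qed simp

lemma carrier_subgroup_of_graph:
  assumes "is_agraph A (V, E)" "reduced_word w" "labels_path E w p q"
  shows "w \<in> carrier (free_group A)"
  using assms labels_path_letters[OF assms(1,3)] by (simp add: free_group_def)

lemma inv_free_group:
  assumes "w \<in> carrier (free_group A)"
  shows "inv\<^bsub>free_group A\<^esub> w = map inv_letter (rev w)"
proof -
  have "reduced_word w" "fst ` set w \<subseteq> A" using assms by (auto simp: free_group_def)
  then have "map inv_letter (rev w) \<in> carrier (free_group A)"
    "map inv_letter (rev w) \<otimes>\<^bsub>free_group A\<^esub> w = \<one>\<^bsub>free_group A\<^esub>"
    using foldr_push_inverse[of w] by (auto simp: free_group_def reduced_inverse)
  then show ?thesis
    using group.inv_equality[OF group_free_group] assms by blast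
qed

lemma subgroup_subgroup_of_graph:
  assumes "is_agraph A (V, E)"
  shows "subgroup (subgroup_of_graph (V, E) v) (free_group A)"
proof
  show "subgroup_of_graph (V, E) v \<subseteq> carrier (free_group A)"
    using carrier_subgroup_of_graph[OF assms] by (auto simp: subgroup_of_graph_def)
  show "\<one>\<^bsub>free_group A\<^esub> \<in> subgroup_of_graph (V, E) v"
    by (simp add: free_group_def subgroup_of_graph_def)
next
  fix x y assume "x \<in> subgroup_of_graph (V, E) v" "y \<in> subgroup_of_graph (V, E) v"
  then show "x \<otimes>\<^bsub>free_group A\<^esub> y \<in> subgroup_of_graph (V, E) v"
    using labels_path_foldr_push[OF assms]
    by (auto simp: subgroup_of_graph_def free_group_def reduced_foldr_push)
next
  fix x assume x: "x \<in> subgroup_of_graph (V, E) v"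
  then have "x \<in> carrier (free_group A)"
    using carrier_subgroup_of_graph[OF assms] by (auto simp: subgroup_of_graph_def)
  with x show "inv\<^bsub>free_group A\<^esub> x \<in> subgroup_of_graph (V, E) v"
    by (simp add: inv_free_group subgroup_of_graph_def reduced_inverse labels_path_inverse)
qed

lemma coset_eq_if_same_end:
  assumes "is_agraph A (V, E)"
    and "reduced_word w" "labels_path E w v u" "reduced_word w'" "labels_path E w' v u"
  shows "subgroup_of_graph (V, E) v #>\<^bsub>free_group A\<^esub> w
    = subgroup_of_graph (V, E) v #>\<^bsub>free_group A\<^esub> w'"
proof -
  let ?h = "foldr push w' (map inv_letter (rev w))"
  have "labels_path E (map inv_letter (rev w)) u v"
    using assms(3) by (rule labels_path_inverse)
  from labels_path_foldr_push[OF assms(1,5) this]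
  have h: "?h \<in> subgroup_of_graph (V, E) v"
    using assms(2) by (simp add: subgroup_of_graph_def reduced_foldr_push reduced_inverse)
  have "foldr push ?h w = foldr push w' (foldr push (map inv_letter (rev w)) w)"
    using assms(2) by (simp add: foldr_push_assoc reduced_inverse)
  also have "\<dots> = w'"
    using assms(2,4) by (simp add: foldr_push_inverse foldr_push_Nil)
  finally have "w' = foldr push ?h w" by simp
  with h have "w' \<in> subgroup_of_graph (V, E) v #>\<^bsub>free_group A\<^esub> w"
    unfolding r_coset_def by (force simp: free_group_def)
  then show ?thesis
    using group.repr_independence[OF group_free_group] carrier_subgroup_of_graph[OF assms(1,2,3)]
      subgroup_subgroup_of_graph[OF assms(1)] by blast
qed

lemma same_end_if_coset_eq:
  assumes "is_agraph A (V, E)" "w \<in> carrier (free_group A)" "labels_path E w' v u"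
    and "subgroup_of_graph (V, E) v #>\<^bsub>free_group A\<^esub> w
      = subgroup_of_graph (V, E) v #>\<^bsub>free_group A\<^esub> w'"
  shows "labels_path E w v u"
proof -
  have "w \<in> subgroup_of_graph (V, E) v #>\<^bsub>free_group A\<^esub> w"
    using group.rcos_self[OF group_free_group assms(2) subgroup_subgroup_of_graph[OF assms(1)]] .
  then have "w \<in> subgroup_of_graph (V, E) v #>\<^bsub>free_group A\<^esub> w'"
    by (simp only: assms(4))
  then obtain h where "h \<in> subgroup_of_graph (V, E) v" "w = foldr push h w'"
    by (auto simp: free_group_def r_coset_def)
  then show ?thesis
    using labels_path_foldr_push[OF assms(1) _ assms(3)] by (simp add: subgroup_of_graph_def)
qed

lemma reduced_path:
  assumes "is_agraph A (V, E)" "labels_path E w p q"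
  obtains w' where "reduced_word w'" "labels_path E w' p q"
  using that[of "foldr push w []"] labels_path_foldr_push[OF assms, of "[]" q]
  by (simp add: reduced_foldr_push)

definition complete_agraph :: "'a set \<Rightarrow> ('v, 'a) agraph \<Rightarrow> bool" where
  "complete_agraph A = (\<lambda>(V, E). \<forall>u\<in>V. \<forall>a\<in>A. \<exists>u'. (u, a, u') \<in> E)"

lemma connected_agraph_path:
  assumes "connected_agraph (V, E)" "p \<in> V" "q \<in> V"
  shows "\<exists>w. labels_path E w p q"
proof -
  have "(p, q) \<in> {(x, y). \<exists>a. (x, a, y) \<in> E \<or> (y, a, x) \<in> E}\<^sup>*"
    using assms by (simp add: connected_agraph_def)
  then show ?thesis
  proof (induction rule: rtrancl_induct)
    case base
    show ?case by (rule exI[of _ "[]"]) simp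
  next
    case (step y z)
    then obtain w a where w: "labels_path E w p y" "(y, a, z) \<in> E \<or> (z, a, y) \<in> E" by blast
    then have "labels_path E [(a, True)] y z \<or> labels_path E [(a, False)] y z" by simp
    with w(1) show ?case using labels_path_append by metis
  qed
qed

text \<open>A vertex determines the coset of the words leading to it, and there are finitely many
  vertices.\<close>

lemma finite_index_if_complete:
  assumes "is_agraph A (V, E)" "v \<in> V" "complete_agraph A (V, E)"
  shows "finite (rcosets\<^bsub>free_group A\<^esub> (subgroup_of_graph (V, E) v))"
proof -
  let ?H = "subgroup_of_graph (V, E) v" and ?F = "free_group A"
  define K where "K u = ?H #>\<^bsub>?F\<^esub> (SOME w. reduced_word w \<and> labels_path E w v u)" for u
  have surj: "\<exists>u'. (u', a, u) \<in> E" if "u \<in> V" "a \<in> A" for u a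
  proof -
    define g where "g u = (SOME u'. (u, a, u') \<in> E)" for u
    have g: "(u, a, g u) \<in> E" if "u \<in> V" for u
    proof -
      have "\<exists>u'. (u, a, u') \<in> E"
        using assms(3) \<open>a \<in> A\<close> that by (simp add: complete_agraph_def)
      then show ?thesis unfolding g_def by (rule someI_ex)
    qed
    have "inj_on g V"
    proof (rule inj_onI)
      fix x y assume "x \<in> V" "y \<in> V" "g x = g y"
      then have "(x, a, g x) \<in> E" "(y, a, g x) \<in> E" using g[of x] g[of y] by simp_all
      then show "x = y" by (rule is_agraph_source_unique[OF assms(1)])
    qed
    moreover have "g ` V \<subseteq> V" "finite V" using g assms(1) by (auto simp: is_agraph_def)
    ultimately have "g ` V = V" using endo_inj_surj by blast
    with that(1) obtain u' where "u' \<in> V" "u = g u'" by (metis imageE)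
    with g show ?thesis by auto
  qed
  have path: "\<exists>u. u \<in> V \<and> labels_path E w p u" if "fst ` set w \<subseteq> A" "p \<in> V" for w p
    using that
  proof (induction w arbitrary: p)
    case (Cons x w)
    obtain a b where x: "x = (a, b)" by (cases x)
    have "\<exists>r. labels_path E [x] p r"
      using surj[of p a] assms(3) Cons.prems by (cases b) (auto simp: x complete_agraph_def)
    then obtain r where r: "labels_path E [x] p r" by blast
    then have "r \<in> V" using labels_path_vertex[OF assms(1)] Cons.prems by blast
    then obtain u where "u \<in> V" "labels_path E w r u" using Cons.IH[of r] Cons.prems by auto
    with r show ?case by (subst labels_path_Cons) blast
  qed auto
  have "rcosets\<^bsub>?F\<^esub> ?H \<subseteq> K ` V"
  proof
    fix X assume "X \<in> rcosets\<^bsub>?F\<^esub> ?H"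
    then obtain w where w: "w \<in> carrier ?F" "X = ?H #>\<^bsub>?F\<^esub> w" by (auto simp: RCOSETS_def)
    then have red: "reduced_word w" by (simp add: free_group_def)
    obtain u where u: "u \<in> V" "labels_path E w v u"
      using path[of w v] w(1) assms(2) by (auto simp: free_group_def)
    from someI[of "\<lambda>w. reduced_word w \<and> labels_path E w v u" w] red u(2)
    have "K u = X" unfolding K_def w(2)
      by (intro coset_eq_if_same_end[OF assms(1)]) auto
    with u show "X \<in> K ` V" by blast
  qed
  moreover have "finite V" using assms(1) by (simp add: is_agraph_def)
  ultimately show ?thesis using finite_surj by blast
qed

text \<open>If no edge labelled \<open>a\<close> leaves \<open>u\<close> and \<open>w\<close> is a reduced word leading to \<open>u\<close>, then \<open>w\<close> does
  not end with the inverse of \<open>a\<close>, so all the words \<open>w a\<^sup>m\<close> are reduced.  Their cosets differ: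
  otherwise some \<open>w a\<^sup>j\<close> with \<open>j > 0\<close> would lie in the coset of \<open>w\<close> and hence be readable.\<close>

lemma complete_if_finite_index:
  assumes "is_agraph A (V, E)" "v \<in> V" "connected_agraph (V, E)"
    and fin: "finite (rcosets\<^bsub>free_group A\<^esub> (subgroup_of_graph (V, E) v))"
  shows "complete_agraph A (V, E)"
proof (rule ccontr)
  let ?H = "subgroup_of_graph (V, E) v" and ?F = "free_group A"
  assume "\<not> ?thesis"
  then obtain u a where u: "u \<in> V" "a \<in> A" and no: "\<And>u'. (u, a, u') \<notin> E"
    by (auto simp: complete_agraph_def)
  obtain w where w: "reduced_word w" "labels_path E w v u"
    using connected_agraph_path[OF assms(3,2) u(1)] reduced_path[OF assms(1)] by metis
  define x where "x m = w @ replicate m (a, True)" for m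
  have last: "last w \<noteq> (a, False)" if "w \<noteq> []"
  proof
    assume "last w = (a, False)"
    then have "w = butlast w @ [(a, False)]" using append_butlast_last_id[OF \<open>w \<noteq> []\<close>] by simp
    then have "labels_path E (butlast w @ [(a, False)]) v u" using w(2) by simp
    then show False using no by (auto simp: labels_path_append)
  qed
  have red: "reduced_word (x m)" for m
  proof (induction m)
    case (Suc m)
    have "x (Suc m) = x m @ [(a, True)]"
      by (simp add: x_def replicate_append_same)
    moreover have "last (x m) \<noteq> (a, False)" if "x m \<noteq> []"
      using last \<open>x m \<noteq> []\<close> by (cases m) (auto simp: x_def last_append)
    ultimately show ?case using Suc
      by (auto simp: reduced_word_def successively_append_iff inv_letter_def prod_eq_iff)
  qed (use w in \<open>simp add: x_def\<close>)
  have lw: "fst ` set w \<subseteq> A" using labels_path_letters[OF assms(1) w(2)] .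
  then have car: "x m \<in> carrier ?F" for m
    using red[of m] u(2) by (auto simp: free_group_def x_def image_Un)
  have red_inv: "reduced_word (replicate l (a, False))" for l
    by (induction l) (auto simp: reduced_Cons inv_letter_def)
  have cancel: "x (j + l) \<otimes>\<^bsub>?F\<^esub> replicate l (a, False) = x j" for j l
  proof -
    have "foldr push (replicate l (a, True)) (replicate l (a, False)) = []"
      using foldr_push_inverse[OF red_inv[of l]] by (simp add: inv_letter_def)
    then have "foldr push (x (j + l)) (replicate l (a, False)) = foldr push (x j) []"
      by (simp add: x_def replicate_add)
    then show ?thesis using foldr_push_Nil[OF red] by (simp add: free_group_def)
  qed
  have inv_car: "replicate l (a, False) \<in> carrier ?F" for l
    using red_inv[of l] u(2) by (auto simp: free_group_def)
  have "inj (\<lambda>m. ?H #>\<^bsub>?F\<^esub> x m)"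
  proof (rule linorder_injI)
    fix l m :: nat assume "l < m"
    then obtain j where m: "m = Suc j + l" by (metis add.commute less_imp_Suc_add add_Suc_right)
    show "?H #>\<^bsub>?F\<^esub> x l \<noteq> ?H #>\<^bsub>?F\<^esub> x m"
    proof
      assume eq: "?H #>\<^bsub>?F\<^esub> x l = ?H #>\<^bsub>?F\<^esub> x m"
      have sub: "?H \<subseteq> carrier ?F"
        using subgroup.subset[OF subgroup_subgroup_of_graph[OF assms(1)]] .
      have "(?H #>\<^bsub>?F\<^esub> x m) #>\<^bsub>?F\<^esub> replicate l (a, False) = ?H #>\<^bsub>?F\<^esub> x (Suc j)"
        using group.coset_mult_assoc[OF group_free_group sub car[of m] inv_car[of l]] cancel[of "Suc j" l]
        by (simp only: m)
      moreover have "(?H #>\<^bsub>?F\<^esub> x l) #>\<^bsub>?F\<^esub> replicate l (a, False) = ?H #>\<^bsub>?F\<^esub> x 0"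
        using group.coset_mult_assoc[OF group_free_group sub car[of l] inv_car[of l]] cancel[of 0 l]
        by (simp only: add_0)
      ultimately have "?H #>\<^bsub>?F\<^esub> x (Suc j) = ?H #>\<^bsub>?F\<^esub> w"
        using eq by (simp add: x_def)
      then have "labels_path E (x (Suc j)) v u"
        using same_end_if_coset_eq[OF assms(1) car w(2)] by blast
      then obtain r where "labels_path E w v r" "labels_path E ((a, True) # replicate j (a, True)) r u"
        by (auto simp: x_def labels_path_append)
      then show False using no labels_path_det[OF assms(1) w(2)] by auto
    qed
  qed
  moreover have "range (\<lambda>m. ?H #>\<^bsub>?F\<^esub> x m) \<subseteq> rcosets\<^bsub>?F\<^esub> ?H"
    using car by (auto simp: RCOSETS_def)
  ultimately show False
    using fin finite_subset range_inj_infinite by blast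
qed


section \<open>Tables of permutations\<close>

text \<open>Row \<open>c\<close> of a table is the permutation by which the letter with code \<open>c\<close> acts on the
  vertices.  Tables are extensional in the row index and permutations are the identity outside
  \<open>{..<n}\<close>, so that equal graphs come from equal tables and counting tables is meaningful.\<close>

definition perm_tables :: "nat \<Rightarrow> nat \<Rightarrow> (nat \<Rightarrow> nat \<Rightarrow> nat) set" where
  "perm_tables k n = {..<k} \<rightarrow>\<^sub>E {p. p permutes {..<n}}"

definition stable :: "nat \<Rightarrow> (nat \<Rightarrow> nat \<Rightarrow> nat) \<Rightarrow> nat set \<Rightarrow> bool" where
  "stable k t S \<longleftrightarrow> (\<forall>c<k. \<forall>u\<in>S. t c u \<in> S)"

definition transitive_tables :: "nat \<Rightarrow> nat \<Rightarrow> (nat \<Rightarrow> nat \<Rightarrow> nat) set" where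
  "transitive_tables k n =
     {t \<in> perm_tables k n. \<forall>S\<subseteq>{..<n}. 0 \<in> S \<longrightarrow> stable k t S \<longrightarrow> S = {..<n}}"

definition table_graph :: "'a set \<Rightarrow> ('a \<Rightarrow> nat) \<Rightarrow> nat \<Rightarrow> (nat \<Rightarrow> nat \<Rightarrow> nat) \<Rightarrow> (nat, 'a) agraph" where
  "table_graph A code n t = ({..<n}, {(u, a, v). u < n \<and> a \<in> A \<and> v < n \<and> t (code a) u = v})"

definition table_edges :: "'a set \<Rightarrow> ('a \<Rightarrow> nat) \<Rightarrow> nat \<Rightarrow> (nat \<Rightarrow> nat \<Rightarrow> nat) \<Rightarrow> (nat \<times> 'a \<times> nat) set" where
  "table_edges A code n t = snd (table_graph A code n t)"

lemma perm_tables_permutes: "t \<in> perm_tables k n \<Longrightarrow> c < k \<Longrightarrow> t c permutes {..<n}"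
  by (auto simp: perm_tables_def)

lemma perm_tables_less: "t \<in> perm_tables k n \<Longrightarrow> c < k \<Longrightarrow> t c u < n \<longleftrightarrow> u < n"
  using permutes_in_image[OF perm_tables_permutes] by fastforce

lemma finite_perm_tables: "finite (perm_tables k n)"
  unfolding perm_tables_def by (intro finite_PiE) (auto intro: finite_permutations)

lemma perm_tables_eqI:
  assumes "t \<in> perm_tables k n" "t' \<in> perm_tables k n" "\<And>c u. c < k \<Longrightarrow> u < n \<Longrightarrow> t c u = t' c u"
  shows "t = t'"
proof (rule PiE_ext)
  show "t \<in> {..<k} \<rightarrow>\<^sub>E {p. p permutes {..<n}}" "t' \<in> {..<k} \<rightarrow>\<^sub>E {p. p permutes {..<n}}"
    using assms(1,2) by (simp_all add: perm_tables_def)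
  fix c assume "c \<in> {..<k}"
  then show "t c = t' c"
    using assms by (intro ext) (metis lessThan_iff perm_tables_permutes permutes_not_in)
qed

lemma transitive_tables_perm: "t \<in> transitive_tables k n \<Longrightarrow> t \<in> perm_tables k n"
  by (simp add: transitive_tables_def)

lemma transitive_tablesD:
  "t \<in> transitive_tables k n \<Longrightarrow> S \<subseteq> {..<n} \<Longrightarrow> 0 \<in> S \<Longrightarrow> (\<And>c u. c < k \<Longrightarrow> u \<in> S \<Longrightarrow> t c u \<in> S)
    \<Longrightarrow> S = {..<n}"
  by (auto simp: transitive_tables_def stable_def)

lemma labels_path_map:
  assumes "\<And>u a u'. (u, a, u') \<in> E \<Longrightarrow> (\<phi> u, a, \<phi> u') \<in> E'"
    and "labels_path E w p q"
  shows "labels_path E' w (\<phi> p) (\<phi> q)"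
  using assms(2)
proof (induction w arbitrary: p)
  case (Cons x w)
  obtain a b where "x = (a, b)" by (cases x)
  then show ?case using Cons assms(1) by (cases b) (auto, blast+)
qed simp

lemma labels_path_connects:
  "labels_path E w p q \<Longrightarrow> (p, q) \<in> {(x, y). \<exists>a. (x, a, y) \<in> E \<or> (y, a, x) \<in> E}\<^sup>*"
proof (induction w arbitrary: p)
  case (Cons x w)
  obtain a b where x: "x = (a, b)" by (cases x)
  obtain r where r: "labels_path E [x] p r" "labels_path E w r q"
    using Cons.prems by (subst (asm) labels_path_Cons) blast
  have "(p, r) \<in> {(x, y). \<exists>a. (x, a, y) \<in> E \<or> (y, a, x) \<in> E}"
    using r(1) by (cases b) (auto simp: x)
  with Cons.IH[OF r(2)] show ?case by (rule converse_rtrancl_into_rtrancl[rotated])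
qed simp

lemma connected_agraphI:
  assumes "\<And>p q. p \<in> V \<Longrightarrow> q \<in> V \<Longrightarrow> \<exists>w. labels_path E w p q"
  shows "connected_agraph (V, E)"
  using assms labels_path_connects unfolding connected_agraph_def by fast

locale letter_code =
  fixes A :: "'a set" and code :: "'a \<Rightarrow> nat" and k n :: nat
  assumes code: "bij_betw code A {..<k}" and k2: "k \<ge> 2" and n: "n \<ge> 1"
begin

abbreviation graph where "graph \<equiv> table_graph A code n"
abbreviation edges where "edges \<equiv> table_edges A code n"
abbreviation grp where "grp t \<equiv> subgroup_of_graph (graph t) 0"

lemma code_less: "a \<in> A \<Longrightarrow> code a < k"
  using code by (auto simp: bij_betw_def)

lemma decode: "c < k \<Longrightarrow> \<exists>a\<in>A. code a = c"
  using code unfolding bij_betw_def by (metis imageE lessThan_iff)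

lemma graph_eq: "graph t = ({..<n}, edges t)"
  by (simp add: table_graph_def table_edges_def)

lemma edges_iff: "(u, a, v) \<in> edges t \<longleftrightarrow> u < n \<and> a \<in> A \<and> v < n \<and> t (code a) u = v"
  by (simp add: table_graph_def table_edges_def)

lemma is_agraph_table:
  assumes "t \<in> perm_tables k n" shows "is_agraph A ({..<n}, edges t)"
proof -
  have "u = u'" if "a \<in> A" "t (code a) u = t (code a) u'" for u u' a
    using permutes_inj[OF perm_tables_permutes[OF assms code_less[OF that(1)]]] that(2)
    by (rule injD)
  then show ?thesis unfolding is_agraph_def by (auto simp: edges_iff)
qed

lemma complete_table:
  assumes "t \<in> perm_tables k n" shows "complete_agraph A ({..<n}, edges t)"
  using perm_tables_less[OF assms code_less] by (auto simp: complete_agraph_def edges_iff)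

lemma path_from_base:
  assumes "t \<in> transitive_tables k n" "u < n"
  shows "\<exists>w. labels_path (edges t) w 0 u"
proof -
  let ?S = "{u. u < n \<and> (\<exists>w. labels_path (edges t) w 0 u)}"
  have "?S = {..<n}"
  proof (rule transitive_tablesD[OF assms(1)])
    have "labels_path (edges t) [] 0 0" by simp
    then show "0 \<in> ?S" using n by (intro CollectI conjI exI[of _ "[]"]) auto
    fix c u assume c: "c < k" and "u \<in> ?S"
    then obtain w where w: "u < n" "labels_path (edges t) w 0 u" by blast
    from decode[OF c] obtain a where a: "a \<in> A" "code a = c" by blast
    have lt: "t c u < n" using perm_tables_less[OF transitive_tables_perm[OF assms(1)] c] w(1) by blast
    have "labels_path (edges t) [(a, True)] u (t c u)"
      using a w(1) lt by (simp add: edges_iff)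
    with w(2) have "labels_path (edges t) (w @ [(a, True)]) 0 (t c u)"
      unfolding labels_path_append by blast
    with lt show "t c u \<in> ?S" by blast
  qed auto
  with assms(2) show ?thesis by blast
qed

lemma connected_table:
  assumes "t \<in> transitive_tables k n" shows "connected_agraph ({..<n}, edges t)"
proof -
  have "\<exists>w. labels_path (edges t) w u v" if uv: "u < n" "v < n" for u v
  proof -
    obtain w w' where "labels_path (edges t) w 0 u" "labels_path (edges t) w' 0 v"
      using path_from_base[OF assms] uv by blast
    then have "labels_path (edges t) (map inv_letter (rev w) @ w') u v"
      unfolding labels_path_append by (blast intro: labels_path_inverse)
    then show ?thesis by blast
  qed
  then show ?thesis by (intro connected_agraphI) auto
qed

lemma no_leaf_table:
  assumes "t \<in> perm_tables k n" "u < n" shows "\<not> leaf (graph t) u"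
proof -
  have "card A = k" using bij_betw_same_card[OF code] by simp
  have eq: "{(u', a, v). (u', a, v) \<in> edges t \<and> u' = u} = (\<lambda>a. (u, a, t (code a) u)) ` A"
    using assms(2) perm_tables_less[OF assms(1) code_less] by (auto simp: edges_iff)
  have "card {(u', a, v). (u', a, v) \<in> edges t \<and> u' = u} = k"
    unfolding eq \<open>card A = k\<close>[symmetric] by (intro card_image) (simp add: inj_on_def)
  moreover have "{(u', a, v) \<in> edges t. u' = u} = {(u', a, v). (u', a, v) \<in> edges t \<and> u' = u}"
    by auto
  ultimately have "occurrences (graph t) u \<ge> k"
    by (simp add: occurrences_def graph_eq)
  with k2 show ?thesis by (simp add: leaf_def)
qed

lemma representation_table:
  assumes "t \<in> transitive_tables k n"
  shows "graphical_representation A (grp t) (graph t) 0"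
  using is_agraph_table[OF transitive_tables_perm[OF assms]] connected_table[OF assms]
    no_leaf_table[OF transitive_tables_perm[OF assms]] n
  by (auto simp: graphical_representation_def admissible_pair_def trim_at_def graph_eq)

lemma grp_in_finite_index_subgroups:
  assumes "t \<in> transitive_tables k n"
  shows "grp t \<in> finite_index_subgroups A n"
proof -
  note T = transitive_tables_perm[OF assms]
  have "finite (rcosets\<^bsub>free_group A\<^esub> (grp t))"
    unfolding graph_eq
    by (rule finite_index_if_complete[OF is_agraph_table[OF T] _ complete_table[OF T]]) (use n in auto)
  moreover have "has_size A (grp t) n"
    unfolding has_size_def using representation_table[OF assms]
    by (intro exI[of _ "graph t"] exI[of _ 0]) (simp add: graph_eq)
  ultimately show ?thesis
    using subgroup_subgroup_of_graph[OF is_agraph_table[OF T]]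
    by (simp add: finite_index_subgroups_def graph_eq)
qed

text \<open>A finite set that is closed under injections is closed under their inverses, so
  forward closure suffices to capture a connected component.\<close>

lemma transitive_if_connected:
  assumes t: "t \<in> perm_tables k n" and con: "connected_agraph ({..<n}, edges t)"
  shows "t \<in> transitive_tables k n"
  unfolding transitive_tables_def
proof (intro CollectI conjI t allI impI)
  fix S assume S: "S \<subseteq> {..<n}" "0 \<in> S" "stable k t S"
  have finS: "finite S" using S(1) finite_subset by blast
  have pre: "u \<in> S" if "c < k" "t c u \<in> S" for c u
  proof -
    have inj: "inj (t c)" using permutes_inj[OF perm_tables_permutes[OF t that(1)]] .
    then have "t c ` S = S"
      using S(3) that(1) finS by (intro endo_inj_surj) (auto simp: stable_def inj_on_def)
    then obtain u' where "u' \<in> S" "t c u' = t c u"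
      using \<open>t c u \<in> S\<close> by (metis imageE)
    with inj show ?thesis by (metis injD)
  qed
  show "S = {..<n}"
  proof (rule equalityI[OF S(1)], rule subsetI)
    fix v assume "v \<in> {..<n}"
    then have "(0, v) \<in> {(x, y). \<exists>a. (x, a, y) \<in> edges t \<or> (y, a, x) \<in> edges t}\<^sup>*"
      using con n by (auto simp: connected_agraph_def)
    then show "v \<in> S"
    proof (induction rule: rtrancl_induct)
      case (step y z)
      then show ?case
        using S(3) pre code_less by (fastforce simp: edges_iff stable_def)
    qed (fact S(2))
  qed
qed

text \<open>By \<open>complete_if_finite_index\<close> every letter permutes the vertices of any graphical
  representation of \<open>H\<close>; numbering its vertices, starting with the base vertex, gives a table.\<close>

lemma finite_index_subgroup_is_grp:
  assumes "H \<in> finite_index_subgroups A n"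
  shows "\<exists>t\<in>transitive_tables k n. grp t = H"
proof -
  obtain V :: "nat set" and E v where rep: "graphical_representation A H (V, E) v"
    and card: "card V = n" and idx: "finite (rcosets\<^bsub>free_group A\<^esub> H)"
    using assms by (auto simp: finite_index_subgroups_def has_size_def)
  have ag: "is_agraph A (V, E)" and v: "v \<in> V" and con: "connected_agraph (V, E)"
    and H: "subgroup_of_graph (V, E) v = H"
    using rep by (auto simp: graphical_representation_def admissible_pair_def)
  have comp: "complete_agraph A (V, E)"
    using complete_if_finite_index[OF ag v con] idx H by simp
  have finV: "finite V" using ag by (simp add: is_agraph_def)
  obtain \<psi> where \<psi>: "bij_betw \<psi> V {..<n}"
    using finV card by (metis ex_bij_betw_finite_nat atLeast0LessThan)
  \<comment> \<open>The transposition moves the number of the base vertex to 0.\<close>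
  define \<phi> where "\<phi> = Transposition.transpose (\<psi> v) 0 \<circ> \<psi>"
  have "\<psi> v < n" using \<psi> v by (auto simp: bij_betw_def)
  then have "bij_betw (Transposition.transpose (\<psi> v) 0) {..<n} {..<n}"
    using n by (intro permutes_imp_bij permutes_swap_id) auto
  with \<psi> have \<phi>: "bij_betw \<phi> V {..<n}" unfolding \<phi>_def by (rule bij_betw_trans)
  have \<phi>v: "\<phi> v = 0" by (simp add: \<phi>_def)
  define \<theta> where "\<theta> = the_inv_into V \<phi>"
  have \<theta>\<phi>: "\<theta> (\<phi> x) = x" if "x \<in> V" for x
    using \<phi> that by (auto simp: \<theta>_def bij_betw_def the_inv_into_f_f)
  have \<phi>\<theta>: "\<phi> (\<theta> u) = u" and \<theta>V: "\<theta> u \<in> V" if "u < n" for u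
    using \<phi> that by (auto simp: \<theta>_def bij_betw_def f_the_inv_into_f the_inv_into_into)
  define g where "g a u = (SOME u'. (u, a, u') \<in> E)" for a u
  have g: "(u, a, g a u) \<in> E" if "a \<in> A" "u \<in> V" for a u
  proof -
    have "\<exists>u'. (u, a, u') \<in> E" using comp that by (simp add: complete_agraph_def)
    then show ?thesis unfolding g_def by (rule someI_ex)
  qed
  have gV: "g a u \<in> V" if "a \<in> A" "u \<in> V" for a u
    using g[OF that] ag by (auto simp: is_agraph_def)
  have E_iff: "(u, a, u') \<in> E \<longleftrightarrow> u \<in> V \<and> a \<in> A \<and> u' = g a u" for u a u'
    using g ag unfolding is_agraph_def prod.case by (metis (no_types) in_mono mem_Sigma_iff)
  have g_inj: "u = u'" if "g a u = g a u'" "a \<in> A" "u \<in> V" "u' \<in> V" for a u u'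
    using is_agraph_source_unique[OF ag g[of a u]] g[of a u'] that by simp
  define dec where "dec = the_inv_into A code"
  have dec: "dec (code a) = a" if "a \<in> A" for a
    using code that by (auto simp: dec_def bij_betw_def the_inv_into_f_f)
  have decA: "dec c \<in> A" if "c < k" for c
    using code that by (auto simp: dec_def bij_betw_def the_inv_into_into)
  define t where "t = (\<lambda>c\<in>{..<k}. \<lambda>u. if u < n then \<phi> (g (dec c) (\<theta> u)) else u)"
  have t_perm: "t \<in> perm_tables k n"
    unfolding perm_tables_def
  proof (rule PiE_I)
    fix c assume "c \<in> {..<k}"
    then have c: "c < k" by simp
    have in_n: "t c u < n" if "u < n" for u
      using gV[OF decA[OF c] \<theta>V[OF that]] \<phi> that c by (auto simp: t_def bij_betw_def)
    have "inj_on (t c) {..<n}"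
    proof (rule inj_onI)
      fix x y assume xy: "x \<in> {..<n}" "y \<in> {..<n}" "t c x = t c y"
      then have "g (dec c) (\<theta> x) = g (dec c) (\<theta> y)"
        using c \<theta>\<phi> gV decA \<theta>V by (simp add: t_def) metis
      then have "\<theta> x = \<theta> y" using g_inj decA[OF c] \<theta>V xy by blast
      then show "x = y" using \<phi>\<theta> xy by (metis lessThan_iff)
    qed
    moreover from this have "t c ` {..<n} = {..<n}"
      by (intro endo_inj_surj) (use in_n in auto)
    ultimately have "t c permutes {..<n}"
      using c by (intro bij_imp_permutes) (auto simp: bij_betw_def t_def)
    then show "t c \<in> {p. p permutes {..<n}}" by simp
  qed (auto simp: t_def)
  have fwd: "(\<phi> u, a, \<phi> u') \<in> edges t" if "(u, a, u') \<in> E" for u a u'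
    using that \<phi> gV[of a u] code_less[of a] by (auto simp: E_iff edges_iff t_def bij_betw_def dec \<theta>\<phi>)
  have bwd: "(\<theta> u, a, \<theta> u') \<in> E" if "(u, a, u') \<in> edges t" for u a u'
    using that \<theta>V[of u] gV[of a "\<theta> u"] code_less[of a] by (auto simp: E_iff edges_iff t_def dec \<theta>\<phi>)
  have "connected_agraph ({..<n}, edges t)"
  proof (rule connected_agraphI)
    fix x y assume xy: "x \<in> {..<n}" "y \<in> {..<n}"
    then obtain w where "labels_path E w (\<theta> x) (\<theta> y)"
      using connected_agraph_path[OF con, of "\<theta> x" "\<theta> y"] \<theta>V by auto
    from labels_path_map[of E \<phi>, OF fwd this] have "labels_path (edges t) w x y"
      using \<phi>\<theta> xy by simp
    then show "\<exists>w. labels_path (edges t) w x y" by blast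
  qed
  then have tt: "t \<in> transitive_tables k n" by (rule transitive_if_connected[OF t_perm])
  have "labels_path E w v v \<longleftrightarrow> labels_path (edges t) w 0 0" for w
    using labels_path_map[of E \<phi>, OF fwd, of w v v] labels_path_map[of "edges t" \<theta>, OF bwd, of w 0 0]
      \<theta>\<phi>[OF v] \<phi>v by auto
  then have "grp t = H" using H by (auto simp: subgroup_of_graph_def graph_eq)
  with tt show ?thesis by blast
qed

lemma path_total:
  assumes "t \<in> perm_tables k n" "fst ` set w \<subseteq> A" "p < n"
  shows "\<exists>q<n. labels_path (edges t) w p q"
  using assms(2,3)
proof (induction w arbitrary: p)
  case (Cons x w)
  obtain a b where x: "x = (a, b)" by (cases x)
  have a: "a \<in> A" using Cons.prems x by simp
  note perm = perm_tables_permutes[OF assms(1) code_less[OF a]]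
  obtain q where "t (code a) q = p" using permutes_surj[OF perm] by (metis surjD)
  moreover from this have "q < n" using perm_tables_less[OF assms(1) code_less[OF a]] Cons.prems by metis
  ultimately have "\<exists>r<n. labels_path (edges t) [x] p r"
    using perm_tables_less[OF assms(1) code_less[OF a]] Cons.prems(2) a
    by (cases b) (auto simp: x edges_iff)
  then obtain r where "r < n" "labels_path (edges t) [x] p r" by blast
  moreover from this obtain q where "q < n" "labels_path (edges t) w r q"
    using Cons.IH[of r] Cons.prems by auto
  ultimately show ?case by (subst labels_path_Cons) blast
qed auto

text \<open>Words leading from the base vertex to the same vertex are those in the same coset, so the
  vertices of two tables with the same subgroup correspond to each other.\<close>

lemma same_grp_paths:
  assumes "t \<in> perm_tables k n" "t' \<in> perm_tables k n" "grp t = grp t'"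
    and "labels_path (edges t) w 0 u" "labels_path (edges t) w' 0 u"
    and "labels_path (edges t') w 0 v"
  shows "labels_path (edges t') w' 0 v"
proof -
  note ag = is_agraph_table[OF assms(1)] and ag' = is_agraph_table[OF assms(2)]
  let ?i = "map inv_letter (rev w')"
  have "labels_path (edges t) ?i u 0" using assms(5) by (rule labels_path_inverse)
  with assms(4) have "labels_path (edges t) (w @ ?i) 0 0" by (auto simp: labels_path_append)
  from labels_path_foldr_push[OF ag this, of "[]" 0]
  have "foldr push (w @ ?i) [] \<in> grp t"
    by (simp add: subgroup_of_graph_def graph_eq reduced_foldr_push del: foldr_append)
  then have h: "labels_path (edges t') (foldr push (w @ ?i) []) 0 0"
    unfolding assms(3) by (simp add: subgroup_of_graph_def graph_eq)
  have "fst ` set (w @ ?i) \<subseteq> A"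
    using labels_path_letters[OF ag assms(4)] labels_path_letters[OF ag assms(5)] by auto
  then obtain z where z: "labels_path (edges t') (w @ ?i) 0 z"
    using path_total[OF assms(2)] n by (metis less_eq_Suc_le One_nat_def)
  from labels_path_foldr_push[OF ag' this, of "[]" z] h
  have "z = 0" using labels_path_det[OF ag'] by force
  with z obtain y where y: "labels_path (edges t') w 0 y" "labels_path (edges t') ?i y 0"
    by (auto simp: labels_path_append)
  then have "y = v" using labels_path_det[OF ag' _ assms(6)] by blast
  with labels_path_inverse[OF y(2)] show ?thesis by (simp add: rev_map comp_def)
qed

lemma same_grp_conjugate:
  assumes t: "t \<in> transitive_tables k n" and t': "t' \<in> transitive_tables k n" and eq: "grp t = grp t'"
  shows "\<exists>\<sigma>. \<sigma> permutes {1..<n} \<and> (\<forall>c<k. \<forall>u<n. t' c (\<sigma> u) = \<sigma> (t c u))"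
proof -
  note p = transitive_tables_perm[OF t] and p' = transitive_tables_perm[OF t']
  note ag = is_agraph_table[OF p] and ag' = is_agraph_table[OF p']
  obtain W where W: "\<And>u. u < n \<Longrightarrow> labels_path (edges t) (W u) 0 u"
    using path_from_base[OF t] by metis
  have "\<exists>v<n. labels_path (edges t') (W u) 0 v" if "u < n" for u
    using path_total[OF p' labels_path_letters[OF ag W[OF that]]] n by simp
  then obtain s where s: "\<And>u. u < n \<Longrightarrow> s u < n \<and> labels_path (edges t') (W u) 0 (s u)"
    by metis
  have sw: "labels_path (edges t') w 0 (s u)" if "u < n" "labels_path (edges t) w 0 u" for u w
    using same_grp_paths[OF p p' eq W[OF that(1)] that(2)] s[OF that(1)] by blast
  define \<sigma> where "\<sigma> u = (if u < n then s u else u)" for u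
  have "labels_path (edges t) [] 0 0" by simp
  then have s0: "s 0 = 0" using sw[of 0 "[]"] n by simp
  have inj: "inj_on s {..<n}"
  proof (rule inj_onI)
    fix u v assume uv: "u \<in> {..<n}" "v \<in> {..<n}" "s u = s v"
    have "labels_path (edges t') (W v) 0 (s u)" using s[of v] uv by simp
    then have "labels_path (edges t) (W v) 0 u"
      using same_grp_paths[OF p' p eq[symmetric], of "W u" "s u" "W v" u] s[of u] W[of u] uv by auto
    with W uv show "u = v" using labels_path_det[OF ag] by blast
  qed
  then have "s ` {..<n} = {..<n}" using s by (intro endo_inj_surj) auto
  with inj have "bij_betw \<sigma> {..<n} {..<n}"
    by (intro bij_betw_cong[THEN iffD1, of _ s \<sigma>]) (auto simp: \<sigma>_def bij_betw_def)
  then have "\<sigma> permutes {..<n}" by (rule bij_imp_permutes) (simp add: \<sigma>_def)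
  then have "\<sigma> permutes {1..<n}"
    by (rule permutes_superset) (use n s0 in \<open>auto simp: \<sigma>_def not_less_eq_eq\<close>)
  moreover have "t' c (\<sigma> u) = \<sigma> (t c u)" if cu: "c < k" "u < n" for c u
  proof -
    obtain a where a: "a \<in> A" "code a = c" using decode[OF cu(1)] by blast
    have tn: "t c u < n" using perm_tables_less[OF p cu(1)] cu(2) by blast
    have "labels_path (edges t) (W u @ [(a, True)]) 0 (t c u)"
      using W[OF cu(2)] a cu tn by (auto simp: labels_path_append edges_iff)
    from sw[OF tn this] obtain r where r: "labels_path (edges t') (W u) 0 r" "(r, a, s (t c u)) \<in> edges t'"
      by (auto simp: labels_path_append)
    then have "r = s u" using s[OF cu(2)] labels_path_det[OF ag'] by blast
    with r(2) show ?thesis using a cu tn by (simp add: edges_iff \<sigma>_def)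
  qed
  ultimately show ?thesis by blast
qed

definition conjugate :: "(nat \<Rightarrow> nat \<Rightarrow> nat) \<Rightarrow> (nat \<Rightarrow> nat) \<Rightarrow> nat \<Rightarrow> nat \<Rightarrow> nat" where
  "conjugate t \<sigma> = (\<lambda>c\<in>{..<k}. \<sigma> \<circ> t c \<circ> inv_into UNIV \<sigma>)"

lemma conjugate_in_fibre:
  assumes t: "t \<in> transitive_tables k n" and s: "\<sigma> permutes {1..<n}"
  shows "conjugate t \<sigma> \<in> transitive_tables k n" "grp (conjugate t \<sigma>) = grp t"
proof -
  let ?t = "conjugate t \<sigma>"
  note p = transitive_tables_perm[OF t]
  have s': "\<sigma> permutes {..<n}" by (rule permutes_subset[OF s]) auto
  have s0: "\<sigma> 0 = 0" using permutes_not_in[OF s, of 0] by simp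
  have inv: "inv_into UNIV \<sigma> (\<sigma> x) = x" "\<sigma> (inv_into UNIV \<sigma> x) = x" for x using permutes_inverses[OF s] by auto
  have sn: "\<sigma> x < n \<longleftrightarrow> x < n" for x using permutes_in_image[OF s', of x] by simp
  have isn: "inv_into UNIV \<sigma> x < n \<longleftrightarrow> x < n" for x using sn[of "inv_into UNIV \<sigma> x"] inv(2) by simp
  have p': "?t \<in> perm_tables k n"
    unfolding perm_tables_def conjugate_def
    by (rule restrict_PiE[THEN iffD2])
       (use perm_tables_permutes[OF p] s' in \<open>auto intro!: permutes_compose permutes_inv\<close>)
  have fwd: "(\<sigma> u, a, \<sigma> v) \<in> edges ?t" if "(u, a, v) \<in> edges t" for u a v
    using that code_less by (auto simp: edges_iff sn conjugate_def inv)
  have bwd: "(inv_into UNIV \<sigma> u, a, inv_into UNIV \<sigma> v) \<in> edges t" if "(u, a, v) \<in> edges ?t" for u a v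
    using that code_less[of a] by (auto simp: edges_iff isn conjugate_def inv)
  have "S = {..<n}" if S: "S \<subseteq> {..<n}" "0 \<in> S" "stable k ?t S" for S
  proof -
    have "{x. \<sigma> x \<in> S} = {..<n}"
    proof (rule transitive_tablesD[OF t])
      fix c u assume c: "c < k" and u: "u \<in> {x. \<sigma> x \<in> S}"
      then have "?t c (\<sigma> u) \<in> S" using S(3) by (auto simp: stable_def)
      with c show "t c u \<in> {x. \<sigma> x \<in> S}" by (simp add: conjugate_def inv)
    qed (use S sn s0 in auto)
    then have "\<sigma> (inv_into UNIV \<sigma> x) \<in> S" if "x < n" for x using that isn by blast
    with S(1) show ?thesis by (auto simp: inv)
  qed
  with p' show "?t \<in> transitive_tables k n" by (auto simp: transitive_tables_def)
  have i0: "inv_into UNIV \<sigma> 0 = 0" using inv(1)[of 0] s0 by simp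
  have "labels_path (edges t) w 0 0 \<longleftrightarrow> labels_path (edges ?t) w 0 0" for w
    using labels_path_map[of "edges t" \<sigma>, OF fwd, of w 0 0]
      labels_path_map[of "edges ?t" "(inv_into UNIV \<sigma>)", OF bwd, of w 0 0] s0 i0 by auto
  then show "grp ?t = grp t" by (auto simp: subgroup_of_graph_def graph_eq)
qed

text \<open>The \<open>(n - 1)!\<close> renumberings that fix the base vertex act on the tables of a given subgroup:
  transitively by \<open>same_grp_conjugate\<close>, and freely because the set of vertices on which two
  renumberings with the same result agree contains 0 and is stable.\<close>

lemma card_fibre:
  assumes t: "t \<in> transitive_tables k n"
  shows "card {t' \<in> transitive_tables k n. grp t' = grp t} = fact (n - 1)"
proof -
  let ?P = "{\<sigma>. \<sigma> permutes {1..<n}}"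
  note p = transitive_tables_perm[OF t]
  have "inj_on (conjugate t) ?P"
  proof (rule inj_onI)
    fix \<sigma> \<tau> assume "\<sigma> \<in> ?P" "\<tau> \<in> ?P" and eq: "conjugate t \<sigma> = conjugate t \<tau>"
    then have s: "\<sigma> permutes {1..<n}" and r: "\<tau> permutes {1..<n}" by auto
    have com: "\<sigma> (t c (inv_into UNIV \<sigma> x)) = \<tau> (t c (inv_into UNIV \<tau> x))" if "c < k" for c x
      using fun_cong[OF fun_cong[OF eq, of c], of x] that by (simp add: conjugate_def)
    have "{u. u < n \<and> \<sigma> u = \<tau> u} = {..<n}"
    proof (rule transitive_tablesD[OF t])
      fix c u assume c: "c < k" and u: "u \<in> {u. u < n \<and> \<sigma> u = \<tau> u}"
      then have "\<sigma> (t c u) = \<tau> (t c u)"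
        using com[OF c, of "\<sigma> u"] permutes_inverses(2)[OF s, of u] permutes_inverses(2)[OF r, of u] u
        by simp
      with u show "t c u \<in> {u. u < n \<and> \<sigma> u = \<tau> u}" using perm_tables_less[OF p c] by simp
    qed (use n s r in \<open>auto simp: permutes_not_in\<close>)
    then have "\<sigma> u = \<tau> u" if "u < n" for u using that by blast
    moreover have "\<sigma> u = \<tau> u" if "\<not> u < n" for u using that s r by (simp add: permutes_not_in)
    ultimately show "\<sigma> = \<tau>" by blast
  qed
  moreover have "conjugate t ` ?P = {t' \<in> transitive_tables k n. grp t' = grp t}"
  proof (intro equalityI subsetI)
    fix t' assume "t' \<in> {t' \<in> transitive_tables k n. grp t' = grp t}"
    then have t': "t' \<in> transitive_tables k n" "grp t = grp t'" by auto
    obtain \<sigma> where s: "\<sigma> permutes {1..<n}" and c: "\<And>c u. c < k \<Longrightarrow> u < n \<Longrightarrow> t' c (\<sigma> u) = \<sigma> (t c u)"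
      using same_grp_conjugate[OF t t'] by blast
    have s': "\<sigma> permutes {..<n}" by (rule permutes_subset[OF s]) auto
    have isn: "inv_into UNIV \<sigma> x < n \<longleftrightarrow> x < n" for x
      using permutes_in_image[OF permutes_inv[OF s'], of x] by simp
    have "t' = conjugate t \<sigma>"
    proof (rule perm_tables_eqI)
      show "t' c u = conjugate t \<sigma> c u" if "c < k" "u < n" for c u
        using c[of c "inv_into UNIV \<sigma> u"] that isn permutes_inverses(1)[OF s] by (simp add: conjugate_def)
    qed (use t' conjugate_in_fibre(1)[OF t s] transitive_tables_perm in blast)+
    with s show "t' \<in> conjugate t ` ?P" by blast
  qed (use conjugate_in_fibre[OF t] in auto)
  ultimately have "card {t' \<in> transitive_tables k n. grp t' = grp t} = card ?P"
    by (metis card_image)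
  also have "\<dots> = fact (n - 1)" using card_permutations[of "{1..<n}" "n - 1"] by simp
  finally show ?thesis .
qed

end

lemma map_spmf_of_set_equal_fibres:
  assumes "finite C" and "m > 0" and fibre: "\<And>y. y \<in> f ` C \<Longrightarrow> card {x \<in> C. f x = y} = m"
  shows "map_spmf f (spmf_of_set C) = spmf_of_set (f ` C)"
proof (rule spmf_eqI)
  fix y
  have "card C = (\<Sum>y\<in>f ` C. card {x \<in> C. f x = y})"
    using sum.image_gen[OF assms(1), of "\<lambda>_. 1::nat" f] by simp
  then have card: "card C = card (f ` C) * m" using fibre by simp
  have eq: "C \<inter> f -` {y} = {x \<in> C. f x = y}" by auto
  show "spmf (map_spmf f (spmf_of_set C)) y = spmf (spmf_of_set (f ` C)) y"
  proof (cases "y \<in> f ` C")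
    case True
    then show ?thesis using fibre[OF True] \<open>m > 0\<close>
      by (simp add: spmf_map measure_spmf_of_set spmf_of_set eq card)
  next
    case False
    then have "C \<inter> f -` {y} = {}" by auto
    with False show ?thesis by (simp add: spmf_map measure_spmf_of_set spmf_of_set)
  qed
qed

context letter_code
begin

text \<open>Every subgroup has the same number of tables, so a uniform table yields a uniform subgroup.\<close>

lemma uniform_subgroups:
  "map_spmf grp (spmf_of_set (transitive_tables k n)) = spmf_of_set (finite_index_subgroups A n)"
proof -
  have "grp ` transitive_tables k n = finite_index_subgroups A n"
    using grp_in_finite_index_subgroups finite_index_subgroup_is_grp by blast
  moreover have "finite (transitive_tables k n)"
    using finite_perm_tables by (rule finite_subset[rotated]) (auto simp: transitive_tables_def)
  moreover have "card {t' \<in> transitive_tables k n. grp t' = H} = fact (n - 1)"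
    if "H \<in> grp ` transitive_tables k n" for H
    using that card_fibre by blast
  ultimately show ?thesis
    using map_spmf_of_set_equal_fibres[of "transitive_tables k n" "fact (n - 1)" grp] by simp
qed

end


section \<open>Most tables are transitive\<close>

lemma card_perm_tables: "card (perm_tables k n) = fact n ^ k"
  using card_permutations[of "{..<n}" n] by (simp add: perm_tables_def card_PiE)

text \<open>A permutation that stabilizes \<open>S\<close> is the product of a permutation of \<open>S\<close> and one of the
  complement.\<close>

lemma card_stabilizer_le:
  assumes "S \<subseteq> {..<n}"
  shows "card {p. p permutes {..<n} \<and> (\<forall>u\<in>S. p u \<in> S)} \<le> fact (card S) * fact (n - card S)"
proof -
  have finS: "finite S" using assms finite_subset by blast
  let ?P = "{p. p permutes S}" and ?Q = "{p. p permutes ({..<n} - S)}"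
  have "{p. p permutes {..<n} \<and> (\<forall>u\<in>S. p u \<in> S)} \<subseteq> (\<lambda>(p, q). p \<circ> q) ` (?P \<times> ?Q)"
  proof
    fix p assume "p \<in> {p. p permutes {..<n} \<and> (\<forall>u\<in>S. p u \<in> S)}"
    then have p: "p permutes {..<n}" and st: "\<And>u. u \<in> S \<Longrightarrow> p u \<in> S" by auto
    have inj: "inj_on p X" for X using permutes_inj[OF p] by (rule inj_on_subset) simp
    have img: "p ` S = S" using st inj finS by (intro endo_inj_surj) auto
    have comp: "p u \<in> {..<n} - S" if "u \<in> {..<n} - S" for u
    proof -
      have "p u \<notin> S" using that img permutes_inj[OF p] by (metis DiffD2 imageE injD)
      then show ?thesis using permutes_in_image[OF p, of u] that by auto
    qed
    have img': "p ` ({..<n} - S) = {..<n} - S"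
      using comp inj by (intro endo_inj_surj) auto
    define p1 where "p1 u = (if u \<in> S then p u else u)" for u
    define p2 where "p2 u = (if u \<in> {..<n} - S then p u else u)" for u
    have "bij_betw p1 S S"
      using img inj[of S] by (simp add: bij_betw_def p1_def inj_on_def image_def)
    then have "p1 permutes S" by (rule bij_imp_permutes) (simp add: p1_def)
    moreover have "bij_betw p2 ({..<n} - S) ({..<n} - S)"
    proof -
      have "bij_betw p ({..<n} - S) ({..<n} - S)" using img' inj by (simp add: bij_betw_def)
      then show ?thesis by (rule bij_betw_cong[THEN iffD1, rotated]) (simp add: p2_def)
    qed
    then have "p2 permutes ({..<n} - S)" by (rule bij_imp_permutes) (auto simp: p2_def)
    moreover have "p = p1 \<circ> p2"
    proof
      fix u
      show "p u = (p1 \<circ> p2) u"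
        using comp[of u] assms permutes_not_in[OF p, of u] by (auto simp: p1_def p2_def)
    qed
    ultimately show "p \<in> (\<lambda>(p, q). p \<circ> q) ` (?P \<times> ?Q)" by force
  qed
  moreover have "finite (?P \<times> ?Q)" using finS by (simp add: finite_permutations)
  ultimately have "card {p. p permutes {..<n} \<and> (\<forall>u\<in>S. p u \<in> S)} \<le> card (?P \<times> ?Q)"
    by (meson card_image_le card_mono finite_imageI le_trans)
  also have "\<dots> = fact (card S) * fact (n - card S)"
    using finS assms by (simp add: card_cartesian_product card_permutations card_Diff_subset)
  finally show ?thesis .
qed

lemma le_binomial: "0 < i \<Longrightarrow> i < n \<Longrightarrow> n \<le> n choose i"
proof (induction n arbitrary: i)
  case (Suc n)
  then obtain j where i: "i = Suc j" by (cases i) auto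
  show ?case
  proof (cases "j = 0")
    case False
    then have "n \<le> n choose j" using Suc i by auto
    moreover have "0 < n choose Suc j" unfolding zero_less_binomial_iff using Suc.prems i by simp
    ultimately show ?thesis unfolding i binomial_Suc_Suc by linarith
  qed (simp add: i)
qed simp

lemma card_subsets_containing:
  assumes "0 < i"
  shows "card {S. S \<subseteq> {..<n} \<and> 0 \<in> S \<and> card S = i} * n \<le> i * (n choose i)"
proof (cases n)
  case (Suc m)
  obtain j where i: "i = Suc j" using assms by (cases i) auto
  have "{S. S \<subseteq> {..<n} \<and> 0 \<in> S \<and> card S = i} \<subseteq> insert 0 ` {S. S \<subseteq> {1..<n} \<and> card S = j}"
  proof
    fix S assume "S \<in> {S. S \<subseteq> {..<n} \<and> 0 \<in> S \<and> card S = i}"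
    then have S: "S \<subseteq> {..<n}" "0 \<in> S" "card S = i" by auto
    have "finite S" using S(1) finite_subset by blast
    moreover have "S - {0} \<subseteq> {1..<n}" using S(1) by (auto simp: Suc_le_eq)
    ultimately show "S \<in> insert 0 ` {S. S \<subseteq> {1..<n} \<and> card S = j}"
      using S i by (intro image_eqI[of _ _ "S - {0}"]) auto
  qed
  moreover have fin: "finite {S. S \<subseteq> {1..<n} \<and> card S = j}" by simp
  ultimately have "card {S. S \<subseteq> {..<n} \<and> 0 \<in> S \<and> card S = i} \<le> card {S. S \<subseteq> {1..<n} \<and> card S = j}"
    by (meson card_image_le card_mono finite_imageI le_trans)
  also have "\<dots> = m choose j" using n_subsets[of "{1..<n}" j] Suc by simp
  finally have "card {S. S \<subseteq> {..<n} \<and> 0 \<in> S \<and> card S = i} * n \<le> (m choose j) * n"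
    by (rule mult_le_mono1)
  also have "\<dots> = i * (n choose i)"
    using Suc_times_binomial_eq[of m j] by (simp add: Suc i mult.commute)
  finally show ?thesis .
qed (use assms in simp)

text \<open>Union bound over the proper subsets \<open>S\<close> that contain 0 and are stable under all letters.
  For \<open>card S = i\<close> there are \<open>i / n\<close> times \<open>n choose i\<close> such sets, and each is stable under
  two independent uniform permutations with probability \<open>1 / (n choose i)\<^sup>2\<close>, where
  \<open>n choose i \<ge> n\<close>; the sum over \<open>i < n\<close> of \<open>i / n\<^sup>2\<close> is less than one half.\<close>

lemma card_intransitive_le:
  assumes k: "k \<ge> 2" and n: "n \<ge> 1"
  shows "2 * card (perm_tables k n - transitive_tables k n) \<le> card (perm_tables k n)"
proof -
  let ?U = "{S. S \<subseteq> {..<n} \<and> 0 \<in> S \<and> S \<noteq> {..<n}}"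
  let ?B = "\<lambda>S. {..<k} \<rightarrow>\<^sub>E {p. p permutes {..<n} \<and> (\<forall>u\<in>S. p u \<in> S)}"
  let ?N = "real (fact n ^ k)"
  have finU: "finite ?U" by simp
  have finB: "finite (?B S)" for S
    by (intro finite_PiE) (simp_all add: finite_permutations)
  have sub: "perm_tables k n - transitive_tables k n \<subseteq> (\<Union>S\<in>?U. ?B S)"
  proof
    fix t assume t: "t \<in> perm_tables k n - transitive_tables k n"
    then obtain S where "S \<in> ?U" "stable k t S" by (auto simp: transitive_tables_def)
    with t show "t \<in> (\<Union>S\<in>?U. ?B S)"
      by (intro UN_I[of S]) (auto simp: perm_tables_def stable_def PiE_iff)
  qed
  have each: "real (card (?B S)) \<le> ?N / (real (n choose card S))\<^sup>2" if "S \<in> ?U" for S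
  proof -
    let ?c = "n choose card S"
    have le: "card S \<le> n" using that card_mono[of "{..<n}" S] by auto
    then have c: "?c \<ge> 1" by (simp add: Suc_le_eq)
    have "fact (card S) * fact (n - card S) * ?c = fact n"
      using le by (rule binomial_fact_lemma)
    then have "real (fact (card S) * fact (n - card S)) * real ?c = real (fact n)"
      by (metis of_nat_mult)
    then have eq: "real (fact (card S) * fact (n - card S)) = real (fact n) / real ?c"
      using le by (intro eq_divide_imp) auto
    have "card (?B S) = card {p. p permutes {..<n} \<and> (\<forall>u\<in>S. p u \<in> S)} ^ k"
      by (simp add: card_PiE)
    also have "\<dots> \<le> (fact (card S) * fact (n - card S)) ^ k"
      using card_stabilizer_le that by (intro power_mono) auto
    finally have "real (card (?B S)) \<le> real ((fact (card S) * fact (n - card S)) ^ k)"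
      by (simp only: of_nat_le_iff)
    also have "\<dots> = ?N / real ?c ^ k" by (simp only: of_nat_power eq power_divide)
    also have "\<dots> \<le> ?N / real ?c ^ 2"
    proof (intro divide_left_mono power_increasing)
      have "real ?c > 0" using c by linarith
      then show "0 < real ?c ^ k * real ?c ^ 2" by simp
    qed (use c k in auto)
    finally show ?thesis .
  qed
  have "real (card (perm_tables k n - transitive_tables k n)) \<le> real (card (\<Union>S\<in>?U. ?B S))"
    using sub finU finB by (intro of_nat_mono card_mono) blast+
  also have "\<dots> \<le> real (\<Sum>S\<in>?U. card (?B S))"
    using finU by (intro of_nat_mono card_UN_le)
  also have "\<dots> \<le> (\<Sum>S\<in>?U. ?N / (real (n choose card S))\<^sup>2)"
    using each by (simp only: of_nat_sum sum_mono)
  also have "\<dots> = (\<Sum>i\<in>card ` ?U. \<Sum>S\<in>{S \<in> ?U. card S = i}. ?N / (real (n choose card S))\<^sup>2)"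
    by (rule sum.image_gen[OF finU])
  also have "\<dots> \<le> (\<Sum>i\<in>card ` ?U. ?N * real i / (real n)\<^sup>2)"
  proof (rule sum_mono)
    fix i assume "i \<in> card ` ?U"
    then obtain S where S: "S \<in> ?U" "card S = i" by blast
    then have "finite S" using finite_subset by blast
    with S have i: "0 < i" "i < n"
      using psubset_card_mono[of "{..<n}" S] by (auto simp: card_gt_0_iff)
    let ?a = "card {S. S \<subseteq> {..<n} \<and> 0 \<in> S \<and> card S = i}" and ?c = "n choose i"
    have a: "real ?a * real n \<le> real i * real ?c"
      using card_subsets_containing[OF i(1), of n] by (simp only: flip: of_nat_mult of_nat_le_iff)
    have c: "real n \<le> real ?c" using le_binomial[OF i] by simp
    have np: "real n > 0" using n by simp
    have "(\<Sum>S\<in>{S \<in> ?U. card S = i}. ?N / (real (n choose card S))\<^sup>2)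
        = real (card {S \<in> ?U. card S = i}) * (?N / (real ?c)\<^sup>2)"
      by simp
    also have "\<dots> \<le> real ?a * (?N / (real ?c)\<^sup>2)"
      by (intro mult_right_mono of_nat_mono card_mono) auto
    also have "\<dots> = ?N * (real ?a * real n) / (real n * (real ?c)\<^sup>2)"
      using np by simp
    also have "\<dots> \<le> ?N * (real i * real ?c) / (real n * (real ?c)\<^sup>2)"
      using a by (intro divide_right_mono mult_left_mono) auto
    also have "\<dots> = ?N * real i / (real n * real ?c)"
      using c np by (simp add: power2_eq_square)
    also have "\<dots> \<le> ?N * real i / (real n * real n)"
      using c np i by (intro divide_left_mono mult_left_mono mult_pos_pos) auto
    finally show "(\<Sum>S\<in>{S \<in> ?U. card S = i}. ?N / (real (n choose card S))\<^sup>2)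
        \<le> ?N * real i / (real n)\<^sup>2"
      by (simp add: power2_eq_square)
  qed
  also have "\<dots> \<le> (\<Sum>i\<in>{..<n}. ?N * real i / (real n)\<^sup>2)"
  proof (rule sum_mono2)
    show "card ` ?U \<subseteq> {..<n}" using psubset_card_mono[of "{..<n}"] by auto
  qed auto
  also have "\<dots> = ?N * real (\<Sum>i<n. i) / (real n)\<^sup>2"
    by (simp add: sum_divide_distrib sum_distrib_left)
  also have "\<dots> \<le> ?N / 2"
  proof -
    have "2 * (\<Sum>i<n. i) \<le> n * n" by (induction n) auto
    then have "2 * real (\<Sum>i<n. i) \<le> real n * real n"
      by (metis of_nat_le_iff of_nat_mult of_nat_numeral)
    then have "?N * (2 * real (\<Sum>i<n. i)) \<le> ?N * (real n * real n)" by (intro mult_left_mono) auto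
    then show ?thesis using n by (simp add: field_simps power2_eq_square)
  qed
  finally show ?thesis unfolding card_perm_tables by linarith
qed

lemma transitive_tables_nonempty: 
  assumes "k \<ge> 2" "n \<ge> 1" shows "transitive_tables k n \<noteq> {}"
proof
  assume "transitive_tables k n = {}"
  with card_intransitive_le[OF assms] show False by (simp add: card_perm_tables)
qed


section \<open>Couplings and a program logic\<close>

lemma nn_integral_bind_spmf:
  "(\<integral>\<^sup>+ y. F y \<partial>measure_spmf (bind_spmf p f)) = (\<integral>\<^sup>+ x. \<integral>\<^sup>+ y. F y \<partial>measure_spmf (f x) \<partial>measure_spmf p)"
  unfolding measure_spmf_bind comp_def
  by (rule nn_integral_bind[where B = "count_space UNIV"])
     (auto simp: space_subprob_algebra subprob_space_measure_spmf)

lemma nn_integral_rel_spmf_mono: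
  assumes "rel_spmf R p q" and "\<And>x y. R x y \<Longrightarrow> F x \<le> G y"
  shows "(\<integral>\<^sup>+ x. F x \<partial>measure_spmf p) \<le> (\<integral>\<^sup>+ y. G y \<partial>measure_spmf q)"
  using assms(1)
proof (cases rule: rel_spmfE)
  case (rel_spmf pq)
  have "(\<integral>\<^sup>+ z. F (fst z) \<partial>measure_spmf pq) \<le> (\<integral>\<^sup>+ z. G (snd z) \<partial>measure_spmf pq)"
    using rel_spmf(1) assms(2) by (intro nn_integral_mono_AE) auto
  then show ?thesis by (simp add: rel_spmf(2,3) comp_def)
qed

lemma nn_integral_rel_spmf_mono':
  assumes "rel_spmf R p q" and "\<And>x y. R x y \<Longrightarrow> G y \<le> F x"
  shows "(\<integral>\<^sup>+ y. G y \<partial>measure_spmf q) \<le> (\<integral>\<^sup>+ x. F x \<partial>measure_spmf p)"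
  using assms nn_integral_rel_spmf_mono[of "R\<inverse>\<inverse>" q p G F] by (simp add: spmf_rel_conversep)

lemma nn_integral_spmf_le:
  assumes "\<And>y. F y \<le> K" shows "(\<integral>\<^sup>+ y. F y \<partial>measure_spmf p) \<le> K"
proof -
  have "(\<integral>\<^sup>+ y. F y \<partial>measure_spmf p) \<le> (\<integral>\<^sup>+ y. K \<partial>measure_spmf p)"
    using assms by (intro nn_integral_mono)
  also have "\<dots> = K * emeasure (measure_spmf p) UNIV" by (simp add: space_measure_spmf)
  also have "\<dots> \<le> K * 1"
    by (intro mult_left_mono) (auto simp: measure_spmf.subprob_emeasure_le_1)
  finally show ?thesis by simp
qed

lemma rel_spmf_setD1:
  assumes "rel_spmf R p q" "x \<in> set_spmf p" shows "\<exists>y\<in>set_spmf q. R x y"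
  using assms(1) by (cases rule: rel_spmfE) (use assms(2) in force)

lemma bind_spmf_of_set_bij:
  assumes bij: "bij_betw (\<lambda>(x, y). g x y) (X \<times> Y) Z" and fin: "finite X" "finite Y"
  shows "bind_spmf (spmf_of_set X) (\<lambda>x. map_spmf (g x) (spmf_of_set Y)) = spmf_of_set Z"
proof -
  have "bind_spmf (spmf_of_set X) (\<lambda>x. map_spmf (g x) (spmf_of_set Y))
      = map_spmf (\<lambda>(x, y). g x y) (pair_spmf (spmf_of_set X) (spmf_of_set Y))"
    by (simp add: pair_spmf_alt_def map_spmf_conv_bind_spmf)
  also have "pair_spmf (spmf_of_set X) (spmf_of_set Y) = spmf_of_set (X \<times> Y)"
    by (rule spmf_eqI)
       (auto simp: spmf_of_set card_cartesian_product indicator_def)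
  finally show ?thesis using bij by (simp add: bij_betw_def)
qed

definition ensures :: "com \<Rightarrow> ram \<Rightarrow> (ram \<Rightarrow> bool) \<Rightarrow> bool" where
  "ensures c \<sigma> Q \<longleftrightarrow> lossless_spmf (exec c \<sigma>) \<and> (\<forall>\<sigma>'\<in>set_spmf (exec c \<sigma>). Q \<sigma>')"

lemma ensures_simps [simp]:
  "ensures Skip \<sigma> Q \<longleftrightarrow> Q \<sigma>"
  "ensures (Do (Const r x)) \<sigma> Q \<longleftrightarrow> Q (set_reg r x (charge [x] \<sigma>))"
  "ensures (Do (Move r s)) \<sigma> Q \<longleftrightarrow> Q (set_reg r (reg \<sigma> s) (charge [reg \<sigma> s] \<sigma>))"
  "ensures (Do (Add r s t)) \<sigma> Q \<longleftrightarrow>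
     Q (set_reg r (reg \<sigma> s + reg \<sigma> t) (charge [reg \<sigma> s, reg \<sigma> t, reg \<sigma> s + reg \<sigma> t] \<sigma>))"
  "ensures (Do (Load r s)) \<sigma> Q \<longleftrightarrow>
     Q (set_reg r (mem \<sigma> (reg \<sigma> s)) (charge [reg \<sigma> s, mem \<sigma> (reg \<sigma> s)] \<sigma>))"
  "ensures (Do (Store r s)) \<sigma> Q \<longleftrightarrow>
     Q (set_mem (reg \<sigma> r) (reg \<sigma> s) (charge [reg \<sigma> r, reg \<sigma> s] \<sigma>))"
  "ensures (Seq c d) \<sigma> Q \<longleftrightarrow> ensures c \<sigma> (\<lambda>\<sigma>'. ensures d \<sigma>' Q)"
  "ensures (If b c d) \<sigma> Q \<longleftrightarrow>
     (if holds b \<sigma> then ensures c (charge_test b \<sigma>) Q else ensures d (charge_test b \<sigma>) Q)"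
  by (auto simp: ensures_def Let_def set_bind_spmf bind_UNION)

lemma ensures_mono: "ensures c \<sigma> P \<Longrightarrow> (\<And>\<sigma>'. P \<sigma>' \<Longrightarrow> Q \<sigma>') \<Longrightarrow> ensures c \<sigma> Q"
  by (auto simp: ensures_def)

lemma state_simps [simp]:
  "reg (charge xs \<sigma>) = reg \<sigma>" "mem (charge xs \<sigma>) = mem \<sigma>"
  "unit_time (charge xs \<sigma>) = Suc (unit_time \<sigma>)"
  "reg (set_reg r x \<sigma>) = (reg \<sigma>)(r := x)" "mem (set_reg r x \<sigma>) = mem \<sigma>"
  "unit_time (set_reg r x \<sigma>) = unit_time \<sigma>"
  "reg (set_mem i x \<sigma>) = reg \<sigma>" "mem (set_mem i x \<sigma>) = (mem \<sigma>)(i := x)"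
  "unit_time (set_mem i x \<sigma>) = unit_time \<sigma>"
  by (simp_all add: charge_def set_reg_def set_mem_def)

lemma charge_test_simps [simp]:
  "reg (charge_test b \<sigma>) = reg \<sigma>" "mem (charge_test b \<sigma>) = mem \<sigma>"
  "unit_time (charge_test b \<sigma>) = Suc (unit_time \<sigma>)"
  "holds b (charge_test b' \<sigma>) = holds b \<sigma>"
  by (cases b; cases b'; simp)+

text \<open>Every step is charged at most three integers, so a uniform bound \<open>B\<close> on the integers bounds
  the second clock by a multiple of the first one; only unit time has to be tracked.\<close>

definition bit_bounded :: "nat \<Rightarrow> ram \<Rightarrow> bool" where
  "bit_bounded B \<sigma> \<longleftrightarrow> bit_time \<sigma> \<le> (1 + 3 * floorlog 2 B) * unit_time \<sigma>"

lemma bit_bounded_set [simp]: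
  "bit_bounded B (set_reg r x \<sigma>) = bit_bounded B \<sigma>"
  "bit_bounded B (set_mem r x \<sigma>) = bit_bounded B \<sigma>"
  by (simp_all add: bit_bounded_def set_reg_def set_mem_def)

lemma bit_bounded_charge:
  assumes "length xs \<le> 3" "\<forall>x\<in>set xs. x \<le> B" "bit_bounded B \<sigma>"
  shows "bit_bounded B (charge xs \<sigma>)"
proof -
  have "sum_list (map (floorlog 2) xs) \<le> length xs * floorlog 2 B"
    using assms(2) by (induction xs) (auto intro: add_mono floorlog_mono)
  also have "\<dots> \<le> 3 * floorlog 2 B" using assms(1) by (rule mult_le_mono1)
  finally show ?thesis using assms(3) by (simp add: bit_bounded_def charge_def algebra_simps)
qed

lemma bit_bounded_test:
  "bit_bounded B (charge_test (Less r s) \<sigma>)" "bit_bounded B (charge_test (Equal r s) \<sigma>)"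
  if "reg \<sigma> r \<le> B" "reg \<sigma> s \<le> B" "bit_bounded B \<sigma>"
  using that by (auto intro!: bit_bounded_charge)

lemma ensures_While:
  fixes m :: "ram \<Rightarrow> nat"
  assumes "I \<sigma>"
    and step: "\<And>\<sigma>. I \<sigma> \<Longrightarrow> holds b \<sigma> \<Longrightarrow> ensures c (charge_test b \<sigma>) (\<lambda>\<sigma>'. I \<sigma>' \<and> m \<sigma>' < m \<sigma>)"
    and stop: "\<And>\<sigma>. I \<sigma> \<Longrightarrow> \<not> holds b \<sigma> \<Longrightarrow> Q (charge_test b \<sigma>)"
  shows "ensures (While b c) \<sigma> Q"
  using assms(1)
proof (induction "m \<sigma>" arbitrary: \<sigma> rule: less_induct)
  case less
  show ?case
  proof (cases "holds b \<sigma>")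
    case True
    have st: "lossless_spmf (exec c (charge_test b \<sigma>))"
      "\<And>\<sigma>'. \<sigma>' \<in> set_spmf (exec c (charge_test b \<sigma>)) \<Longrightarrow> I \<sigma>' \<and> m \<sigma>' < m \<sigma>"
      using step[OF less.prems True] by (auto simp: ensures_def)
    have "ensures (While b c) \<sigma>' Q" if "\<sigma>' \<in> set_spmf (exec c (charge_test b \<sigma>))" for \<sigma>'
      using less.hyps st(2)[OF that] by blast
    with st(1) show ?thesis
      using True by (simp add: ensures_def while_loop.simps[of b "exec c" \<sigma>] set_bind_spmf bind_UNION)
  next
    case False
    then show ?thesis
      using stop[OF less.prems False] by (simp add: ensures_def while_loop.simps[of b "exec c" \<sigma>])
  qed
qed

lemma rel_spmf_Seq1:
  assumes "ensures c \<sigma> (\<lambda>\<sigma>'. rel_spmf R (exec d \<sigma>') q)"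
  shows "rel_spmf R (exec (Seq c d) \<sigma>) q"
  using assms by (auto simp: ensures_def intro: rel_spmf_bindI1)

lemma rel_spmf_Seq2:
  assumes "rel_spmf P (exec c \<sigma>) q" "\<And>\<sigma>' x. P \<sigma>' x \<Longrightarrow> ensures d \<sigma>' (\<lambda>\<sigma>''. R \<sigma>'' x)"
  shows "rel_spmf R (exec (Seq c d) \<sigma>) q"
proof -
  have "rel_spmf R (exec c \<sigma> \<bind> exec d) (q \<bind> return_spmf)"
    using assms by (intro rel_spmf_bindI[OF assms(1)]) (auto simp: ensures_def rel_spmf_return_spmf2)
  then show ?thesis by simp
qed

text \<open>The invariant is a coupling of the machine state with an abstract sample that is uniform on
  \<open>X i\<close> after \<open>i\<close> rounds; it composes round by round because the kernels \<open>K i\<close> map the uniform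
  distribution on \<open>X i\<close> to the one on \<open>X (Suc i)\<close>.\<close>

lemma rel_spmf_sampling_loop:
  assumes step: "\<And>i x \<sigma>. i < N \<Longrightarrow> x \<in> X i \<Longrightarrow> R i \<sigma> x \<Longrightarrow>
      holds b \<sigma> \<and> rel_spmf (R (Suc i)) (exec c (charge_test b \<sigma>)) (K i x)"
    and unif: "\<And>i. i < N \<Longrightarrow> bind_spmf (spmf_of_set (X i)) (K i) = spmf_of_set (X (Suc i))"
    and fin: "\<And>i. finite (X i)"
    and stop: "\<And>x \<sigma>. x \<in> X N \<Longrightarrow> R N \<sigma> x \<Longrightarrow> \<not> holds b \<sigma> \<and> Q (charge_test b \<sigma>) x"
    and start: "X 0 = {z}" "R 0 \<sigma> z"
  shows "rel_spmf Q (exec (While b c) \<sigma>) (spmf_of_set (X N))"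
proof -
  let ?W = "while_loop b (exec c)"
  have "rel_spmf Q (bind_spmf p ?W) (spmf_of_set (X N))"
    if "i \<le> N" "rel_spmf (R i) p (spmf_of_set (X i))" for i p
    using that
  proof (induction arbitrary: p rule: inc_induct)
    case base
    have "rel_spmf Q (bind_spmf p ?W) (bind_spmf (spmf_of_set (X N)) return_spmf)"
    proof (rule rel_spmf_bindI)
      show "rel_spmf (\<lambda>\<sigma> x. x \<in> X N \<and> R N \<sigma> x) p (spmf_of_set (X N))"
        using base by (rule rel_spmf_mono_strong) (simp add: fin)
      show "rel_spmf Q (?W \<sigma>) (return_spmf x)" if "x \<in> X N \<and> R N \<sigma> x" for \<sigma> x
        using stop[of x \<sigma>] that by (simp add: while_loop.simps[of b _ \<sigma>])
    qed
    then show ?case by simp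
  next
    case (step i)
    have "holds b \<sigma>" if "\<sigma> \<in> set_spmf p" for \<sigma>
      using rel_spmf_setD1[OF step.prems that] assms(1)[OF step.hyps(2)] by (auto simp: fin)
    then have "bind_spmf p ?W = bind_spmf p (\<lambda>\<sigma>. bind_spmf (exec c (charge_test b \<sigma>)) ?W)"
      by (intro bind_spmf_cong refl) (simp add: while_loop.simps[of b])
    then have eq: "bind_spmf p ?W = bind_spmf (bind_spmf p (\<lambda>\<sigma>. exec c (charge_test b \<sigma>))) ?W"
      by simp
    have "rel_spmf (R (Suc i)) (bind_spmf p (\<lambda>\<sigma>. exec c (charge_test b \<sigma>)))
        (bind_spmf (spmf_of_set (X i)) (K i))"
    proof (rule rel_spmf_bindI)
      show "rel_spmf (\<lambda>\<sigma> x. x \<in> X i \<and> R i \<sigma> x) p (spmf_of_set (X i))"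
        using step.prems by (rule rel_spmf_mono_strong) (simp add: fin)
    qed (use assms(1)[OF step.hyps(2)] in blast)
    then show ?case unfolding eq unif[OF step.hyps(2)] by (rule step.IH)
  qed
  from this[of 0 "return_spmf \<sigma>"] show ?thesis
    using start by (simp add: spmf_of_set_singleton)
qed


section \<open>Rejection sampling\<close>

lemma ennreal_inverse_2: "inverse 2 = ennreal (1 / 2)"
  using inverse_ennreal[of 2] by (simp add: inverse_eq_divide)

lemma half_pow_tendsto:
  assumes "K < \<infinity>" shows "(\<lambda>j. K * inverse 2 ^ j :: ennreal) \<longlonglongrightarrow> 0"
proof -
  obtain r where r: "K = ennreal r" "r \<ge> 0" using assms by (cases K) auto
  have "(\<lambda>j. ennreal (r * (1 / 2) ^ j)) \<longlonglongrightarrow> ennreal (r * 0)"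
    by (intro tendsto_ennrealI tendsto_mult LIMSEQ_power_zero tendsto_const) simp
  moreover have "ennreal (r * (1 / 2) ^ j) = K * inverse 2 ^ j" for j
    using r by (simp only: ennreal_inverse_2 ennreal_power ennreal_mult zero_le_power zero_le_divide_1_iff zero_le_numeral)
  ultimately show ?thesis by simp
qed

text \<open>One round draws a uniform element of \<open>T\<close>, readable from the state by \<open>f\<close>, and the loop
  stops once it lies in \<open>C\<close>, which happens with probability at least one half.  The unknown rest of
  the state may influence the later rounds, so the rounds are not assumed to be independent.\<close>

locale rejection_loop =
  fixes b :: test and c :: com and I :: "ram \<Rightarrow> bool" and T C :: "'x set" and f :: "ram \<Rightarrow> 'x"
    and m :: nat
  assumes fin: "finite T" and sub: "C \<subseteq> T" and half: "2 * card (T - C) \<le> card T" and ne: "C \<noteq> {}"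
    and trial: "\<And>\<sigma>. I \<sigma> \<Longrightarrow> holds b \<sigma> \<Longrightarrow>
      rel_spmf (\<lambda>\<sigma>' x. I \<sigma>' \<and> (holds b \<sigma>' \<longleftrightarrow> x \<notin> C) \<and> f \<sigma>' = x \<and> unit_time \<sigma>' \<le> unit_time \<sigma> + m)
        (exec c (charge_test b \<sigma>)) (spmf_of_set T)"
    and f_charge: "\<And>\<sigma>. f (charge_test b \<sigma>) = f \<sigma>"
begin

abbreviation loop where "loop \<equiv> exec (While b c)"
abbreviation body where "body \<sigma> \<equiv> exec c (charge_test b \<sigma>)"

lemma reject_le_half:
  "(\<integral>\<^sup>+ x. (if x \<notin> C then e else 0) \<partial>measure_spmf (spmf_of_set T)) \<le> e * (inverse 2::ennreal)"
proof -
  have T: "card T > 0" using fin sub ne by (auto simp: card_gt_0_iff)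
  have "(\<Sum>x\<in>T. if x \<notin> C then e else 0) = of_nat (card (T - C)) * e"
    by (simp add: sum.inter_filter[OF fin, symmetric] set_diff_eq)
  then have "(\<integral>\<^sup>+ x. (if x \<notin> C then e else 0) \<partial>measure_spmf (spmf_of_set T))
      = of_nat (card (T - C)) * e / of_nat (card T)"
    by (simp add: nn_integral_spmf_of_set)
  also have "\<dots> = e * (of_nat (card (T - C)) / of_nat (card T))"
    by (simp add: ennreal_times_divide mult.commute)
  also have "(of_nat (card (T - C)) / of_nat (card T) :: ennreal) \<le> inverse 2"
  proof -
    have "real (card (T - C)) / real (card T) \<le> 1 / 2" using half T by (simp add: field_simps)
    moreover have "(of_nat (card (T - C)) / of_nat (card T) :: ennreal)
        = ennreal (real (card (T - C)) / real (card T))"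
      using T by (simp add: divide_ennreal ennreal_of_nat_eq_real_of_nat)
    ultimately show ?thesis by (simp only: ennreal_inverse_2 ennreal_leI)
  qed
  finally show ?thesis by (simp add: mult_left_mono)
qed

text \<open>The mean of \<open>\<phi>\<close> over \<open>C\<close> solves the equation that \<open>loop_unfold\<close> imposes on an expectation
  over the final states.\<close>

lemma average_fixed_point:
  fixes \<phi> :: "'x \<Rightarrow> ennreal"
  defines "v \<equiv> (\<Sum>x\<in>C. \<phi> x) / of_nat (card C)"
  shows "(\<integral>\<^sup>+ x. (if x \<notin> C then v else \<phi> x) \<partial>measure_spmf (spmf_of_set T)) = v"
proof -
  have finC: "finite C" using sub fin finite_subset by blast
  have C0: "card C > 0" using finC ne by (simp add: card_gt_0_iff)
  have T0: "card T > 0" using fin sub ne by (auto simp: card_gt_0_iff)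
  have S: "(\<Sum>x\<in>C. \<phi> x) = of_nat (card C) * v"
    using C0 unfolding v_def by (simp add: ennreal_times_divide mult.commute ennreal_mult_divide_eq)
  have "(\<Sum>x\<in>T. if x \<notin> C then v else \<phi> x) = (\<Sum>x\<in>T - C. v) + (\<Sum>x\<in>C. \<phi> x)"
    by (subst sum.subset_diff[OF sub fin]) (intro arg_cong2[of _ _ _ _ "(+)"] sum.cong, auto)
  also have "\<dots> = of_nat (card (T - C) + card C) * v" by (simp add: S distrib_right)
  also have "card (T - C) + card C = card T"
    using card_Diff_subset[OF finC sub] card_mono[OF fin sub] by simp
  finally show ?thesis
    using T0 by (simp add: nn_integral_spmf_of_set mult.commute ennreal_mult_divide_eq)
qed

lemma loop_unfold: "holds b \<sigma> \<Longrightarrow> (\<integral>\<^sup>+ y. F y \<partial>measure_spmf (loop \<sigma>)) =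
   (\<integral>\<^sup>+ \<sigma>'. (if holds b \<sigma>' then \<integral>\<^sup>+ y. F y \<partial>measure_spmf (loop \<sigma>') else F (charge_test b \<sigma>'))
      \<partial>measure_spmf (body \<sigma>))"
proof -
  assume h: "holds b \<sigma>"
  have "(\<integral>\<^sup>+ y. F y \<partial>measure_spmf (loop \<sigma>')) = F (charge_test b \<sigma>')" if "\<not> holds b \<sigma>'" for \<sigma>'
    using that by (simp add: while_loop.simps[of b _ \<sigma>'] measure_spmf_return_spmf nn_integral_return)
  then show ?thesis
    using h by (auto simp: while_loop.simps[of b _ \<sigma>] nn_integral_bind_spmf intro!: nn_integral_cong)
qed

text \<open>Unfolding the loop once shows that the distance between the expectation and its candidate
  value, maximized over the states of \<open>I\<close>, is at most half of itself; starting from the bound \<open>K\<close>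
  it must vanish.  This determines the law of the loop, termination included, without an
  induction over approximations of the least fixed point.\<close>

lemma loop_expectation:
  fixes F :: "ram \<Rightarrow> ennreal"
  assumes bound: "\<And>y. F y \<le> K" "\<And>x. \<phi> x \<le> K" "K < \<infinity>"
    and F: "\<And>\<sigma>. I \<sigma> \<Longrightarrow> \<not> holds b \<sigma> \<Longrightarrow> F (charge_test b \<sigma>) = \<phi> (f \<sigma>)"
    and start: "I \<sigma>" "holds b \<sigma>"
  shows "(\<integral>\<^sup>+ y. F y \<partial>measure_spmf (loop \<sigma>)) = (\<Sum>x\<in>C. \<phi> x) / of_nat (card C)" (is "?g \<sigma> = ?v")
proof (rule antisym)
  let ?G = "\<lambda>\<sigma>'. if holds b \<sigma>' then ?g \<sigma>' else F (charge_test b \<sigma>')"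
  let ?U = "measure_spmf (spmf_of_set T)"
  note lim = tendsto_add[OF tendsto_const half_pow_tendsto[OF bound(3)]]
  have halve: "K * inverse 2 ^ j * inverse 2 = K * inverse 2 ^ Suc j" for j
    by (simp add: mult_ac)
  have "?g \<sigma> \<le> ?v + K * inverse 2 ^ j" for j
    using start
  proof (induction j arbitrary: \<sigma>)
    case 0
    then show ?case
      using nn_integral_spmf_le[of F K "loop \<sigma>", OF bound(1)] by (simp add: add_increasing)
  next
    case (Suc j)
    have "?g \<sigma> = (\<integral>\<^sup>+ \<sigma>'. ?G \<sigma>' \<partial>measure_spmf (body \<sigma>))"
      by (rule loop_unfold[OF Suc.prems(2)])
    also have "\<dots> \<le> (\<integral>\<^sup>+ x. (if x \<notin> C then ?v + K * inverse 2 ^ j else \<phi> x) \<partial>?U)"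
      using Suc.IH F by (intro nn_integral_rel_spmf_mono[OF trial[OF Suc.prems]]) auto
    also have "\<dots> = (\<integral>\<^sup>+ x. (if x \<notin> C then ?v else \<phi> x) + (if x \<notin> C then K * inverse 2 ^ j else 0) \<partial>?U)"
      by (intro nn_integral_cong) simp
    also have "\<dots> = ?v + (\<integral>\<^sup>+ x. (if x \<notin> C then K * inverse 2 ^ j else 0) \<partial>?U)"
      by (simp add: nn_integral_add average_fixed_point)
    also have "\<dots> \<le> ?v + K * inverse 2 ^ j * inverse 2" by (intro add_left_mono reject_le_half)
    finally show ?case by (simp only: halve)
  qed
  from LIMSEQ_le_const[OF lim] this show "?g \<sigma> \<le> ?v" by auto
  have v: "?v \<le> K"
  proof -
    have "(\<Sum>x\<in>C. \<phi> x) \<le> of_nat (card C) * K" using sum_bounded_above[of C \<phi> K] bound(2) by simp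
    moreover have "finite C" using sub fin finite_subset by blast
    ultimately show ?thesis
      using ne by (metis card_gt_0_iff divide_right_mono_ennreal ennreal_mult_divide_eq
        ennreal_of_nat_neq_top mult.commute of_nat_eq_0_iff not_gr_zero)
  qed
  have "?v \<le> ?g \<sigma> + K * inverse 2 ^ j" for j
    using start
  proof (induction j arbitrary: \<sigma>)
    case 0
    then show ?case using v by (simp add: add_increasing)
  next
    case (Suc j)
    \<comment> \<open>The error is added to the integrand, since subtraction would truncate at 0.\<close>
    let ?e = "\<lambda>\<sigma>'. if holds b \<sigma>' then K * inverse 2 ^ j else 0"
    have "?v = (\<integral>\<^sup>+ x. (if x \<notin> C then ?v else \<phi> x) \<partial>?U)" by (rule average_fixed_point[symmetric])
    also have "\<dots> \<le> (\<integral>\<^sup>+ \<sigma>'. ?G \<sigma>' + ?e \<sigma>' \<partial>measure_spmf (body \<sigma>))"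
      using Suc.IH F by (intro nn_integral_rel_spmf_mono'[OF trial[OF Suc.prems]]) auto
    also have "\<dots> = ?g \<sigma> + (\<integral>\<^sup>+ \<sigma>'. ?e \<sigma>' \<partial>measure_spmf (body \<sigma>))"
      by (subst nn_integral_add) (simp_all only: loop_unfold[OF Suc.prems(2), symmetric], simp_all)
    also have "(\<integral>\<^sup>+ \<sigma>'. ?e \<sigma>' \<partial>measure_spmf (body \<sigma>))
        \<le> (\<integral>\<^sup>+ x. (if x \<notin> C then K * inverse 2 ^ j else 0) \<partial>?U)"
      by (intro nn_integral_rel_spmf_mono[OF trial[OF Suc.prems]]) auto
    also have "\<dots> \<le> K * inverse 2 ^ j * inverse 2" by (rule reject_le_half)
    finally show ?case by (simp only: halve add_left_mono)
  qed
  from LIMSEQ_le_const[OF lim] this show "?v \<le> ?g \<sigma>" by auto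
qed

lemma map_loop:
  assumes "I \<sigma>" "holds b \<sigma>" shows "map_spmf f (loop \<sigma>) = spmf_of_set C"
proof (rule spmf_eqI)
  fix x
  have finC: "finite C" using sub fin finite_subset by blast
  have "ennreal (spmf (map_spmf f (loop \<sigma>)) x)
      = (\<integral>\<^sup>+ y. indicator {x} (f y) \<partial>measure_spmf (loop \<sigma>))"
  proof -
    have "indicator {x} (f y) = (indicator (f -` {x}) y :: ennreal)" for y
      by (simp add: indicator_def)
    then show ?thesis by (simp add: ennreal_spmf_map)
  qed
  also have "\<dots> = (\<Sum>y\<in>C. indicator {x} y) / of_nat (card C)"
    by (rule loop_expectation[where K = 1, OF _ _ _ _ assms]) (auto simp: f_charge indicator_def)
  also have "(\<Sum>y\<in>C. indicator {x} y :: ennreal) = indicator C x"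
    using finC by (simp add: indicator_def)
  also have "\<dots> / of_nat (card C) = ennreal (spmf (spmf_of_set C) x)"
    using finC ne by (simp add: spmf_of_set indicator_def ennreal_of_nat_eq_real_of_nat divide_ennreal
      card_gt_0_iff flip: ennreal_1)
  finally show "spmf (map_spmf f (loop \<sigma>)) x = spmf (spmf_of_set C) x" by simp
qed

lemma lossless_loop:
  assumes "I \<sigma>" "holds b \<sigma>" shows "lossless_spmf (loop \<sigma>)"
proof -
  have "finite C" using sub fin by (rule finite_subset)
  then have "lossless_spmf (map_spmf f (loop \<sigma>))" unfolding map_loop[OF assms] using ne by simp
  then show ?thesis by simp
qed

lemma support_loop:
  assumes "I \<sigma>" "holds b \<sigma>" and post: "\<And>\<sigma>. I \<sigma> \<Longrightarrow> \<not> holds b \<sigma> \<Longrightarrow> P (charge_test b \<sigma>)"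
    and "y \<in> set_spmf (loop \<sigma>)"
  shows "P y"
proof -
  have "(\<integral>\<^sup>+ y. indicator {y. \<not> P y} y \<partial>measure_spmf (loop \<sigma>)) = (\<Sum>x\<in>C. 0 :: ennreal) / of_nat (card C)"
    using post by (intro loop_expectation[where K = 1, OF _ _ _ _ assms(1,2)]) (auto simp: indicator_def)
  then have "emeasure (measure_spmf (loop \<sigma>)) {y. \<not> P y} = 0" by simp
  then have "AE y in measure_spmf (loop \<sigma>). P y"
    by (intro AE_I[where N = "{y. \<not> P y}"]) auto
  with assms(4) show ?thesis by simp
qed

text \<open>The same halving argument bounds the expected time, but it needs an a priori finite bound.
  Hence the elapsed time is first truncated at \<open>K\<close>, and then \<open>K\<close> tends to infinity.\<close>

lemma expected_time_loop:
  assumes "I \<sigma>" "holds b \<sigma>"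
  shows "expected unit_time (loop \<sigma>) \<le> of_nat (unit_time \<sigma> + 2 * (m + 1))"
proof -
  let ?M = "2 * of_nat (m + 1) :: ennreal"
  have trunc: "(\<integral>\<^sup>+ y. of_nat (min (unit_time y - unit_time \<sigma>) K) \<partial>measure_spmf (loop \<sigma>)) \<le> ?M" for K
  proof -
    let ?\<tau> = "\<lambda>a y. of_nat (min (unit_time y - a) K) :: ennreal"
    let ?h = "\<lambda>\<sigma>. \<integral>\<^sup>+ y. ?\<tau> (unit_time \<sigma>) y \<partial>measure_spmf (loop \<sigma>)"
    have halve: "of_nat K * inverse 2 ^ j * inverse 2 = (of_nat K * inverse 2 ^ Suc j :: ennreal)" for j
      by (simp add: mult_ac)
    have "?h \<sigma> \<le> ?M + of_nat K * inverse 2 ^ j" for j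
      using assms
    proof (induction j arbitrary: \<sigma>)
      case 0
      have "?h \<sigma> \<le> of_nat K" by (rule nn_integral_spmf_le) simp
      then show ?case by (simp add: add_increasing)
    next
      case (Suc j)
      let ?e = "?M + of_nat K * inverse 2 ^ j"
      let ?a = "unit_time \<sigma>"
      have later: "(\<integral>\<^sup>+ y. ?\<tau> ?a y \<partial>measure_spmf (loop \<sigma>')) \<le> of_nat (m + 1) + ?e"
        if "I \<sigma>'" "holds b \<sigma>'" "unit_time \<sigma>' \<le> ?a + m" for \<sigma>'
      proof -
        have "?\<tau> ?a y \<le> of_nat (m + 1) + ?\<tau> (unit_time \<sigma>') y" for y
          using that(3) unfolding of_nat_add[symmetric] of_nat_le_iff by linarith
        then have "(\<integral>\<^sup>+ y. ?\<tau> ?a y \<partial>measure_spmf (loop \<sigma>'))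
            \<le> (\<integral>\<^sup>+ y. of_nat (m + 1) + ?\<tau> (unit_time \<sigma>') y \<partial>measure_spmf (loop \<sigma>'))"
          by (intro nn_integral_mono)
        also have "\<dots> = (\<integral>\<^sup>+ y. of_nat (m + 1) \<partial>measure_spmf (loop \<sigma>')) + ?h \<sigma>'"
          by (rule nn_integral_add) simp_all
        also have "\<dots> \<le> of_nat (m + 1) + ?e"
          by (intro add_mono Suc.IH that nn_integral_spmf_le) simp
        finally show ?thesis .
      qed
      have "?h \<sigma> \<le> (\<integral>\<^sup>+ x. of_nat (m + 1) + (if x \<notin> C then ?e else 0) \<partial>measure_spmf (spmf_of_set T))"
        unfolding loop_unfold[OF Suc.prems(2)]
        using later by (intro nn_integral_rel_spmf_mono[OF trial[OF Suc.prems]])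
          (auto simp del: of_nat_Suc of_nat_add)
      also have "\<dots> = (\<integral>\<^sup>+ x. of_nat (m + 1) \<partial>measure_spmf (spmf_of_set T))
          + (\<integral>\<^sup>+ x. (if x \<notin> C then ?e else 0) \<partial>measure_spmf (spmf_of_set T))"
        by (rule nn_integral_add) simp_all
      also have "\<dots> \<le> of_nat (m + 1) + ?e * inverse 2"
      proof (intro add_mono reject_le_half)
        show "(\<integral>\<^sup>+ x. of_nat (m + 1) \<partial>measure_spmf (spmf_of_set T)) \<le> (of_nat (m + 1) :: ennreal)"
          by (rule nn_integral_spmf_le) simp
      qed
      also have "?e * inverse 2 = of_nat (m + 1) + of_nat K * inverse 2 ^ Suc j"
      proof -
        have "2 * of_nat (m + 1) * inverse 2 = (of_nat (m + 1) * (2 * inverse 2) :: ennreal)"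
          by (simp only: mult_ac)
        also have "2 * inverse 2 = ennreal 2 * ennreal (1 / 2)"
          by (simp only: ennreal_inverse_2 ennreal_numeral)
        also have "\<dots> = 1" by (subst ennreal_mult[symmetric]) simp_all
        finally show ?thesis by (simp only: distrib_right halve mult_1_right)
      qed
      also have "of_nat (m + 1) + (of_nat (m + 1) + of_nat K * inverse 2 ^ Suc j) = ?M + of_nat K * inverse 2 ^ Suc j"
        by (simp only: mult_2 add.assoc)
      finally show ?case .
    qed
    from LIMSEQ_le_const[OF tendsto_add[OF tendsto_const half_pow_tendsto]] this
    show ?thesis by (force simp: of_nat_less_top)
  qed
  have sup: "(SUP K. of_nat (min x K)) = (of_nat x :: ennreal)" for x :: nat
    by (rule antisym[OF SUP_least SUP_upper2[of x]]) auto
  have "(\<integral>\<^sup>+ y. of_nat (unit_time y - unit_time \<sigma>) \<partial>measure_spmf (loop \<sigma>))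
      = (SUP K. \<integral>\<^sup>+ y. of_nat (min (unit_time y - unit_time \<sigma>) K) \<partial>measure_spmf (loop \<sigma>))"
    by (subst nn_integral_monotone_convergence_SUP[symmetric])
       (auto simp: incseq_def le_fun_def sup intro!: of_nat_mono)
  also have "\<dots> \<le> ?M" using trunc by (rule SUP_least)
  finally have le: "(\<integral>\<^sup>+ y. of_nat (unit_time y - unit_time \<sigma>) \<partial>measure_spmf (loop \<sigma>)) \<le> ?M" .
  have "expected unit_time (loop \<sigma>)
      \<le> (\<integral>\<^sup>+ y. of_nat (unit_time \<sigma>) + of_nat (unit_time y - unit_time \<sigma>) \<partial>measure_spmf (loop \<sigma>))"
    unfolding expected_def
    by (intro nn_integral_mono) (simp flip: of_nat_add)
  also have "\<dots> = (\<integral>\<^sup>+ y. of_nat (unit_time \<sigma>) \<partial>measure_spmf (loop \<sigma>))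
      + (\<integral>\<^sup>+ y. of_nat (unit_time y - unit_time \<sigma>) \<partial>measure_spmf (loop \<sigma>))"
    by (rule nn_integral_add) simp_all
  also have "\<dots> \<le> of_nat (unit_time \<sigma>) + ?M"
    by (intro add_mono le nn_integral_spmf_le) simp
  finally show ?thesis by (simp only: of_nat_add of_nat_mult of_nat_numeral)
qed

end


section \<open>Symbolic execution\<close>

lemma rel_spmf_return_iff_ensures:
  "rel_spmf R (exec c \<sigma>) (return_spmf x) \<longleftrightarrow> ensures c \<sigma> (\<lambda>\<sigma>'. R \<sigma>' x)"
  by (simp add: ensures_def rel_spmf_return_spmf2)

lemma rel_spmf_Draw:
  assumes "reg \<sigma> s = N" "N > 0"
    and "\<And>j. j < N \<Longrightarrow> ensures d (set_reg r j (charge [N, j] \<sigma>)) (\<lambda>\<sigma>'. R \<sigma>' (g j))"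
  shows "rel_spmf R (exec (Seq (Do (Draw r s)) d) \<sigma>) (map_spmf g (spmf_of_set {..<N}))"
  unfolding map_spmf_conv_bind_spmf using assms
  by (auto simp: Let_def rel_spmf_return_iff_ensures intro!: rel_spmf_bind_reflI)

notation Seq (infixr ";;" 60)

text \<open>A configuration gives the registers and the memory as explicit functions and forgets the
  exact bit time.  The rules below evaluate one instruction each and check the bound \<open>B\<close>
  on the way, so straight-line code can be executed without copying ever larger states.\<close>

definition config :: "nat \<Rightarrow> (nat \<Rightarrow> nat) \<Rightarrow> (nat \<Rightarrow> nat) \<Rightarrow> nat \<Rightarrow> ram \<Rightarrow> bool" where
  "config B R M \<tau> \<sigma> \<longleftrightarrow> reg \<sigma> = R \<and> mem \<sigma> = M \<and> unit_time \<sigma> = \<tau> \<and> bit_bounded B \<sigma>"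

definition runs :: "nat \<Rightarrow> com \<Rightarrow> (nat \<Rightarrow> nat) \<Rightarrow> (nat \<Rightarrow> nat) \<Rightarrow> nat \<Rightarrow> (ram \<Rightarrow> bool) \<Rightarrow> bool" where
  "runs B c R M \<tau> Q \<longleftrightarrow> (\<forall>\<sigma>. config B R M \<tau> \<sigma> \<longrightarrow> ensures c \<sigma> Q)"

lemma runs_Skip: "(\<And>\<sigma>. config B R M \<tau> \<sigma> \<Longrightarrow> Q \<sigma>) \<Longrightarrow> runs B Skip R M \<tau> Q"
  by (simp add: runs_def)

lemma runs_last: "runs B (c;; Skip) R M \<tau> Q \<Longrightarrow> runs B c R M \<tau> Q"
  by (simp add: runs_def)

lemma runs_Seq_assoc: "runs B (c;; d;; e) R M \<tau> Q \<Longrightarrow> runs B ((c;; d);; e) R M \<tau> Q"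
  by (simp add: runs_def)

lemma runs_Skip_Seq: "runs B e R M \<tau> Q \<Longrightarrow> runs B (Skip;; e) R M \<tau> Q"
  by (simp add: runs_def)

lemma runs_SeqI:
  assumes "\<And>\<sigma>. config B R M \<tau> \<sigma> \<Longrightarrow> ensures c \<sigma> (config B R' M' \<tau>')" "runs B d R' M' \<tau>' Q"
  shows "runs B (c;; d) R M \<tau> Q"
  unfolding runs_def ensures_simps
proof (intro allI impI)
  fix \<sigma> assume "config B R M \<tau> \<sigma>"
  from ensures_mono[OF assms(1)[OF this]] show "ensures c \<sigma> (\<lambda>\<sigma>'. ensures d \<sigma>' Q)"
    using assms(2) by (simp add: runs_def)
qed

lemma runs_Const:
  assumes "x \<le> B" "runs B d (R(r := x)) M (Suc \<tau>) Q"
  shows "runs B (Do (Const r x);; d) R M \<tau> Q"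
  by (rule runs_SeqI[OF _ assms(2)]) (use assms(1) in \<open>auto simp: config_def intro!: bit_bounded_charge\<close>)

lemma runs_Move:
  assumes "R s = x" "x \<le> B" "runs B d (R(r := x)) M (Suc \<tau>) Q"
  shows "runs B (Do (Move r s);; d) R M \<tau> Q"
  by (rule runs_SeqI[OF _ assms(3)]) (use assms(1,2) in \<open>auto simp: config_def intro!: bit_bounded_charge\<close>)

lemma runs_Add:
  assumes "R s = x" "R t = y" "x + y \<le> B" "runs B d (R(r := x + y)) M (Suc \<tau>) Q"
  shows "runs B (Do (Add r s t);; d) R M \<tau> Q"
  by (rule runs_SeqI[OF _ assms(4)]) (use assms(1,2,3) in \<open>auto simp: config_def intro!: bit_bounded_charge\<close>)

lemma runs_Load:
  assumes "R s = i" "M i = x" "i \<le> B" "x \<le> B" "runs B d (R(r := x)) M (Suc \<tau>) Q"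
  shows "runs B (Do (Load r s);; d) R M \<tau> Q"
  by (rule runs_SeqI[OF _ assms(5)]) (use assms(1-4) in \<open>auto simp: config_def intro!: bit_bounded_charge\<close>)

lemma runs_Store:
  assumes "R r = i" "R s = x" "i \<le> B" "x \<le> B" "runs B d R (M(i := x)) (Suc \<tau>) Q"
  shows "runs B (Do (Store r s);; d) R M \<tau> Q"
  by (rule runs_SeqI[OF _ assms(5)]) (use assms(1-4) in \<open>auto simp: config_def intro!: bit_bounded_charge\<close>)

lemma runs_If_Equal:
  assumes "R r \<le> B" "R s \<le> B" and "R r = R s \<Longrightarrow> runs B (c;; e) R M (Suc \<tau>) Q"
    and "R r \<noteq> R s \<Longrightarrow> runs B (d;; e) R M (Suc \<tau>) Q"
  shows "runs B (If (Equal r s) c d;; e) R M \<tau> Q"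
  unfolding runs_def
proof (intro allI impI)
  fix \<sigma> assume c: "config B R M \<tau> \<sigma>"
  then have "config B R M (Suc \<tau>) (charge_test (Equal r s) \<sigma>)"
    using assms(1,2) by (auto simp: config_def intro!: bit_bounded_charge)
  with c assms(3,4) show "ensures (If (Equal r s) c d;; e) \<sigma> Q"
    by (cases "R r = R s") (auto simp: runs_def config_def simp del: charge_test.simps)
qed

lemmas runs_step = runs_Seq_assoc runs_Skip_Seq runs_Const runs_Move runs_Add runs_Load runs_Store

lemma ensures_if_runs:
  assumes "bit_bounded B \<sigma>" "reg \<sigma> = R" "mem \<sigma> = M" "unit_time \<sigma> = \<tau>" "runs B c R M \<tau> Q"
  shows "ensures c \<sigma> Q"
  using assms by (simp add: runs_def config_def)


section \<open>The program\<close>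

text \<open>Registers: 0 holds \<open>n\<close>, 1 holds 0 (and is the output vertex), 2 holds 1, 3 holds \<open>k * n\<close>, 12
  holds \<open>k * n + n\<close>, and 4 holds the number of vertices found by the last search; the remaining
  ones are temporary.  Memory: the \<open>k\<close> rows of the table, then from \<open>k * n\<close> on one mark for
  each vertex, then from \<open>k * n + n\<close> on the queue of the search.\<close>

fun add_times :: "nat \<Rightarrow> com" where
  "add_times 0 = Skip"
| "add_times (Suc k) = Do (Add 3 3 0);; add_times k"

definition prepare :: "nat \<Rightarrow> com" where
  "prepare k = Do (Const 2 1);; add_times k;; Do (Add 12 3 0)"

text \<open>One step of the inside-out variant of the Fisher-Yates shuffle on the row that starts at the
  address in register 5: entry \<open>i\<close> receives the entry \<open>j\<close> of a random \<open>j \<le> i\<close>, and entry \<open>j\<close>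
  becomes \<open>i\<close>.  Writing \<open>i\<close> to entry \<open>i\<close> first makes the case \<open>j = i\<close> come out right.\<close>

definition insert_random :: com where
  "insert_random =
     Do (Add 7 6 2);; Do (Draw 8 7);;
     Do (Add 9 5 6);; Do (Store 9 6);; Do (Add 8 5 8);; Do (Load 10 8);;
     Do (Store 9 10);; Do (Store 8 6);; Do (Move 6 7)"

definition shuffle_all :: com where
  "shuffle_all =
     Do (Const 5 0);;
     While (Less 5 3) (Do (Const 6 0);; While (Less 6 0) insert_random;; Do (Add 5 5 0))"

definition clear_marks :: com where
  "clear_marks = Do (Move 9 3);; While (Less 9 12) (Do (Store 9 1);; Do (Add 9 9 2))"

text \<open>The address in register 5 runs through the column of the current vertex, that is, through the
  targets of its outgoing edges.\<close>

definition follow_edge :: com where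
  "follow_edge =
     Do (Load 6 5);; Do (Add 7 3 6);; Do (Load 8 7);;
     If (Equal 8 1) (Do (Store 7 2);; Do (Add 9 12 4);; Do (Store 9 6);; Do (Add 4 4 2)) Skip;;
     Do (Add 5 5 0)"

definition search :: com where
  "search =
     Do (Store 3 2);; Do (Store 12 1);; Do (Const 4 1);; Do (Const 11 0);;
     While (Less 11 4)
       (Do (Add 9 12 11);; Do (Load 5 9);; Do (Add 11 11 2);; While (Less 5 3) follow_edge)"

definition trial :: com where
  "trial = shuffle_all;; clear_marks;; search"

text \<open>Register 4 is initially 0, so at least one trial takes place.\<close>

definition sampler :: "nat \<Rightarrow> com" where
  "sampler k = prepare k;; While (Less 4 0) trial"

text \<open>All addresses lie below \<open>(k + 2) * n\<close>, the size of the memory in use; vertices, counters and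
  the constants are not larger than that either.\<close>

locale sizes =
  fixes k n B :: nat
  assumes n: "n \<ge> 1" and B: "(k + 2) * n \<le> B"
begin

lemma B': "k * n + 2 * n \<le> B" using B by (simp add: algebra_simps)

definition env :: "ram \<Rightarrow> bool" where
  "env \<sigma> \<longleftrightarrow> reg \<sigma> 0 = n \<and> reg \<sigma> 1 = 0 \<and> reg \<sigma> 2 = 1 \<and> reg \<sigma> 3 = k * n \<and> reg \<sigma> 12 = k * n + n \<and>
     bit_bounded B \<sigma>"

lemma row_less: "c < k \<Longrightarrow> u < n \<Longrightarrow> c * n + u < k * n"
proof -
  assume "c < k" "u < n"
  then have "Suc c * n \<le> k * n" by (intro mult_le_mono1) simp
  with \<open>u < n\<close> show ?thesis by simp
qed

lemma row_le: "c < k \<Longrightarrow> c * n + n \<le> k * n"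
  using mult_le_mono1[of "Suc c" k n] by simp


section \<open>Drawing a uniform table\<close>

text \<open>The drawn \<open>j\<close> can be recovered as the position of the entry \<open>i\<close>.\<close>

lemma bij_insert_permutation:
  "bij_betw (\<lambda>(p, j). p \<circ> Transposition.transpose i j)
     ({p. p permutes {..<i}} \<times> {..<Suc i}) {p. p permutes {..<Suc i}}"
proof -
  let ?g = "\<lambda>(p, j). p \<circ> Transposition.transpose i j"
  let ?X = "{p. p permutes {..<i}} \<times> {..<Suc i}"
  have inj: "inj_on ?g ?X"
  proof (rule inj_onI, clarify)
    fix p j p' j'
    assume p: "p permutes {..<i}" "p' permutes {..<i}"
      and eq: "p \<circ> Transposition.transpose i j = p' \<circ> Transposition.transpose i j'"
    have "p' (Transposition.transpose i j' j) = p i" using fun_cong[OF eq, of j] by simp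
    also have "\<dots> = p' i" using p by (simp add: permutes_not_in)
    finally have "Transposition.transpose i j' j = i" using permutes_inj[OF p(2)] by (simp add: inj_eq)
    then have j: "j' = j" by (metis transpose_apply_second transpose_eq_iff)
    have "p = (p \<circ> Transposition.transpose i j) \<circ> Transposition.transpose i j"
      by (simp add: comp_assoc)
    also have "\<dots> = p'" unfolding eq j by (simp add: comp_assoc)
    finally show "p = p' \<and> j = j'" using j by simp
  qed
  have "?g ` ?X = {p. p permutes {..<Suc i}}"
  proof (rule card_subset_eq)
    show "?g ` ?X \<subseteq> {p. p permutes {..<Suc i}}"
      by (auto intro!: permutes_compose permutes_swap_id intro: permutes_subset)
    show "card (?g ` ?X) = card {p. p permutes {..<Suc i}}"
      using card_image[OF inj] card_permutations[of "{..<i}" i] card_permutations[of "{..<Suc i}" "Suc i"]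
      by (simp add: card_cartesian_product)
  qed (simp add: finite_permutations)
  with inj show ?thesis by (simp add: bij_betw_def)
qed

text \<open>The second clause on the memory protects the rows already drawn.  One round takes 10 units of
  time, one for the test and nine for \<open>insert_random\<close>, so \<open>t\<close> is the time at which the row is
  completed.  The other loop invariants account for time in the same way.\<close>

definition filled :: "nat \<Rightarrow> (nat \<Rightarrow> nat) \<Rightarrow> nat \<Rightarrow> nat \<Rightarrow> ram \<Rightarrow> (nat \<Rightarrow> nat) \<Rightarrow> bool" where
  "filled b M t i \<sigma> p \<longleftrightarrow> env \<sigma> \<and> reg \<sigma> 5 = b \<and> reg \<sigma> 6 = i \<and>
     (\<forall>u<i. mem \<sigma> (b + u) = p u) \<and> (\<forall>a<b. mem \<sigma> a = M a) \<and> unit_time \<sigma> + 10 * (n - i) \<le> t"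

lemma insert_random_step:
  assumes i: "i < n" and p: "p permutes {..<i}" and F: "filled b M t i \<sigma> p" and b: "b + n \<le> k * n"
  shows "rel_spmf (filled b M t (Suc i)) (exec insert_random (charge_test (Less 6 0) \<sigma>))
    (map_spmf (\<lambda>j. p \<circ> Transposition.transpose i j) (spmf_of_set {..<Suc i}))"
proof -
  have e: "reg \<sigma> 0 = n" "reg \<sigma> (Suc 0) = 0" "reg \<sigma> 2 = 1" "reg \<sigma> 3 = k * n" "reg \<sigma> 12 = k * n + n"
    "bit_bounded B \<sigma>" "reg \<sigma> 5 = b" "reg \<sigma> 6 = i" and m: "\<And>u. u < i \<Longrightarrow> mem \<sigma> (b + u) = p u"
    and M: "\<And>a. a < b \<Longrightarrow> mem \<sigma> a = M a" and t: "unit_time \<sigma> + 10 * (n - i) \<le> t"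
    using F by (auto simp: filled_def env_def)
  have le: "p j \<le> B" if "j < i" for j
    using permutes_in_image[OF p, of j] that i B' by simp
  have pi: "p i = i" using permutes_not_in[OF p] by simp
  have step: "filled b M t (Suc i) \<sigma>' (p \<circ> Transposition.transpose i j)"
    if j: "j < Suc i" and \<sigma>': "env \<sigma>'" "reg \<sigma>' 5 = b" "reg \<sigma>' 6 = Suc i" "unit_time \<sigma>' = unit_time \<sigma> + 10"
      and mem: "mem \<sigma>' = (mem \<sigma>)(b + i := i, b + i := ((mem \<sigma>)(b + i := i)) (b + j), b + j := i)" for j \<sigma>'
  proof -
    have "mem \<sigma>' (b + u) = (p \<circ> Transposition.transpose i j) u" if "u < Suc i" for u
    proof (cases "u = i \<and> j \<noteq> i")
      case True
      then show ?thesis using j m by (simp add: mem)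
    next
      case False
      then show ?thesis
        using that m by (cases "u = j") (auto simp: mem pi Transposition.transpose_def)
    qed
    then show ?thesis
      using \<sigma>' M t i by (simp add: filled_def mem)
  qed
  show ?thesis
    unfolding insert_random_def
    apply (rule rel_spmf_Seq1)
    apply (simp only: ensures_simps)
    apply (rule rel_spmf_Draw)
      apply (simp add: e)
     apply simp
    subgoal premises j for j
      apply (rule ensures_if_runs[where B = B])
          subgoal using e i B' j by (auto intro!: bit_bounded_charge)
      apply (simp add: e; fail)+
      apply (rule runs_last)
      apply (rule runs_step | (simp add: e; fail) | (use i b B' j le[of j] m[of j] in \<open>auto simp add: e; fail\<close>))+
      apply (rule runs_Skip)
      apply (rule step[OF j]; use e in \<open>simp add: config_def env_def; fail\<close>)
      done
    done
qed

lemma shuffle_row: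
  assumes F: "filled b M t 0 \<sigma> id" and b: "b + n \<le> k * n"
  shows "rel_spmf (\<lambda>\<sigma>' p. filled b M (t + 1) n \<sigma>' p) (exec (While (Less 6 0) insert_random) \<sigma>)
    (spmf_of_set {p. p permutes {..<n}})"
proof -
  have n_le: "n \<le> B" using B' by simp
  show ?thesis
    by (rule rel_spmf_sampling_loop[where X = "\<lambda>i. {p. p permutes {..<i}}" and R = "filled b M t"
          and K = "\<lambda>i p. map_spmf (\<lambda>j. p \<circ> Transposition.transpose i j) (spmf_of_set {..<Suc i})"
          and N = n and z = id, OF _ bind_spmf_of_set_bij[OF bij_insert_permutation]])
       (use insert_random_step[OF _ _ _ b] F n_le in
        \<open>auto simp: filled_def env_def finite_permutations simp del: charge_test.simps
          intro!: bit_bounded_test\<close>)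
qed

definition rows :: "nat \<Rightarrow> nat \<Rightarrow> ram \<Rightarrow> (nat \<Rightarrow> nat \<Rightarrow> nat) \<Rightarrow> bool" where
  "rows t c \<sigma> T \<longleftrightarrow> env \<sigma> \<and> reg \<sigma> 5 = c * n \<and> (\<forall>c'<c. \<forall>u<n. mem \<sigma> (c' * n + u) = T c' u) \<and>
     unit_time \<sigma> + (10 * n + 4) * (k - c) \<le> t"

lemma bij_insert_row:
  "bij_betw (\<lambda>(T, p). T(c := p)) (perm_tables c n \<times> {p. p permutes {..<n}}) (perm_tables (Suc c) n)"
proof -
  have "inj_on (\<lambda>(T, p). T(c := p)) (perm_tables c n \<times> {p. p permutes {..<n}})"
  proof (rule inj_onI, clarify)
    fix T p T' p'
    assume T: "T \<in> perm_tables c n" "T' \<in> perm_tables c n" and eq: "T(c := p) = T'(c := p')"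
    have "T x = T' x" for x
      using T fun_cong[OF eq, of x] by (cases "x = c") (auto simp: perm_tables_def PiE_def extensional_def)
    with fun_cong[OF eq, of c] show "T = T' \<and> p = p'" by auto
  qed
  moreover have "(\<lambda>(T, p). T(c := p)) ` (perm_tables c n \<times> {p. p permutes {..<n}}) = perm_tables (Suc c) n"
    by (auto simp: perm_tables_def lessThan_Suc PiE_insert_eq image_iff)
  ultimately show ?thesis by (simp add: bij_betw_def)
qed

lemma shuffle_all_step:
  assumes c: "c < k" and T: "T \<in> perm_tables c n" and R: "rows t c \<sigma> T"
  shows "rel_spmf (rows t (Suc c))
    (exec (Do (Const 6 0);; While (Less 6 0) insert_random;; Do (Add 5 5 0)) (charge_test (Less 5 3) \<sigma>))
    (map_spmf (\<lambda>p. T(c := p)) (spmf_of_set {p. p permutes {..<n}}))"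
proof -
  let ?\<sigma> = "set_reg 6 0 (charge [0] (charge_test (Less 5 3) \<sigma>))"
  let ?t = "unit_time \<sigma> + 2 + 10 * n"
  have cn: "c * n + n \<le> k * n" using row_le[OF c] .
  have F: "filled (c * n) (mem \<sigma>) ?t 0 ?\<sigma> id"
    using R cn B' by (auto simp: filled_def rows_def env_def simp del: charge_test.simps
      intro!: bit_bounded_charge bit_bounded_test)
  have kc: "k - c = Suc (k - Suc c)" using c by simp
  have add: "ensures (Do (Add 5 5 0)) \<sigma>' (\<lambda>\<sigma>''. rows t (Suc c) \<sigma>'' (T(c := p)))"
    if f: "filled (c * n) (mem \<sigma>) (?t + 1) n \<sigma>' p" for \<sigma>' p
  proof -
    have "mem \<sigma>' (c' * n + u) = (T(c := p)) c' u" if "c' < Suc c" "u < n" for c' u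
    proof (cases "c' = c")
      case True
      with f that show ?thesis by (simp add: filled_def)
    next
      case False
      then have "c' < c" using that by simp
      then have "Suc c' * n \<le> c * n" by (intro mult_le_mono1) simp
      then have "c' * n + u < c * n" using that by simp
      with f R \<open>c' < c\<close> that show ?thesis by (simp add: filled_def rows_def)
    qed
    moreover have "unit_time \<sigma>' + 1 + (10 * n + 4) * (k - Suc c) \<le> t"
      using f R unfolding filled_def rows_def kc by (simp add: algebra_simps)
    ultimately show ?thesis
      using f cn B' by (auto simp: filled_def rows_def env_def add.commute intro!: bit_bounded_charge)
  qed
  have rel: "rel_spmf (\<lambda>\<sigma>' T'. rows t (Suc c) \<sigma>' T')
      (exec (While (Less 6 0) insert_random;; Do (Add 5 5 0)) ?\<sigma>)
      (map_spmf (\<lambda>p. T(c := p)) (spmf_of_set {p. p permutes {..<n}}))"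
    unfolding spmf_rel_map
    by (rule rel_spmf_Seq2[OF shuffle_row[OF F cn]]) (rule add)
  show ?thesis by (rule rel_spmf_Seq1) (use rel in simp)
qed

lemma perm_tables_0: "perm_tables 0 n = {\<lambda>_. undefined}"
  by (simp add: perm_tables_def)

lemma shuffle_all:
  assumes "env \<sigma>"
  shows "rel_spmf (\<lambda>\<sigma>' T. rows (unit_time \<sigma> + (10 * n + 4) * k + 2) k \<sigma>' T)
    (exec shuffle_all \<sigma>) (spmf_of_set (perm_tables k n))"
proof -
  let ?t = "unit_time \<sigma> + (10 * n + 4) * k + 1"
  let ?\<sigma> = "set_reg 5 0 (charge [0] \<sigma>)"
  have kn: "k * n \<le> B" using B' by simp
  have start: "rows ?t 0 ?\<sigma> (\<lambda>_. undefined)"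
    using assms by (auto simp: rows_def env_def intro!: bit_bounded_charge)
  have step: "holds (Less 5 3) \<sigma>' \<and> rel_spmf (rows ?t (Suc c))
      (exec (Do (Const 6 0);; While (Less 6 0) insert_random;; Do (Add 5 5 0)) (charge_test (Less 5 3) \<sigma>'))
      (map_spmf (\<lambda>p. T(c := p)) (spmf_of_set {p. p permutes {..<n}}))"
    if "c < k" "T \<in> perm_tables c n" "rows ?t c \<sigma>' T" for c T \<sigma>'
    using shuffle_all_step[OF that] that(1,3) n by (auto simp: rows_def env_def)
  have stop: "\<not> holds (Less 5 3) \<sigma>' \<and> rows (?t + 1) k (charge_test (Less 5 3) \<sigma>') T"
    if "T \<in> perm_tables k n" "rows ?t k \<sigma>' T" for T \<sigma>'
    using that(2) kn by (auto simp: rows_def env_def simp del: charge_test.simps intro!: bit_bounded_test)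
  have "rel_spmf (rows (?t + 1) k)
      (exec (While (Less 5 3) (Do (Const 6 0);; While (Less 6 0) insert_random;; Do (Add 5 5 0))) ?\<sigma>)
      (spmf_of_set (perm_tables k n))"
    by (rule rel_spmf_sampling_loop[where X = "\<lambda>c. perm_tables c n" and R = "rows ?t" and N = k
          and K = "\<lambda>c T. map_spmf (\<lambda>p. T(c := p)) (spmf_of_set {p. p permutes {..<n}})"
          and z = "\<lambda>_. undefined", OF step bind_spmf_of_set_bij[OF bij_insert_row] _ stop _ start])
       (simp_all add: finite_perm_tables finite_permutations perm_tables_0)
  then show ?thesis
    unfolding shuffle_all_def by (intro rel_spmf_Seq1) (simp add: add.commute)
qed


section \<open>Testing connectivity\<close>

definition cleared :: "(nat \<Rightarrow> nat) \<Rightarrow> ram \<Rightarrow> bool" where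
  "cleared M \<sigma> \<longleftrightarrow> env \<sigma> \<and> (\<forall>a<k * n. mem \<sigma> a = M a) \<and> (\<forall>v<n. mem \<sigma> (k * n + v) = 0)"

lemma clear_marks:
  assumes "env \<sigma>"
  shows "ensures clear_marks \<sigma> (\<lambda>\<sigma>'. cleared (mem \<sigma>) \<sigma>' \<and> unit_time \<sigma>' \<le> unit_time \<sigma> + 3 * n + 2)"
proof -
  let ?t = "unit_time \<sigma> + 3 * n + 1"
  let ?I = "\<lambda>\<sigma>'. env \<sigma>' \<and> k * n \<le> reg \<sigma>' 9 \<and> reg \<sigma>' 9 \<le> k * n + n \<and>
    (\<forall>a<k * n. mem \<sigma>' a = mem \<sigma> a) \<and> (\<forall>a. k * n \<le> a \<longrightarrow> a < reg \<sigma>' 9 \<longrightarrow> mem \<sigma>' a = 0) \<and>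
    unit_time \<sigma>' + 3 * (k * n + n - reg \<sigma>' 9) \<le> ?t"
  have "ensures (While (Less 9 12) (Do (Store 9 1);; Do (Add 9 9 2))) (set_reg 9 (k * n) (charge [k * n] \<sigma>))
      (\<lambda>\<sigma>'. cleared (mem \<sigma>) \<sigma>' \<and> unit_time \<sigma>' \<le> ?t + 1)"
  proof (rule ensures_While[where I = ?I and m = "\<lambda>\<sigma>'. k * n + n - reg \<sigma>' 9"])
    show "?I (set_reg 9 (k * n) (charge [k * n] \<sigma>))"
      using assms B' by (auto simp: env_def intro!: bit_bounded_charge)
  next
    fix \<sigma>' assume "?I \<sigma>'" "holds (Less 9 12) \<sigma>'"
    then show "ensures (Do (Store 9 1);; Do (Add 9 9 2)) (charge_test (Less 9 12) \<sigma>')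
        (\<lambda>\<sigma>''. ?I \<sigma>'' \<and> k * n + n - reg \<sigma>'' 9 < k * n + n - reg \<sigma>' 9)"
      using B' by (auto simp: env_def simp del: charge_test.simps
        intro!: bit_bounded_charge bit_bounded_test)
  next
    fix \<sigma>' assume "?I \<sigma>'" "\<not> holds (Less 9 12) \<sigma>'"
    then show "cleared (mem \<sigma>) (charge_test (Less 9 12) \<sigma>') \<and> unit_time (charge_test (Less 9 12) \<sigma>') \<le> ?t + 1"
      using B' by (auto simp: env_def cleared_def simp del: charge_test.simps intro!: bit_bounded_test)
  qed
  then show ?thesis using assms by (simp add: clear_marks_def env_def)
qed

text \<open>The list \<open>qs\<close> consists of all vertices ever put into the queue.  The last clause says that
  only vertices reachable from 0 are discovered.\<close>

definition frontier :: "(nat \<Rightarrow> nat) \<Rightarrow> nat list \<Rightarrow> ram \<Rightarrow> bool" where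
  "frontier M qs \<sigma> \<longleftrightarrow> env \<sigma> \<and> reg \<sigma> 4 = length qs \<and> distinct qs \<and> set qs \<subseteq> {..<n} \<and> 0 \<in> set qs \<and>
     (\<forall>j<length qs. mem \<sigma> (k * n + n + j) = qs ! j) \<and>
     (\<forall>v<n. mem \<sigma> (k * n + v) = (if v \<in> set qs then 1 else 0)) \<and>
     (\<forall>a<k * n. mem \<sigma> a = M a) \<and>
     (\<forall>S. 0 \<in> S \<longrightarrow> (\<forall>c<k. \<forall>u\<in>S. u < n \<longrightarrow> M (c * n + u) \<in> S) \<longrightarrow> set qs \<subseteq> S)"

definition expanded :: "(nat \<Rightarrow> nat) \<Rightarrow> nat list \<Rightarrow> nat \<Rightarrow> bool" where
  "expanded M qs h \<longleftrightarrow> (\<forall>j<h. \<forall>c<k. M (c * n + qs ! j) \<in> set qs)"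

lemma frontier_length:
  assumes "frontier M qs \<sigma>" shows "length qs \<le> n"
proof -
  have "card (set qs) \<le> card {..<n}" using assms by (intro card_mono) (auto simp: frontier_def)
  then show ?thesis using assms by (simp add: frontier_def distinct_card)
qed

lemma frontier_append:
  assumes F: "frontier M qs \<sigma>" and v: "v \<notin> set qs" "v < n" "v = M (c * n + u)" "c < k" "u \<in> set qs"
    and \<sigma>': "env \<sigma>'" "reg \<sigma>' 4 = Suc (length qs)"
      "mem \<sigma>' = (mem \<sigma>)(k * n + v := 1, k * n + n + length qs := v)"
  shows "frontier M (qs @ [v]) \<sigma>'"
proof -
  have u: "u < n" using F v(5) by (auto simp: frontier_def)
  have "v \<in> S" if "0 \<in> S" "\<forall>c<k. \<forall>u\<in>S. u < n \<longrightarrow> M (c * n + u) \<in> S" for S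
  proof -
    have "set qs \<subseteq> S" using F that by (simp add: frontier_def)
    then have "M (c * n + u) \<in> S" using that(2) v(4,5) u by blast
    then show ?thesis using v(3) by simp
  qed
  then have "\<forall>S. 0 \<in> S \<longrightarrow> (\<forall>c<k. \<forall>u\<in>S. u < n \<longrightarrow> M (c * n + u) \<in> S) \<longrightarrow> set (qs @ [v]) \<subseteq> S"
    using F by (simp add: frontier_def)
  moreover have "mem \<sigma>' (k * n + n + j) = (qs @ [v]) ! j" if "j < length (qs @ [v])" for j
  proof (cases "j = length qs")
    case False
    then have "j < length qs" using that by simp
    then show ?thesis using F v(2) by (simp add: \<sigma>'(3) frontier_def nth_append)
  qed (simp add: \<sigma>'(3))
  moreover have "mem \<sigma>' (k * n + x) = (if x \<in> set (qs @ [v]) then 1 else 0)" if "x < n" for x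
    using F that by (simp add: \<sigma>'(3) frontier_def)
  moreover have "mem \<sigma>' a = M a" if "a < k * n" for a
    using F that by (simp add: \<sigma>'(3) frontier_def)
  ultimately show ?thesis
    using F v(1,2) \<sigma>'(1,2) unfolding frontier_def by simp
qed

end

context sizes begin

lemma frontierD:
  assumes "frontier M qs \<sigma>"
  shows "reg \<sigma> 0 = n" "reg \<sigma> (Suc 0) = 0" "reg \<sigma> 2 = 1" "reg \<sigma> 3 = k * n" "reg \<sigma> 12 = k * n + n"
    "bit_bounded B \<sigma>" "reg \<sigma> 4 = length qs" "distinct qs" "set qs \<subseteq> {..<n}"
    "j < length qs \<Longrightarrow> mem \<sigma> (k * n + n + j) = qs ! j" "j < length qs \<Longrightarrow> qs ! j < n"
    "v < n \<Longrightarrow> mem \<sigma> (k * n + v) = (if v \<in> set qs then 1 else 0)"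
    "a < k * n \<Longrightarrow> mem \<sigma> a = M a"
proof -
  show "set qs \<subseteq> {..<n}" using assms by (simp add: frontier_def)
  then show "j < length qs \<Longrightarrow> qs ! j < n" by (meson lessThan_iff nth_mem subsetD)
qed (use assms in \<open>simp_all add: frontier_def env_def\<close>)

lemma frontier_transfer:
  assumes "frontier M qs \<sigma>" "env \<sigma>'" "mem \<sigma>' = mem \<sigma>" "reg \<sigma>' 4 = reg \<sigma> 4"
  shows "frontier M qs \<sigma>'"
  using assms by (simp add: frontier_def)

definition scanning :: "(nat \<Rightarrow> nat) \<Rightarrow> nat \<Rightarrow> nat \<Rightarrow> nat \<Rightarrow> nat list \<Rightarrow> nat \<Rightarrow> ram \<Rightarrow> bool" where
  "scanning M t u h qs c \<sigma> \<longleftrightarrow> frontier M qs \<sigma> \<and> expanded M qs h \<and> h < length qs \<and> qs ! h = u \<and>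
     reg \<sigma> 11 = Suc h \<and> c \<le> k \<and> reg \<sigma> 5 = c * n + u \<and> (\<forall>c'<c. M (c' * n + u) \<in> set qs) \<and>
     unit_time \<sigma> + 10 * (k - c) \<le> t"

lemma follow_edge:
  assumes S: "scanning M t u h qs c \<sigma>" and c: "c < k" and M: "\<And>c u. c < k \<Longrightarrow> u < n \<Longrightarrow> M (c * n + u) < n"
  shows "ensures follow_edge (charge_test (Less 5 3) \<sigma>)
    (\<lambda>\<sigma>'. \<exists>qs'. scanning M t u h qs' (Suc c) \<sigma>')"
proof -
  let ?v = "M (c * n + u)"
  have F: "frontier M qs \<sigma>" using S by (simp add: scanning_def)
  have h: "h < length qs" "qs ! h = u" using S by (auto simp: scanning_def)
  have u: "u \<in> set qs" "u < n" using nth_mem[OF h(1)] frontierD(11)[OF F h(1)] h(2) by simp_all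
  have v: "?v < n" by (rule M[OF c u(2)])
  have e: "reg \<sigma> 0 = n" "reg \<sigma> (Suc 0) = 0" "reg \<sigma> 2 = 1" "reg \<sigma> 3 = k * n" "reg \<sigma> 12 = k * n + n"
    "bit_bounded B \<sigma>" "reg \<sigma> 5 = c * n + u" "reg \<sigma> 4 = length qs" "reg \<sigma> 11 = Suc h"
    using frontierD[OF F] S by (simp_all add: scanning_def)
  have row: "c * n + u < k * n" "c * n + n \<le> k * n" using row_less[OF c u(2)] row_le[OF c] by simp_all
  have mv: "mem \<sigma> (c * n + u) = ?v" using frontierD(13)[OF F row(1)] .
  have mark: "mem \<sigma> (k * n + ?v) = (if ?v \<in> set qs then 1 else 0)"
    by (rule frontierD(12)[OF F v])
  have len: "length qs \<le> n" using frontier_length[OF F] .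
  have kc: "k - c = Suc (k - Suc c)" using c by simp
  have time: "unit_time \<sigma> + 10 * Suc (k - Suc c) \<le> t" using S by (simp add: scanning_def kc)
  show ?thesis
  proof (cases "?v \<in> set qs")
    \<comment> \<open>The target is marked already and \<open>Skip\<close> is executed.\<close>
    case True
    have fin: "\<exists>qs'. scanning M t u h qs' (Suc c) \<sigma>'"
      if s: "env \<sigma>'" "mem \<sigma>' = mem \<sigma>" "reg \<sigma>' 4 = length qs" "reg \<sigma>' 11 = Suc h"
        "reg \<sigma>' 5 = c * n + u + n" "unit_time \<sigma>' \<le> unit_time \<sigma> + 10" for \<sigma>'
    proof -
      have "frontier M qs \<sigma>'" using frontier_transfer[OF F s(1,2)] s(3) e(8) by simp
      then have "scanning M t u h qs (Suc c) \<sigma>'"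
        using s(4-6) S c True time by (auto simp: scanning_def less_Suc_eq)
      then show ?thesis by blast
    qed
    show ?thesis
      unfolding follow_edge_def
      apply (rule ensures_if_runs[where B = B])
          subgoal using e B' row by (auto intro!: bit_bounded_charge)
      apply (simp add: e; fail)+
      apply (rule runs_last)
      apply (rule runs_step runs_If_Equal | (simp add: e mv mark True; fail) |
        (use B' row v in \<open>auto simp add: e mv mark True; fail\<close>))+
      apply (rule runs_Skip)
      apply (rule fin; use e in \<open>simp add: config_def env_def; fail\<close>)
      done
  next
    case False
    have len': "length qs < n"
    proof -
      have "card (insert ?v (set qs)) \<le> card {..<n}"
        using frontierD(9)[OF F] v by (intro card_mono) auto
      then show ?thesis using frontierD(8)[OF F] False by (simp add: distinct_card)
    qed
    have fin: "\<exists>qs'. scanning M t u h qs' (Suc c) \<sigma>'"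
      if s: "env \<sigma>'" "reg \<sigma>' 4 = Suc (length qs)"
        "mem \<sigma>' = (mem \<sigma>)(k * n + ?v := 1, k * n + n + length qs := ?v)" "reg \<sigma>' 11 = Suc h"
        "reg \<sigma>' 5 = c * n + u + n" "unit_time \<sigma>' \<le> unit_time \<sigma> + 10" for \<sigma>'
    proof -
      have "frontier M (qs @ [?v]) \<sigma>'" by (rule frontier_append[OF F False v refl c u(1) s(1-3)])
      moreover have "expanded M (qs @ [?v]) h"
        using S by (auto simp: scanning_def expanded_def nth_append)
      ultimately have "scanning M t u h (qs @ [?v]) (Suc c) \<sigma>'"
        using s(4-6) S c time by (auto simp: scanning_def nth_append less_Suc_eq)
      then show ?thesis by blast
    qed
    show ?thesis
      unfolding follow_edge_def
      apply (rule ensures_if_runs[where B = B])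
          subgoal using e B' row by (auto intro!: bit_bounded_charge)
      apply (simp add: e; fail)+
      apply (rule runs_last)
      apply (rule runs_step runs_If_Equal | (simp add: e mv mark False; fail) |
        (use B' row v len' in \<open>auto simp add: e mv mark False; fail\<close>))+
      apply (rule runs_Skip)
      apply (rule fin; use e in \<open>simp add: config_def env_def; fail\<close>)
      apply (simp add: e mark False)
      done
  qed
qed

lemma scan_vertex:
  assumes S: "scanning M t u h qs 0 \<sigma>" and M: "\<And>c u. c < k \<Longrightarrow> u < n \<Longrightarrow> M (c * n + u) < n"
  shows "ensures (While (Less 5 3) follow_edge) \<sigma>
    (\<lambda>\<sigma>'. \<exists>qs'. frontier M qs' \<sigma>' \<and> expanded M qs' (Suc h) \<and> Suc h \<le> length qs' \<and> reg \<sigma>' 11 = Suc h \<and>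
      unit_time \<sigma>' \<le> t + 1)"
proof (rule ensures_While[where I = "\<lambda>\<sigma>'. \<exists>qs' c. scanning M t u h qs' c \<sigma>'" and m = "\<lambda>\<sigma>'. k * n - reg \<sigma>' 5"])
  show "\<exists>qs' c. scanning M t u h qs' c \<sigma>" using S by blast
next
  fix \<sigma>' assume "\<exists>qs' c. scanning M t u h qs' c \<sigma>'" and h: "holds (Less 5 3) \<sigma>'"
  then obtain qs' c where s: "scanning M t u h qs' c \<sigma>'" by blast
  have F: "frontier M qs' \<sigma>'" using s by (simp add: scanning_def)
  have "c * n + u < k * n" using s h frontierD(4)[OF F] by (simp add: scanning_def)
  then have "c < k" using s by (cases "c = k") (auto simp: scanning_def)
  have m: "k * n - reg \<sigma>'' 5 < k * n - reg \<sigma>' 5" if "scanning M t u h qs'' (Suc c) \<sigma>''" for qs'' \<sigma>''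
    using that s n \<open>c * n + u < k * n\<close> by (simp add: scanning_def)
  show "ensures follow_edge (charge_test (Less 5 3) \<sigma>')
      (\<lambda>\<sigma>''. (\<exists>qs' c. scanning M t u h qs' c \<sigma>'') \<and> k * n - reg \<sigma>'' 5 < k * n - reg \<sigma>' 5)"
    by (rule ensures_mono[OF follow_edge[OF s \<open>c < k\<close> M]]) (use m in blast)+
next
  fix \<sigma>' assume "\<exists>qs' c. scanning M t u h qs' c \<sigma>'" and h: "\<not> holds (Less 5 3) \<sigma>'"
  then obtain qs' c where s: "scanning M t u h qs' c \<sigma>'" by blast
  have F: "frontier M qs' \<sigma>'" using s by (simp add: scanning_def)
  have un: "u < n" using s frontierD(11)[OF F, of h] by (simp add: scanning_def)
  have "\<not> c < k" using row_less[OF _ un, of c] s h frontierD(4)[OF F] by (auto simp: scanning_def)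
  then have c: "c = k" using s by (simp add: scanning_def)
  have "expanded M qs' (Suc h)" using s c by (auto simp: scanning_def expanded_def less_Suc_eq)
  moreover have "frontier M qs' (charge_test (Less 5 3) \<sigma>')"
  proof (rule frontier_transfer[OF F])
    show "env (charge_test (Less 5 3) \<sigma>')"
      using frontierD[OF F] s un B' c unfolding env_def
      by (simp add: scanning_def bit_bounded_test del: charge_test.simps)
  qed simp_all
  ultimately show "\<exists>qs'. frontier M qs' (charge_test (Less 5 3) \<sigma>') \<and> expanded M qs' (Suc h) \<and>
      Suc h \<le> length qs' \<and> reg (charge_test (Less 5 3) \<sigma>') 11 = Suc h \<and>
      unit_time (charge_test (Less 5 3) \<sigma>') \<le> t + 1"
    using s by (intro exI[of _ qs']) (auto simp: scanning_def simp del: charge_test.simps)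
qed

lemma search:
  assumes C: "cleared M \<sigma>" and M: "\<And>c u. c < k \<Longrightarrow> u < n \<Longrightarrow> M (c * n + u) < n"
  shows "ensures search \<sigma> (\<lambda>\<sigma>'. \<exists>qs. frontier M qs \<sigma>' \<and> expanded M qs (length qs) \<and>
    unit_time \<sigma>' \<le> unit_time \<sigma> + (10 * k + 5) * n + 5)"
proof -
  let ?t = "unit_time \<sigma> + (10 * k + 5) * n + 4"
  let ?body = "Do (Add 9 12 11);; Do (Load 5 9);; Do (Add 11 11 2);; While (Less 5 3) follow_edge"
  let ?I = "\<lambda>\<sigma>'. \<exists>qs h. frontier M qs \<sigma>' \<and> expanded M qs h \<and> h \<le> length qs \<and> reg \<sigma>' 11 = h \<and>
    unit_time \<sigma>' + (10 * k + 5) * (n - h) \<le> ?t"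
  have loop: "ensures (While (Less 11 4) ?body) \<sigma>0 (\<lambda>\<sigma>'. \<exists>qs. frontier M qs \<sigma>' \<and>
      expanded M qs (length qs) \<and> unit_time \<sigma>' \<le> ?t + 1)" if "?I \<sigma>0" for \<sigma>0
  proof (rule ensures_While[where I = ?I and m = "\<lambda>\<sigma>'. n - reg \<sigma>' 11", OF that])
    fix \<sigma>' assume "?I \<sigma>'" and hld: "holds (Less 11 4) \<sigma>'"
    then obtain qs h where F: "frontier M qs \<sigma>'" and E: "expanded M qs h" and h: "reg \<sigma>' 11 = h"
      and time: "unit_time \<sigma>' + (10 * k + 5) * (n - h) \<le> ?t" by blast
    have hl: "h < length qs" using hld F h by (simp add: frontier_def)
    have hn: "h < n" using hl frontier_length[OF F] by simp
    then have nh: "n - h = Suc (n - Suc h)" by simp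
    have time': "unit_time \<sigma>' + 10 * k + 5 + (10 * k + 5) * (n - Suc h) \<le> ?t"
      using time unfolding nh by simp
    let ?u = "qs ! h"
    have u: "?u < n" by (rule frontierD(11)[OF F hl])
    have e: "reg \<sigma>' 0 = n" "reg \<sigma>' (Suc 0) = 0" "reg \<sigma>' 2 = 1" "reg \<sigma>' 3 = k * n"
      "reg \<sigma>' 12 = k * n + n" "bit_bounded B \<sigma>'" "reg \<sigma>' 4 = length qs" "reg \<sigma>' 11 = h"
      "mem \<sigma>' (k * n + n + h) = ?u"
      using frontierD[OF F] hl h by simp_all
    have scan: "ensures (While (Less 5 3) follow_edge) \<sigma>'' (\<lambda>\<sigma>''. ?I \<sigma>'' \<and> n - reg \<sigma>'' 11 < n - reg \<sigma>' 11)"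
      if s: "env \<sigma>''" "mem \<sigma>'' = mem \<sigma>'" "reg \<sigma>'' 4 = length qs" "reg \<sigma>'' 11 = Suc h"
        "reg \<sigma>'' 5 = ?u" "unit_time \<sigma>'' = unit_time \<sigma>' + 4" for \<sigma>''
    proof -
      have "frontier M qs \<sigma>''" using frontier_transfer[OF F s(1,2)] s(3) e(7) by simp
      then have "scanning M (unit_time \<sigma>' + 4 + 10 * k) ?u h qs 0 \<sigma>''"
        using E hl s by (simp add: scanning_def)
      from scan_vertex[OF this M] show ?thesis
      proof (rule ensures_mono)
        fix \<sigma>'' assume "\<exists>qs'. frontier M qs' \<sigma>'' \<and> expanded M qs' (Suc h) \<and> Suc h \<le> length qs' \<and>
          reg \<sigma>'' 11 = Suc h \<and> unit_time \<sigma>'' \<le> unit_time \<sigma>' + 4 + 10 * k + 1"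
        then obtain qs' where q: "frontier M qs' \<sigma>''" "expanded M qs' (Suc h)" "Suc h \<le> length qs'"
          "reg \<sigma>'' 11 = Suc h" "unit_time \<sigma>'' \<le> unit_time \<sigma>' + 4 + 10 * k + 1" by blast
        have "unit_time \<sigma>'' + (10 * k + 5) * (n - Suc h) \<le> ?t" using q(5) time' by linarith
        with q have "?I \<sigma>''" by blast
        moreover have "n - reg \<sigma>'' 11 < n - reg \<sigma>' 11" using nh by (simp add: q(4) h)
        ultimately show "?I \<sigma>'' \<and> n - reg \<sigma>'' 11 < n - reg \<sigma>' 11" by blast
      qed
    qed
    show "ensures ?body (charge_test (Less 11 4) \<sigma>') (\<lambda>\<sigma>''. ?I \<sigma>'' \<and> n - reg \<sigma>'' 11 < n - reg \<sigma>' 11)"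
      apply (rule ensures_if_runs[where B = B])
          subgoal using e B' hn frontier_length[OF F] by (auto intro!: bit_bounded_charge)
      apply (simp add: e; fail)+
      apply (rule runs_step | (simp add: e; fail) | (use B' hn u in \<open>auto simp add: e; fail\<close>))+
      apply (unfold runs_def, intro allI impI)
      apply (rule scan; use e in \<open>simp add: config_def env_def; fail\<close>)
      done
  next
    fix \<sigma>' assume "?I \<sigma>'" and hld: "\<not> holds (Less 11 4) \<sigma>'"
    then obtain qs h where F: "frontier M qs \<sigma>'" and E: "expanded M qs h" "h \<le> length qs" and h: "reg \<sigma>' 11 = h"
      and time: "unit_time \<sigma>' + (10 * k + 5) * (n - h) \<le> ?t" by blast
    have hq: "h = length qs" using hld frontierD(7)[OF F] h E(2) by simp
    moreover have "frontier M qs (charge_test (Less 11 4) \<sigma>')"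
    proof (rule frontier_transfer[OF F])
      show "env (charge_test (Less 11 4) \<sigma>')"
        using frontierD[OF F] h hq frontier_length[OF F] B' unfolding env_def
        by (simp add: bit_bounded_test del: charge_test.simps)
    qed simp_all
    ultimately show "\<exists>qs. frontier M qs (charge_test (Less 11 4) \<sigma>') \<and> expanded M qs (length qs) \<and>
        unit_time (charge_test (Less 11 4) \<sigma>') \<le> ?t + 1"
      using E time by (intro exI[of _ qs]) simp
  qed
  have e: "reg \<sigma> 0 = n" "reg \<sigma> (Suc 0) = 0" "reg \<sigma> 2 = 1" "reg \<sigma> 3 = k * n" "reg \<sigma> 12 = k * n + n"
    "bit_bounded B \<sigma>"
    using C by (auto simp: cleared_def env_def)
  have start: "?I \<sigma>0"
    if s: "env \<sigma>0" "reg \<sigma>0 4 = 1" "reg \<sigma>0 11 = 0" "mem \<sigma>0 = (mem \<sigma>)(k * n := 1, k * n + n := 0)"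
      "unit_time \<sigma>0 = unit_time \<sigma> + 4" for \<sigma>0
  proof -
    have "mem \<sigma>0 (k * n + v) = (if v \<in> set [0] then 1 else 0)" if "v < n" for v
      using C that by (simp add: cleared_def s(4))
    then have "frontier (M) [0] \<sigma>0"
      using C s n by (auto simp: frontier_def cleared_def)
    with s show ?thesis
      by (intro exI[of _ "[0]"] exI[of _ 0]) (simp add: expanded_def)
  qed
  show ?thesis
    unfolding search_def
    apply (rule ensures_if_runs[where B = B, OF e(6) refl refl refl])
    apply (rule runs_step | (simp add: e; fail) | (use B' n in \<open>auto simp add: e; fail\<close>))+
    apply (unfold runs_def, intro allI impI)
    subgoal premises cfg for \<sigma>'
    proof -
      have "?I \<sigma>'" by (rule start) (use cfg e in \<open>simp_all add: config_def env_def\<close>)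
      from loop[OF this] show ?thesis by (simp add: add_ac)
    qed
    done
qed

text \<open>At the end of the search the discovered vertices form the least stable set that contains 0.\<close>

lemma search_transitive:
  assumes T: "T \<in> perm_tables k n" and M: "\<And>c u. c < k \<Longrightarrow> u < n \<Longrightarrow> M (c * n + u) = T c u"
    and F: "frontier M qs \<sigma>" and E: "expanded M qs (length qs)"
  shows "length qs = n \<longleftrightarrow> T \<in> transitive_tables k n"
proof
  assume len: "length qs = n"
  have full: "set qs = {..<n}"
    using F len by (intro card_subset_eq) (auto simp: frontier_def distinct_card)
  show "T \<in> transitive_tables k n"
    unfolding transitive_tables_def
  proof (intro CollectI conjI T allI impI)
    fix S assume S: "S \<subseteq> {..<n}" "0 \<in> S" "stable k T S"
    have "M (c * n + u) \<in> S" if "c < k" "u \<in> S" "u < n" for c u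
      using S(3) that M[OF that(1,3)] by (simp add: stable_def)
    then have "set qs \<subseteq> S" using F S(2) by (simp add: frontier_def)
    with full S(1) show "S = {..<n}" by blast
  qed
next
  assume tr: "T \<in> transitive_tables k n"
  have "set qs = {..<n}"
  proof (rule transitive_tablesD[OF tr])
    fix c u assume c: "c < k" and u: "u \<in> set qs"
    then obtain j where j: "j < length qs" "qs ! j = u" by (auto simp: in_set_conv_nth)
    have "u < n" using F u by (auto simp: frontier_def)
    then have "T c u = M (c * n + qs ! j)" using M[OF c] j(2) by simp
    with E j(1) c show "T c u \<in> set qs" by (simp add: expanded_def)
  qed (use F in \<open>auto simp: frontier_def\<close>)
  then show "length qs = n" using F distinct_card[of qs] by (simp add: frontier_def)
qed

definition trial_time :: nat where
  "trial_time = (10 * n + 4) * k + 2 + (3 * n + 2) + ((10 * k + 5) * n + 5)"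

definition table_of :: "ram \<Rightarrow> nat \<Rightarrow> nat \<Rightarrow> nat" where
  "table_of \<sigma> = (\<lambda>c\<in>{..<k}. \<lambda>u. if u < n then mem \<sigma> (c * n + u) else u)"

lemma table_of_eq:
  assumes T: "T \<in> perm_tables k n" and M: "\<And>c u. c < k \<Longrightarrow> u < n \<Longrightarrow> mem \<sigma> (c * n + u) = T c u"
  shows "table_of \<sigma> = T"
proof
  fix c
  show "table_of \<sigma> c = T c"
  proof (cases "c < k")
    case True
    then show ?thesis
      using M permutes_not_in[OF perm_tables_permutes[OF T True]] by (auto simp: table_of_def fun_eq_iff)
  next
    case False
    then show ?thesis using T by (simp add: table_of_def perm_tables_def PiE_def extensional_def)
  qed
qed

lemma trial:
  assumes "env \<sigma>"
  shows "rel_spmf (\<lambda>\<sigma>' T. env \<sigma>' \<and> reg \<sigma>' 4 \<le> n \<and> (reg \<sigma>' 4 < n \<longleftrightarrow> T \<notin> transitive_tables k n) \<and>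
      table_of \<sigma>' = T \<and> unit_time \<sigma>' \<le> unit_time \<sigma> + trial_time)
    (exec trial \<sigma>) (spmf_of_set (perm_tables k n))"
proof -
  let ?t = "unit_time \<sigma> + (10 * n + 4) * k + 2"
  have "rel_spmf (\<lambda>\<sigma>' T. T \<in> perm_tables k n \<and> rows ?t k \<sigma>' T) (exec shuffle_all \<sigma>) (spmf_of_set (perm_tables k n))"
    using shuffle_all[OF assms] by (rule rel_spmf_mono_strong) (simp add: finite_perm_tables)
  then show ?thesis
    unfolding trial_def
  proof (rule rel_spmf_Seq2)
    fix \<sigma>1 T assume "T \<in> perm_tables k n \<and> rows ?t k \<sigma>1 T"
    then have T: "T \<in> perm_tables k n" and e: "env \<sigma>1" and t1: "unit_time \<sigma>1 \<le> ?t"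
      and M: "\<And>c u. c < k \<Longrightarrow> u < n \<Longrightarrow> mem \<sigma>1 (c * n + u) = T c u" by (auto simp: rows_def)
    have Mn: "mem \<sigma>1 (c * n + u) < n" if "c < k" "u < n" for c u
      using M[OF that] perm_tables_less[OF T that(1)] that(2) by simp
    have "ensures search \<sigma>2 (\<lambda>\<sigma>'. env \<sigma>' \<and> reg \<sigma>' 4 \<le> n \<and> (reg \<sigma>' 4 < n \<longleftrightarrow> T \<notin> transitive_tables k n) \<and>
        table_of \<sigma>' = T \<and> unit_time \<sigma>' \<le> unit_time \<sigma> + trial_time)"
      if s2: "cleared (mem \<sigma>1) \<sigma>2 \<and> unit_time \<sigma>2 \<le> unit_time \<sigma>1 + 3 * n + 2" for \<sigma>2
    proof (rule ensures_mono[OF search[OF conjunct1[OF s2] Mn]], assumption, assumption)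
      fix \<sigma>' assume "\<exists>qs. frontier (mem \<sigma>1) qs \<sigma>' \<and> expanded (mem \<sigma>1) qs (length qs) \<and>
        unit_time \<sigma>' \<le> unit_time \<sigma>2 + (10 * k + 5) * n + 5"
      then obtain qs where F: "frontier (mem \<sigma>1) qs \<sigma>'" and E: "expanded (mem \<sigma>1) qs (length qs)"
        and t: "unit_time \<sigma>' \<le> unit_time \<sigma>2 + (10 * k + 5) * n + 5" by blast
      have "reg \<sigma>' 4 = length qs" "env \<sigma>'" using F by (auto simp: frontier_def)
      moreover have "table_of \<sigma>' = T"
        using F M row_less by (intro table_of_eq[OF T]) (simp add: frontier_def)
      moreover have "unit_time \<sigma>' \<le> unit_time \<sigma> + trial_time"
        using t t1 s2 by (simp add: trial_time_def)
      ultimately show "env \<sigma>' \<and> reg \<sigma>' 4 \<le> n \<and> (reg \<sigma>' 4 < n \<longleftrightarrow> T \<notin> transitive_tables k n) \<and>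
        table_of \<sigma>' = T \<and> unit_time \<sigma>' \<le> unit_time \<sigma> + trial_time"
        using search_transitive[OF T M F E] frontier_length[OF F] by auto
    qed
    then have "ensures (clear_marks;; search) \<sigma>1 (\<lambda>\<sigma>'. env \<sigma>' \<and> reg \<sigma>' 4 \<le> n \<and>
        (reg \<sigma>' 4 < n \<longleftrightarrow> T \<notin> transitive_tables k n) \<and>
        table_of \<sigma>' = T \<and> unit_time \<sigma>' \<le> unit_time \<sigma> + trial_time)"
      using ensures_mono[OF clear_marks[OF e]] by simp
    then show "ensures (clear_marks;; search) \<sigma>1 (\<lambda>\<sigma>'. env \<sigma>' \<and> reg \<sigma>' 4 \<le> n \<and>
        (reg \<sigma>' 4 < n \<longleftrightarrow> T \<notin> transitive_tables k n) \<and>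
        table_of \<sigma>' = T \<and> unit_time \<sigma>' \<le> unit_time \<sigma> + trial_time)" .
  qed
qed

lemma add_times:
  assumes "reg \<sigma> 0 = n" "reg \<sigma> 3 = c * n" "c + j \<le> k" "bit_bounded B \<sigma>"
  shows "ensures (add_times j) \<sigma> (\<lambda>\<sigma>'. (\<forall>r. r \<noteq> 3 \<longrightarrow> reg \<sigma>' r = reg \<sigma> r) \<and> reg \<sigma>' 3 = (c + j) * n \<and>
    bit_bounded B \<sigma>' \<and> unit_time \<sigma>' = unit_time \<sigma> + j)"
  using assms
proof (induction j arbitrary: c \<sigma>)
  case (Suc j)
  let ?\<sigma> = "set_reg 3 (c * n + n) (charge [c * n, n, c * n + n] \<sigma>)"
  have "c * n + n \<le> k * n" using row_le[of c] Suc.prems by simp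
  then have "bit_bounded B ?\<sigma>" using Suc.prems B' by (auto intro!: bit_bounded_charge)
  then have "ensures (add_times j) ?\<sigma> (\<lambda>\<sigma>'. (\<forall>r. r \<noteq> 3 \<longrightarrow> reg \<sigma>' r = reg ?\<sigma> r) \<and> reg \<sigma>' 3 = (Suc c + j) * n \<and>
    bit_bounded B \<sigma>' \<and> unit_time \<sigma>' = unit_time ?\<sigma> + j)"
    using Suc.prems by (intro Suc.IH) auto
  from ensures_mono[OF this] show ?case using Suc.prems by simp
qed simp

lemma prepare:
  "ensures (prepare k) (init n) (\<lambda>\<sigma>. env \<sigma> \<and> reg \<sigma> 4 = 0 \<and> unit_time \<sigma> = k + 2)"
proof -
  let ?\<sigma> = "set_reg 2 1 (charge [1] (init n))"
  have i: "reg (init n) = (\<lambda>_. 0)(0 := n)" "unit_time (init n) = 0" by (simp_all add: init_def)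
  have n_le: "n \<le> B" using B' by simp
  have "bit_bounded B (init n)" by (simp add: bit_bounded_def init_def)
  then have b: "bit_bounded B ?\<sigma>" using n_le n by (auto intro!: bit_bounded_charge)
  have "ensures (add_times k) ?\<sigma> (\<lambda>\<sigma>'. (\<forall>r. r \<noteq> 3 \<longrightarrow> reg \<sigma>' r = reg ?\<sigma> r) \<and> reg \<sigma>' 3 = (0 + k) * n \<and>
      bit_bounded B \<sigma>' \<and> unit_time \<sigma>' = unit_time ?\<sigma> + k)"
    by (rule add_times) (use b in \<open>simp_all add: i\<close>)
  then have "ensures (add_times k;; Do (Add 12 3 0)) ?\<sigma> (\<lambda>\<sigma>. env \<sigma> \<and> reg \<sigma> 4 = 0 \<and> unit_time \<sigma> = k + 2)"
    unfolding ensures_simps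
    by (rule ensures_mono) (use B' in \<open>auto simp: env_def i intro!: bit_bounded_charge\<close>)
  then show ?thesis by (simp add: prepare_def)
qed

end


section \<open>Law and running time of the sampler\<close>

context sizes
begin

lemma rejection_loop_trial:
  assumes "k \<ge> 2"
  shows "rejection_loop (Less 4 0) trial (\<lambda>\<sigma>. env \<sigma> \<and> reg \<sigma> 4 \<le> n) (perm_tables k n)
    (transitive_tables k n) table_of (trial_time + 1)"
proof
  show "finite (perm_tables k n)" by (rule finite_perm_tables)
  show "transitive_tables k n \<subseteq> perm_tables k n" by (auto simp: transitive_tables_def)
  show "2 * card (perm_tables k n - transitive_tables k n) \<le> card (perm_tables k n)"
    using assms n by (rule card_intransitive_le)
  show "transitive_tables k n \<noteq> {}" using assms n by (rule transitive_tables_nonempty)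
  show "table_of (charge_test (Less 4 0) \<sigma>) = table_of \<sigma>" for \<sigma>
    by (simp only: table_of_def charge_test_simps)
next
  fix \<sigma> assume I: "env \<sigma> \<and> reg \<sigma> 4 \<le> n"
  have "n \<le> B" using B' by simp
  with I have "env (charge_test (Less 4 0) \<sigma>)"
    by (auto simp: env_def simp del: charge_test.simps intro!: bit_bounded_test)
  from trial[OF this]
  show "rel_spmf (\<lambda>\<sigma>' x. (env \<sigma>' \<and> reg \<sigma>' 4 \<le> n) \<and> (holds (Less 4 0) \<sigma>' \<longleftrightarrow> x \<notin> transitive_tables k n) \<and>
      table_of \<sigma>' = x \<and> unit_time \<sigma>' \<le> unit_time \<sigma> + (trial_time + 1))
      (exec trial (charge_test (Less 4 0) \<sigma>)) (spmf_of_set (perm_tables k n))"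
    by (rule rel_spmf_mono) (auto simp: env_def simp del: charge_test.simps)
qed

lemma sampler:
  assumes "k \<ge> 2"
  shows lossless_sampler: "lossless_spmf (run (sampler k) n)"
    and map_sampler: "map_spmf table_of (run (sampler k) n) = spmf_of_set (transitive_tables k n)"
    and env_sampler: "\<And>\<sigma>. \<sigma> \<in> set_spmf (run (sampler k) n) \<Longrightarrow> env \<sigma>"
    and time_sampler: "expected unit_time (run (sampler k) n) \<le> of_nat (k + 2 + 2 * (trial_time + 2))"
proof -
  interpret rejection_loop "Less 4 0" trial "\<lambda>\<sigma>. env \<sigma> \<and> reg \<sigma> 4 \<le> n" "perm_tables k n"
    "transitive_tables k n" table_of "trial_time + 1"
    using assms by (rule rejection_loop_trial)
  let ?P = "exec (prepare k) (init n)"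
  have run: "run (sampler k) n = bind_spmf ?P loop" by (simp add: run_def sampler_def)
  have P: "lossless_spmf ?P"
    "\<And>\<sigma>. \<sigma> \<in> set_spmf ?P \<Longrightarrow> env \<sigma> \<and> reg \<sigma> 4 \<le> n" "\<And>\<sigma>. \<sigma> \<in> set_spmf ?P \<Longrightarrow> holds (Less 4 0) \<sigma>"
    "\<And>\<sigma>. \<sigma> \<in> set_spmf ?P \<Longrightarrow> unit_time \<sigma> = k + 2"
    using prepare n by (auto simp: ensures_def env_def)
  show "lossless_spmf (run (sampler k) n)"
    unfolding run using P(1) lossless_loop[OF P(2,3)] by simp
  have "map_spmf table_of (run (sampler k) n) = bind_spmf ?P (\<lambda>\<sigma>. map_spmf table_of (loop \<sigma>))"
    by (simp add: run map_spmf_conv_bind_spmf)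
  also have "\<dots> = bind_spmf ?P (\<lambda>_. spmf_of_set (transitive_tables k n))"
    using map_loop[OF P(2,3)] by (intro bind_spmf_cong refl)
  also have "\<dots> = spmf_of_set (transitive_tables k n)"
    using P(1) by (simp add: bind_spmf_const lossless_weight_spmfD)
  finally show "map_spmf table_of (run (sampler k) n) = spmf_of_set (transitive_tables k n)" .
  have post: "env (charge_test (Less 4 0) \<sigma>)" if "env \<sigma> \<and> reg \<sigma> 4 \<le> n" for \<sigma>
  proof -
    have "n \<le> B" using B' by simp
    with that show ?thesis
      by (auto simp: env_def simp del: charge_test.simps intro!: bit_bounded_test)
  qed
  show "env \<sigma>" if "\<sigma> \<in> set_spmf (run (sampler k) n)" for \<sigma>
  proof -
    have "\<exists>\<sigma>0. \<sigma>0 \<in> set_spmf ?P \<and> \<sigma> \<in> set_spmf (loop \<sigma>0)"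
      using that unfolding run set_bind_spmf bind_UNION comp_def by blast
    then obtain \<sigma>0 where s: "\<sigma>0 \<in> set_spmf ?P" "\<sigma> \<in> set_spmf (loop \<sigma>0)" by blast
    show ?thesis by (rule support_loop[where P = env, OF P(2)[OF s(1)] P(3)[OF s(1)] post s(2)])
  qed
  have "expected unit_time (run (sampler k) n) = (\<integral>\<^sup>+ \<sigma>. expected unit_time (loop \<sigma>) \<partial>measure_spmf ?P)"
    by (simp only: run expected_def nn_integral_bind_spmf)
  also have "\<dots> \<le> (\<integral>\<^sup>+ \<sigma>. of_nat (k + 2 + 2 * (trial_time + 2)) \<partial>measure_spmf ?P)"
  proof (rule nn_integral_mono_AE, unfold AE_measure_spmf_iff, rule ballI)
    fix \<sigma> assume s: "\<sigma> \<in> set_spmf ?P"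
    show "expected unit_time (loop \<sigma>) \<le> of_nat (k + 2 + 2 * (trial_time + 2))"
      using expected_time_loop[OF P(2)[OF s] P(3)[OF s]] P(4)[OF s] by (simp add: add.assoc)
  qed
  also have "\<dots> \<le> of_nat (k + 2 + 2 * (trial_time + 2))" by (rule nn_integral_spmf_le) simp
  finally show "expected unit_time (run (sampler k) n) \<le> of_nat (k + 2 + 2 * (trial_time + 2))" .
qed

lemma bit_time_sampler:
  assumes "k \<ge> 2"
  shows "expected bit_time (run (sampler k) n)
    \<le> of_nat (1 + 3 * floorlog 2 B) * expected unit_time (run (sampler k) n)"
proof -
  have "expected bit_time (run (sampler k) n)
      \<le> (\<integral>\<^sup>+ \<sigma>. of_nat (1 + 3 * floorlog 2 B) * of_nat (unit_time \<sigma>) \<partial>measure_spmf (run (sampler k) n))"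
    unfolding expected_def
  proof (rule nn_integral_mono_AE, unfold AE_measure_spmf_iff, rule ballI)
    fix \<sigma> assume "\<sigma> \<in> set_spmf (run (sampler k) n)"
    then have "bit_time \<sigma> \<le> (1 + 3 * floorlog 2 B) * unit_time \<sigma>"
      using env_sampler[OF assms] by (simp add: env_def bit_bounded_def)
    then show "(of_nat (bit_time \<sigma>) :: ennreal) \<le> of_nat (1 + 3 * floorlog 2 B) * of_nat (unit_time \<sigma>)"
      by (simp only: of_nat_le_iff flip: of_nat_mult)
  qed
  also have "\<dots> = of_nat (1 + 3 * floorlog 2 B) * expected unit_time (run (sampler k) n)"
    unfolding expected_def by (rule nn_integral_cmult) simp
  finally show ?thesis .
qed

lemma total_time_le: "k + 2 + 2 * (trial_time + 2) \<le> (49 * k + 40) * n"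
proof -
  obtain m where "n = Suc m" using n by (cases n) auto
  then show ?thesis unfolding trial_time_def by (simp add: algebra_simps)
qed

end

lemma floorlog_le_ln:
  assumes "x \<ge> 1" shows "real (floorlog 2 x) \<le> ln (real x) / ln 2 + 1"
  using assms of_int_floor_le[of "log 2 (real x)"]
  by (simp add: floorlog_def log_def zero_le_floor)

lemma const_in_bigo_ln: "(\<lambda>_. c :: real) \<in> O(\<lambda>n. ln (real n))"
proof (rule bigoI[of _ "\<bar>c\<bar>"])
  have "norm c \<le> \<bar>c\<bar> * norm (ln (real n))" if "n \<ge> 3" for n
  proof -
    have "exp 1 \<le> real n" using that exp_le by linarith
    then have "1 \<le> ln (real n)" using that by (simp add: ln_ge_iff)
    then have "\<bar>c\<bar> * 1 \<le> \<bar>c\<bar> * norm (ln (real n))" by (intro mult_left_mono) auto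
    then show ?thesis by simp
  qed
  then show "\<forall>\<^sub>F n in sequentially. norm c \<le> \<bar>c\<bar> * norm (ln (real n))"
    by (rule eventually_sequentiallyI)
qed

theorem mainTheorem5:
  fixes A :: "'a set" and code :: "'a \<Rightarrow> nat"
  assumes "finite A" and "card A \<ge> 2"
    and "bij_betw code A {..<card A}"
  shows "\<exists>p :: com.
    (\<forall>n\<ge>1.
       lossless_spmf (run p n) \<and>
       (\<forall>\<sigma>\<in>set_spmf (run p n). \<exists>H\<in>finite_index_subgroups A n.
          graphical_representation A H (output_graph A code \<sigma>) (output_vertex \<sigma>)) \<and>
       map_spmf (\<lambda>\<sigma>. subgroup_of_graph (output_graph A code \<sigma>) (output_vertex \<sigma>)) (run p n)
         = spmf_of_set (finite_index_subgroups A n) \<and>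
       expected unit_time (run p n) < \<infinity> \<and>
       expected bit_time (run p n) < \<infinity>) \<and>
    (\<lambda>n. enn2real (expected unit_time (run p n))) \<in> O(\<lambda>n. real n) \<and>
    (\<lambda>n. enn2real (expected bit_time (run p n))) \<in> O(\<lambda>n. real n * ln (real n))"
proof -
  define k where "k = card A"
  define p where "p = sampler k"
  have k2: "k \<ge> 2" using assms(2) by (simp add: k_def)
  let ?B = "\<lambda>n. (k + 2) * n" and ?K = "49 * k + 40"
  have sz: "sizes k n (?B n)" if "n \<ge> 1" for n
    using that by unfold_locales auto
  have lc: "letter_code A code k n" if "n \<ge> 1" for n
    using that k2 assms by unfold_locales (auto simp: k_def)
  have unit: "expected unit_time (run p n) \<le> of_nat (?K * n)" if "n \<ge> 1" for n
  proof -
    interpret sizes k n "?B n" using sz[OF that] .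
    show ?thesis
      unfolding p_def by (rule order_trans[OF time_sampler[OF k2]]) (simp only: of_nat_le_iff total_time_le)
  qed
  have bit: "expected bit_time (run p n) \<le> of_nat ((1 + 3 * floorlog 2 (?B n)) * (?K * n))" if "n \<ge> 1" for n
  proof -
    interpret sizes k n "?B n" using sz[OF that] .
    show ?thesis
      unfolding p_def of_nat_mult[of "1 + 3 * floorlog 2 (?B n)"]
      using unit[OF that] by (intro order_trans[OF bit_time_sampler[OF k2]] mult_left_mono) (simp_all add: p_def)
  qed
  have correct: "lossless_spmf (run p n) \<and>
       (\<forall>\<sigma>\<in>set_spmf (run p n). \<exists>H\<in>finite_index_subgroups A n.
          graphical_representation A H (output_graph A code \<sigma>) (output_vertex \<sigma>)) \<and>
       map_spmf (\<lambda>\<sigma>. subgroup_of_graph (output_graph A code \<sigma>) (output_vertex \<sigma>)) (run p n)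
         = spmf_of_set (finite_index_subgroups A n)" if n: "n \<ge> 1" for n
  proof -
    interpret sizes k n "?B n" using sz[OF n] .
    interpret letter_code A code k n using lc[OF n] .
    have out: "output_graph A code \<sigma> = graph (table_of \<sigma>) \<and> output_vertex \<sigma> = 0 \<and>
        table_of \<sigma> \<in> transitive_tables k n" if s: "\<sigma> \<in> set_spmf (run p n)" for \<sigma>
    proof -
      have e: "reg \<sigma> 0 = n" "reg \<sigma> (Suc 0) = 0"
        using env_sampler[OF k2 s[unfolded p_def]] unfolding env_def by simp_all
      have "table_of \<sigma> \<in> set_spmf (map_spmf table_of (run p n))" using s by simp
      then have "table_of \<sigma> \<in> transitive_tables k n"
        unfolding p_def map_sampler[OF k2] by (simp add: set_spmf_of_set split: if_splits)
      then show ?thesis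
        using code_less
        by (auto simp: output_graph_def output_vertex_def e Let_def table_graph_def table_of_def)
    qed
    have "map_spmf (\<lambda>\<sigma>. subgroup_of_graph (output_graph A code \<sigma>) (output_vertex \<sigma>)) (run p n)
        = map_spmf (\<lambda>\<sigma>. grp (table_of \<sigma>)) (run p n)"
      using out by (intro map_spmf_cong refl) simp
    also have "\<dots> = map_spmf grp (map_spmf table_of (run p n))"
      by (simp add: spmf.map_comp comp_def)
    also have "\<dots> = spmf_of_set (finite_index_subgroups A n)"
      unfolding p_def map_sampler[OF k2] by (rule uniform_subgroups)
    finally have "map_spmf (\<lambda>\<sigma>. subgroup_of_graph (output_graph A code \<sigma>) (output_vertex \<sigma>)) (run p n)
        = spmf_of_set (finite_index_subgroups A n)" .
    moreover have "\<exists>H\<in>finite_index_subgroups A n.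
        graphical_representation A H (output_graph A code \<sigma>) (output_vertex \<sigma>)"
      if "\<sigma> \<in> set_spmf (run p n)" for \<sigma>
      using out[OF that] representation_table grp_in_finite_index_subgroups by auto
    ultimately show ?thesis
      using lossless_sampler[OF k2] by (simp add: p_def)
  qed
  have "(\<lambda>n. enn2real (expected unit_time (run p n))) \<in> O(\<lambda>n. real n)"
  proof (rule bigoI[of _ "real ?K"], rule eventually_sequentiallyI[of 1])
    fix n :: nat assume "n \<ge> 1"
    then have "enn2real (expected unit_time (run p n)) \<le> real (?K * n)"
      using unit by (intro enn2real_leI) (simp_all add: ennreal_of_nat_eq_real_of_nat)
    then show "norm (enn2real (expected unit_time (run p n))) \<le> real ?K * norm (real n)" by simp
  qed
  moreover have "(\<lambda>n. enn2real (expected bit_time (run p n))) \<in> O(\<lambda>n. real n * ln (real n))"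
  proof (rule landau_o.big_trans)
    let ?g = "\<lambda>n. real n * ((4 + 3 * ln (real (k + 2)) / ln 2) + 3 / ln 2 * ln (real n))"
    show "(\<lambda>n. enn2real (expected bit_time (run p n))) \<in> O(?g)"
    proof (rule bigoI[of _ "real ?K"], rule eventually_sequentiallyI[of 1])
      fix n :: nat assume n: "n \<ge> 1"
      have "real (floorlog 2 (?B n)) \<le> ln (real (?B n)) / ln 2 + 1"
        using n by (intro floorlog_le_ln) (simp add: Suc_le_eq)
      also have "ln (real (?B n)) = ln (real (k + 2)) + ln (real n)"
        unfolding of_nat_mult using n by (intro ln_mult_pos) simp_all
      finally have fl: "1 + 3 * real (floorlog 2 (?B n))
          \<le> 4 + 3 * ln (real (k + 2)) / ln 2 + 3 / ln 2 * ln (real n)"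
        by (simp add: field_simps)
      have "enn2real (expected bit_time (run p n)) \<le> real ((1 + 3 * floorlog 2 (?B n)) * (?K * n))"
        using bit[OF n] by (intro enn2real_leI) (simp_all add: ennreal_of_nat_eq_real_of_nat del: of_nat_mult of_nat_add)
      also have "\<dots> = real (?K * n) * (1 + 3 * real (floorlog 2 (?B n)))"
        by (simp only: of_nat_mult of_nat_add of_nat_1 of_nat_numeral mult.commute)
      also have "\<dots> \<le> real (?K * n) * (4 + 3 * ln (real (k + 2)) / ln 2 + 3 / ln 2 * ln (real n))"
        by (intro mult_left_mono fl) simp
      also have "\<dots> = real ?K * ?g n" by (simp only: of_nat_mult mult.assoc)
      also have "\<dots> \<le> real ?K * norm (?g n)"
        unfolding real_norm_def by (intro mult_left_mono abs_ge_self) simp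
      finally show "norm (enn2real (expected bit_time (run p n))) \<le> real ?K * norm (?g n)"
        by simp
    qed
    show "?g \<in> O(\<lambda>n. real n * ln (real n))"
      by (intro landau_o.big_mult landau_o.big_refl sum_in_bigo const_in_bigo_ln
        landau_o.big.cmult_in_iff'[THEN iffD2] ) simp
  qed
  moreover have "expected unit_time (run p n) < \<infinity>" "expected bit_time (run p n) < \<infinity>" if "n \<ge> 1" for n
    using le_less_trans[OF unit[OF that] of_nat_less_top] le_less_trans[OF bit[OF that] of_nat_less_top]
    by simp_all
  ultimately show ?thesis
    using correct by (intro exI[of _ p]) blast
qed

end
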